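(* Let $T>0$ and consider the Cauchy problem $$u_{tt}(t,x)-\sum_{j=1}^{d}\partial_{x_j}\left(h_j(x)\partial_{x_j}u(t,x)\right)=0,\quad (t,x)\in[0,T]\times\mathbb{R}^d,\qquad u(0,x)=u_0(x),\quad u_t(0,x)=u_1(x),\quad x\in\mathbb{R}^d,$$ with (possibly singular, distributional) coefficients $h_1,\dots,h_d$ and initial data $u_0,u_1$. Let the coefficients $h_i$ be positive in the sense that all regularisations $h_{i,\varepsilon}$ are positive, for $i=1,\dots,d$, i.e. there is $c_0>0$ with $h_{i,\varepsilon}\ge c_0$ on $\mathbb{R}^d$ for all $i=1,\dots,d$ and $\varepsilon\in(0,1]$. Assume that the regularisations of $h_i,u_0,u_1$ satisfy: there exist $N_0,N_1,N_2\in\mathbb{N}_0$ such that $$\|h_{i,\varepsilon}\|_{W^{1,\infty}}\lesssim\varepsilon^{-N_0}\ \ (i=1,\dots,d),\qquad \|u_{0,\varepsilon}\|_{H^2}\lesssim\varepsilon^{-N_1},\qquad \|u_{1,\varepsilon}\|_{H^1}\lesssim\varepsilon^{-N_2}.$$ Then the Cauchy problem has a very weak solution.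
   Context: Regularisations: let $\psi$ be a Friedrichs mollifier, i.e. $\psi\in C_0^\infty(\mathbb{R}^d)$, $\psi\ge0$, $\int\psi=1$, and $\psi_\varepsilon(x)=\varepsilon^{-d}\psi(x/\varepsilon)$ for $\varepsilon\in(0,1]$. The regularisations are the nets of smooth functions $h_{i,\varepsilon}=h_i*\psi_\varepsilon$ ($i=1,\dots,d$), $u_{0,\varepsilon}=u_0*\psi_\varepsilon$, $u_{1,\varepsilon}=u_1*\psi_\varepsilon$. Notation: $a\lesssim b$ means $a\le cb$ for some constant $c>0$; in estimates for nets, $c$ is independent of $\varepsilon\in(0,1]$ (and of $t\in[0,T]$). $W^{1,\infty}(\mathbb{R}^d)$ is the space of measurable $f$ with $\|f\|_{W^{1,\infty}}:=\|f\|_{L^\infty}+\|\nabla f\|_{L^\infty}<\infty$. Write $\|u(t,\cdot)\|:=\|u(t,\cdot)\|_{L^2}+\|\sum_{j=1}^d\partial_{x_j}u(t,\cdot)\|_{L^2}+\|\Delta u(t,\cdot)\|_{L^2}$, used as the $H^2$-norm. Moderateness: a net $(f_\varepsilon)_{\varepsilon\in(0,1]}$ is $X$-moderate, for $X\in\{H^1,H^2,W^{1,\infty}\}$, if there is $N\in\mathbb{N}_0$ with $\|f_\varepsilon\|_X\lesssim\varepsilon^{-N}$. A net $(u_\varepsilon)_\varepsilon$ from $C([0,T];H^2(\mathbb{R}^d))\cap C^1([0,T];H^1(\mathbb{R}^d))$ is $C^1$-moderate if there is $N\in\mathbb{N}_0$ with $\|u_\varepsilon(t,\cdot)\|\lesssim\varepsilon^{-N}$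 for all $t\in[0,T]$. Very weak solution: a net $(u_\varepsilon)_\varepsilon$ in $C([0,T];H^1(\mathbb{R}^d))\cap C^1([0,T];L^2(\mathbb{R}^d))$ is a very weak solution to the Cauchy problem if there exist $W^{1,\infty}$-moderate regularisations $h_{i,\varepsilon}$ of the coefficients $h_i$ ($i=1,\dots,d$), an $H^2$-moderate regularisation $u_{0,\varepsilon}$ of $u_0$ and an $H^1$-moderate regularisation $u_{1,\varepsilon}$ of $u_1$ such that $(u_\varepsilon)_\varepsilon$ solves, for all $\varepsilon\in(0,1]$, the regularised problem $$\partial_t^2u_\varepsilon(t,x)-\sum_{j=1}^{d}\partial_{x_j}\left(h_{j,\varepsilon}(x)\partial_{x_j}u_\varepsilon(t,x)\right)=0,\quad (t,x)\in[0,T]\times\mathbb{R}^d,\qquad u_\varepsilon(0,x)=u_{0,\varepsilon}(x),\quad \partial_tu_\varepsilon(0,x)=u_{1,\varepsilon}(x),$$ and $(u_\varepsilon)_\varepsilon$ is $C^1$-moderate. *)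

theory Defs
  imports "HOL-Analysis.Analysis" "HOL-Probability.Essential_Supremum"
begin

text \<open>Real-valued functions on \<open>real ^ 'n\<close>, with \<open>d = CARD('n)\<close>. Elements of Lebesgue and Sobolev
  spaces are represented by Borel functions, so identities between them hold almost everywhere.\<close>

section \<open>Test functions and distributions\<close>

definition partial :: "'n::finite \<Rightarrow> (real ^ 'n \<Rightarrow> real) \<Rightarrow> real ^ 'n \<Rightarrow> real" where
  "partial i f x = frechet_derivative f (at x) (axis i 1)"

text \<open>Multi-indices are encoded as lists of coordinate directions.\<close>

definition partials :: "'n::finite list \<Rightarrow> (real ^ 'n \<Rightarrow> real) \<Rightarrow> real ^ 'n \<Rightarrow> real" where
  "partials ks f = foldr partial ks f"

definition smooth :: "(real ^ 'n::finite \<Rightarrow> real) \<Rightarrow> bool" where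
  "smooth f \<longleftrightarrow> (\<forall>ks. partials ks f differentiable_on UNIV)"

definition test_on :: "(real ^ 'n::finite) set \<Rightarrow> (real ^ 'n \<Rightarrow> real) set" where
  "test_on K = {\<phi>. smooth \<phi> \<and> (\<forall>x. x \<notin> K \<longrightarrow> \<phi> x = 0)}"

definition test_functions :: "(real ^ 'n::finite \<Rightarrow> real) set" where
  "test_functions = (\<Union>K\<in>Collect compact. test_on K)"

text \<open>A distribution is a functional on test functions whose value outside \<open>test_functions\<close>
  is irrelevant. Continuity is expressed by the usual seminorm estimates on each compact set.\<close>

definition distribution :: "((real ^ 'n::finite \<Rightarrow> real) \<Rightarrow> real) \<Rightarrow> bool" where
  "distribution F \<longleftrightarrow>
     (\<forall>\<phi>\<in>test_functions. \<forall>\<eta>\<in>test_functions. F (\<lambda>x. \<phi> x + \<eta> x) = F \<phi> + F \<eta>) \<and>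
     (\<forall>a. \<forall>\<phi>\<in>test_functions. F (\<lambda>x. a * \<phi> x) = a * F \<phi>) \<and>
     (\<forall>K. compact K \<longrightarrow>
        (\<exists>C m. \<forall>\<phi>\<in>test_on K.
           \<bar>F \<phi>\<bar> \<le> C * (\<Sum>ks | length ks \<le> m. SUP x. \<bar>partials ks \<phi> x\<bar>)))"

section \<open>Regularisation\<close>

definition friedrichs_mollifier :: "(real ^ 'n::finite \<Rightarrow> real) \<Rightarrow> bool" where
  "friedrichs_mollifier \<psi> \<longleftrightarrow>
     \<psi> \<in> test_functions \<and> (\<forall>x. 0 \<le> \<psi> x) \<and> integral\<^sup>L lborel \<psi> = 1"

definition scaled :: "(real ^ 'n::finite \<Rightarrow> real) \<Rightarrow> real \<Rightarrow> real ^ 'n \<Rightarrow> real" where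
  "scaled \<psi> \<epsilon> x = \<psi> (x /\<^sub>R \<epsilon>) / \<epsilon> ^ CARD('n)"

definition regularise ::
    "(real ^ 'n::finite \<Rightarrow> real) \<Rightarrow> ((real ^ 'n \<Rightarrow> real) \<Rightarrow> real) \<Rightarrow> real \<Rightarrow> real ^ 'n \<Rightarrow> real" where
  "regularise \<psi> F \<epsilon> x = F (\<lambda>y. scaled \<psi> \<epsilon> (x - y))"

section \<open>Weak derivatives and Sobolev spaces\<close>

definition locally_integrable :: "(real ^ 'n::finite \<Rightarrow> real) \<Rightarrow> bool" where
  "locally_integrable f \<longleftrightarrow>
     f \<in> borel_measurable lborel \<and> (\<forall>K. compact K \<longrightarrow> set_integrable lborel K f)"

definition has_weak_partial ::
    "'n::finite \<Rightarrow> (real ^ 'n \<Rightarrow> real) \<Rightarrow> (real ^ 'n \<Rightarrow> real) \<Rightarrow> bool" where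
  "has_weak_partial i f g \<longleftrightarrow> locally_integrable f \<and> locally_integrable g \<and>
     (\<forall>\<phi>\<in>test_functions.
        (LINT x|lborel. f x * partial i \<phi> x) = - (LINT x|lborel. g x * \<phi> x))"

definition weakly_differentiable :: "'n::finite \<Rightarrow> (real ^ 'n \<Rightarrow> real) \<Rightarrow> bool" where
  "weakly_differentiable i f \<longleftrightarrow> (\<exists>g. has_weak_partial i f g)"

text \<open>A representative of the weak derivative, meaningful if \<open>weakly_differentiable i f\<close>.\<close>

definition wpartial :: "'n::finite \<Rightarrow> (real ^ 'n \<Rightarrow> real) \<Rightarrow> real ^ 'n \<Rightarrow> real" where
  "wpartial i f = (SOME g. has_weak_partial i f g)"

definition L2 :: "(real ^ 'n::finite \<Rightarrow> real) set" where
  "L2 = {f. f \<in> borel_measurable lborel \<and> integrable lborel (\<lambda>x. (f x)\<^sup>2)}"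

definition H1 :: "(real ^ 'n::finite \<Rightarrow> real) set" where
  "H1 = {f \<in> L2. \<forall>i. weakly_differentiable i f \<and> wpartial i f \<in> L2}"

definition H2 :: "(real ^ 'n::finite \<Rightarrow> real) set" where
  "H2 = {f \<in> H1. \<forall>i. wpartial i f \<in> H1}"

definition L2_norm :: "(real ^ 'n::finite \<Rightarrow> real) \<Rightarrow> real" where
  "L2_norm f = sqrt (LINT x|lborel. (f x)\<^sup>2)"

definition H1_norm :: "(real ^ 'n::finite \<Rightarrow> real) \<Rightarrow> real" where
  "H1_norm f = L2_norm f + sqrt (\<Sum>j\<in>UNIV. (L2_norm (wpartial j f))\<^sup>2)"

text \<open>The middle term is the norm of the sum of the first derivatives, not of the gradient. By
  interpolation the first and last terms already control the usual norm on \<open>H2\<close>.\<close>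

definition H2_norm :: "(real ^ 'n::finite \<Rightarrow> real) \<Rightarrow> real" where
  "H2_norm f = L2_norm f + L2_norm (\<lambda>x. \<Sum>j\<in>UNIV. wpartial j f x)
     + L2_norm (\<lambda>x. \<Sum>j\<in>UNIV. wpartial j (wpartial j f) x)"

definition Linf_norm :: "(real ^ 'n::finite \<Rightarrow> 'b::real_normed_vector) \<Rightarrow> ereal" where
  "Linf_norm f = esssup lborel (\<lambda>x. ereal (norm (f x)))"

definition weak_grad :: "(real ^ 'n::finite \<Rightarrow> real) \<Rightarrow> real ^ 'n \<Rightarrow> real ^ 'n" where
  "weak_grad f x = (\<chi> j. wpartial j f x)"

definition W1inf :: "(real ^ 'n::finite \<Rightarrow> real) set" where
  "W1inf = {f. f \<in> borel_measurable lborel \<and> (\<forall>i. weakly_differentiable i f) \<and>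
     Linf_norm f + Linf_norm (weak_grad f) < \<infinity>}"

definition W1inf_norm :: "(real ^ 'n::finite \<Rightarrow> real) \<Rightarrow> real" where
  "W1inf_norm f = real_of_ereal (Linf_norm f + Linf_norm (weak_grad f))"

section \<open>Moderate nets\<close>

definition moderate_of_order ::
    "(real ^ 'n::finite \<Rightarrow> real) set \<Rightarrow> ((real ^ 'n \<Rightarrow> real) \<Rightarrow> real) \<Rightarrow> nat
      \<Rightarrow> (real \<Rightarrow> real ^ 'n \<Rightarrow> real) \<Rightarrow> bool" where
  "moderate_of_order X nrm N f \<longleftrightarrow>
     (\<exists>c>0. \<forall>\<epsilon>\<in>{0<..1}. f \<epsilon> \<in> X \<and> nrm (f \<epsilon>) \<le> c * (1 / \<epsilon>) ^ N)"

definition moderate ::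
    "(real ^ 'n::finite \<Rightarrow> real) set \<Rightarrow> ((real ^ 'n \<Rightarrow> real) \<Rightarrow> real)
      \<Rightarrow> (real \<Rightarrow> real ^ 'n \<Rightarrow> real) \<Rightarrow> bool" where
  "moderate X nrm f \<longleftrightarrow> (\<exists>N. moderate_of_order X nrm N f)"

text \<open>\<open>C0_in T X nrm\<close> is \<open>C([0,T]; X)\<close>, and \<open>C1_in T X nrm\<close> is \<open>C\<^sup>1([0,T]; X)\<close>, for a function
  space \<open>X\<close> with norm \<open>nrm\<close>; time derivatives are limits of difference quotients in \<open>nrm\<close>,
  one-sided at the end points.\<close>

definition C0_in ::
    "real \<Rightarrow> (real ^ 'n::finite \<Rightarrow> real) set \<Rightarrow> ((real ^ 'n \<Rightarrow> real) \<Rightarrow> real)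
      \<Rightarrow> (real \<Rightarrow> real ^ 'n \<Rightarrow> real) set" where
  "C0_in T X nrm = {u. \<forall>t\<in>{0..T}. u t \<in> X \<and>
     ((\<lambda>s. nrm (\<lambda>x. u s x - u t x)) \<longlongrightarrow> 0) (at t within {0..T})}"

definition has_C1_derivative ::
    "real \<Rightarrow> (real ^ 'n::finite \<Rightarrow> real) set \<Rightarrow> ((real ^ 'n \<Rightarrow> real) \<Rightarrow> real)
      \<Rightarrow> (real \<Rightarrow> real ^ 'n \<Rightarrow> real) \<Rightarrow> (real \<Rightarrow> real ^ 'n \<Rightarrow> real) \<Rightarrow> bool" where
  "has_C1_derivative T X nrm u v \<longleftrightarrow> u \<in> C0_in T X nrm \<and> v \<in> C0_in T X nrm \<and>
     (\<forall>t\<in>{0..T}. ((\<lambda>s. nrm (\<lambda>x. (u s x - u t x) / (s - t) - v t x)) \<longlongrightarrow> 0)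
        (at t within {0..T}))"

definition C1_in ::
    "real \<Rightarrow> (real ^ 'n::finite \<Rightarrow> real) set \<Rightarrow> ((real ^ 'n \<Rightarrow> real) \<Rightarrow> real)
      \<Rightarrow> (real \<Rightarrow> real ^ 'n \<Rightarrow> real) set" where
  "C1_in T X nrm = {u. \<exists>v. has_C1_derivative T X nrm u v}"

definition C1_moderate ::
    "real \<Rightarrow> (real \<Rightarrow> real \<Rightarrow> real ^ 'n::finite \<Rightarrow> real) \<Rightarrow> bool" where
  "C1_moderate T u \<longleftrightarrow>
     (\<forall>\<epsilon>\<in>{0<..1}. u \<epsilon> \<in> C0_in T H2 H2_norm \<inter> C1_in T H1 H1_norm) \<and>
     (\<exists>N::nat. \<exists>c>0. \<forall>\<epsilon>\<in>{0<..1}. \<forall>t\<in>{0..T}. H2_norm (u \<epsilon> t) \<le> c * (1 / \<epsilon>) ^ N)"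

section \<open>The Cauchy problem\<close>

text \<open>Strong solutions: \<open>\<partial>\<^sub>t u = v\<close> and \<open>\<partial>\<^sub>t v = w\<close> in \<open>L2\<close>, spatial derivatives are weak ones, and
  the equation holds almost everywhere in space for every time in \<open>[0,T]\<close>.\<close>

definition solves_wave ::
    "real \<Rightarrow> ('n::finite \<Rightarrow> real ^ 'n \<Rightarrow> real) \<Rightarrow> (real ^ 'n \<Rightarrow> real) \<Rightarrow> (real ^ 'n \<Rightarrow> real)
      \<Rightarrow> (real \<Rightarrow> real ^ 'n \<Rightarrow> real) \<Rightarrow> bool" where
  "solves_wave T h u0 u1 u \<longleftrightarrow>
     (\<exists>v w. has_C1_derivative T L2 L2_norm u v \<and> has_C1_derivative T L2 L2_norm v w \<and>
        (\<forall>t\<in>{0..T}.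
           (\<forall>j. weakly_differentiable j (u t) \<and>
                weakly_differentiable j (\<lambda>x. h j x * wpartial j (u t) x)) \<and>
           (AE x in lborel.
              w t x - (\<Sum>j\<in>UNIV. wpartial j (\<lambda>y. h j y * wpartial j (u t) y) x) = 0)) \<and>
        (AE x in lborel. u 0 x = u0 x) \<and>
        (AE x in lborel. v 0 x = u1 x))"

text \<open>The mollifier \<open>\<psi>\<close> is fixed once and for all, and regularisations of a distribution are the
  nets obtained by convolution with the scaled versions of \<open>\<psi>\<close>.\<close>

definition regularisation ::
    "(real ^ 'n::finite \<Rightarrow> real) \<Rightarrow> ((real ^ 'n \<Rightarrow> real) \<Rightarrow> real)
      \<Rightarrow> (real \<Rightarrow> real ^ 'n \<Rightarrow> real) \<Rightarrow> bool" where
  "regularisation \<psi> F f \<longleftrightarrow> (\<forall>\<epsilon>\<in>{0<..1}. f \<epsilon> = regularise \<psi> F \<epsilon>)"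

definition very_weak_solution ::
    "(real ^ 'n::finite \<Rightarrow> real) \<Rightarrow> real \<Rightarrow> ('n \<Rightarrow> (real ^ 'n \<Rightarrow> real) \<Rightarrow> real)
      \<Rightarrow> ((real ^ 'n \<Rightarrow> real) \<Rightarrow> real) \<Rightarrow> ((real ^ 'n \<Rightarrow> real) \<Rightarrow> real)
      \<Rightarrow> (real \<Rightarrow> real \<Rightarrow> real ^ 'n \<Rightarrow> real) \<Rightarrow> bool" where
  "very_weak_solution \<psi> T h u0 u1 u \<longleftrightarrow>
     (\<forall>\<epsilon>\<in>{0<..1}. u \<epsilon> \<in> C0_in T H1 H1_norm \<inter> C1_in T L2 L2_norm) \<and>
     (\<exists>h\<epsilon> u0\<epsilon> u1\<epsilon>.
        (\<forall>i. regularisation \<psi> (h i) (h\<epsilon> i) \<and> moderate W1inf W1inf_norm (h\<epsilon> i)) \<and>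
        regularisation \<psi> u0 u0\<epsilon> \<and> moderate H2 H2_norm u0\<epsilon> \<and>
        regularisation \<psi> u1 u1\<epsilon> \<and> moderate H1 H1_norm u1\<epsilon> \<and>
        (\<forall>\<epsilon>\<in>{0<..1}. solves_wave T (\<lambda>i. h\<epsilon> i \<epsilon>) (u0\<epsilon> \<epsilon>) (u1\<epsilon> \<epsilon>) (u \<epsilon>))) \<and>
     C1_moderate T u"

end

theory Submission
  imports Defs
begin

text \<open>For each fixed \<open>\<epsilon>\<close> the regularised problem has Lipschitz coefficients bounded below, and it suffices
  to solve it with bounds that are polynomial in the norms of the coefficients and of the data.
  With \<open>v = \<partial>\<^sub>t u\<close> and \<open>q\<^sub>j = sqrt h\<^sub>j \<partial>\<^sub>j u\<close> the equation becomes a first-order system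
  \<open>v\<^sub>t = \<Sum>\<^sub>j \<partial>\<^sub>j (sqrt h\<^sub>j q\<^sub>j)\<close>, \<open>(q\<^sub>j)\<^sub>t = sqrt h\<^sub>j \<partial>\<^sub>j v\<close> whose generator is skew-adjoint on
  \<open>L2 \<times> L2\<^sup>d\<close>, so the Hille--Yosida theorem yields a \<open>C\<^sup>1\<close> solution for data in the domain, and the norms
  of \<open>(v, q)\<close> and of its time derivative do not increase. At each time \<open>div (h grad u) \<in> L2\<close>, and elliptic
  regularity by difference quotients puts \<open>u\<close> into \<open>H2\<close>; the estimate is linear in
  \<open>(u, div (h grad u))\<close>, hence also gives continuity in time. Weak derivatives in \<open>L2\<close> are handled
  through the translation group: they are the limits of difference quotients.\<close>

section \<open>Bounded functionals on Hilbert spaces\<close>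

text \<open>Moderateness tolerates powers of \<open>1 / \<epsilon>\<close> but not exponentials of
  them. A Gronwall argument whose rate contains derivatives of \<open>h\<close> would produce such
  exponentials, so the evolution has to be a contraction. This is why the unknowns are weighted with
  \<open>sqrt h\<close>: the weights cancel in the inner product, and the system is skew without
  differentiating a coefficient. Derivatives of \<open>h\<close> enter the estimates only twice,
  each time linearly: in placing the data in the domain, where \<open>div (h grad u0)\<close> has to
  lie in \<open>L2\<close>, and in the elliptic estimate, where coercivity with the uniform bound
  \<open>c\<close> absorbs the top order. Counting factors gives the cube of a common bound for
  coefficients and data. A second obstacle is that \<open>H2_norm\<close> sees only the sum of the
  first derivatives and the Laplacian, while the estimates use every derivative separately; the
  elliptic estimate with constant coefficients supplies them. Uniqueness of weak derivatives and
  density of test functions are extracted from the given mollifier itself.\<close>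

lemma bounded_functional_representation:
  fixes V :: "'a::{real_inner,complete_space} set" and \<Lambda> :: "'a \<Rightarrow> real"
  assumes V: "subspace V"
    and add: "\<And>x y. x \<in> V \<Longrightarrow> y \<in> V \<Longrightarrow> \<Lambda> (x + y) = \<Lambda> x + \<Lambda> y"
    and scale: "\<And>c x. x \<in> V \<Longrightarrow> \<Lambda> (c *\<^sub>R x) = c * \<Lambda> x"
    and bound: "\<And>x. x \<in> V \<Longrightarrow> \<bar>\<Lambda> x\<bar> \<le> C * norm x"
    and C: "C \<ge> 0"
  obtains g where "g \<in> closure V" "\<And>z. z \<in> V \<Longrightarrow> \<Lambda> z = g \<bullet> z" "norm g \<le> C"
proof -
  \<comment> \<open>Riesz representation by minimising the energy \<open>Q\<close> over
    \<open>V\<close>: the parallelogram law makes a minimising sequence Cauchy, and the first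
    variation at its limit \<open>g\<close> is the representation. The limit is sought in
    \<open>closure V\<close> because \<open>V\<close> will be the space of test functions or the
    range of an operator.\<close>
  define Q where "Q z = (norm z)\<^sup>2 / 2 - \<Lambda> z" for z
  define m where "m = Inf (Q ` V)"
  have Qlow: "Q z \<ge> - (C\<^sup>2 / 2)" if "z \<in> V" for z
  proof -
    have "\<Lambda> z \<le> C * norm z" using bound[OF that] by linarith
    moreover have "0 \<le> (norm z - C)\<^sup>2" by simp
    ultimately show ?thesis
      unfolding Q_def by (simp add: power2_diff algebra_simps)
  qed
  have bdd: "bdd_below (Q ` V)" by (rule bdd_belowI[of _ "- (C\<^sup>2 / 2)"]) (use Qlow in auto)
  have V0: "0 \<in> V" by (rule subspace_0[OF V])
  have mle: "m \<le> Q z" if "z \<in> V" for z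
    unfolding m_def by (rule cInf_lower) (use that bdd in auto)
  have "\<exists>z\<in>V. Q z < m + 1 / real (Suc n)" for n
  proof -
    have "Inf (Q ` V) < m + 1 / real (Suc n)" by (simp add: m_def)
    then show ?thesis using cInf_lessD[of "Q ` V"] V0 by blast
  qed
  then obtain z where z: "\<And>n. z n \<in> V" "\<And>n. Q (z n) < m + 1 / real (Suc n)" by metis
  have par: "(norm (z n - z k))\<^sup>2 \<le> 4 * (1 / real (Suc n) + 1 / real (Suc k))" for n k
  proof -
    have inV: "(1/2) *\<^sub>R (z n + z k) \<in> V" by (intro subspace_scale subspace_add V z)
    have "Q ((1/2) *\<^sub>R (z n + z k)) = (norm (z n + z k))\<^sup>2 / 8 - (\<Lambda> (z n) + \<Lambda> (z k)) / 2"
      unfolding Q_def using scale[of "z n + z k" "1/2"] add[OF z(1) z(1)] subspace_add[OF V z(1) z(1)]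
      by (simp add: power_divide)
    moreover have "(norm (z n + z k))\<^sup>2 + (norm (z n - z k))\<^sup>2 = 2 * (norm (z n))\<^sup>2 + 2 * (norm (z k))\<^sup>2"
      by (simp add: power2_norm_eq_inner inner_simps inner_commute)
    ultimately have "(norm (z n - z k))\<^sup>2 / 4 = Q (z n) + Q (z k) - 2 * Q ((1/2) *\<^sub>R (z n + z k))"
      unfolding Q_def by (simp add: field_simps)
    also have "\<dots> \<le> 1 / real (Suc n) + 1 / real (Suc k)"
      using z(2)[of n] z(2)[of k] mle[OF inV] by linarith
    finally show ?thesis by simp
  qed
  have "Cauchy z"
  proof (rule metric_CauchyI)
    fix e :: real assume "e > 0"
    then obtain N where N: "1 / real (Suc N) < e\<^sup>2 / 8"
      using reals_Archimedean[of "e\<^sup>2/8"] by (auto simp: inverse_eq_divide)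
    show "\<exists>M. \<forall>m\<ge>M. \<forall>n\<ge>M. dist (z m) (z n) < e"
    proof (intro exI allI impI)
      fix n k assume "N \<le> n" "N \<le> k"
      then have "1 / real (Suc n) \<le> 1 / real (Suc N)" "1 / real (Suc k) \<le> 1 / real (Suc N)"
        by (auto simp: field_simps)
      then have "(norm (z n - z k))\<^sup>2 < e\<^sup>2" using par[of n k] N by argo
      then show "dist (z n) (z k) < e"
        using \<open>e > 0\<close> by (simp add: dist_norm power_less_imp_less_base)
    qed
  qed
  then obtain g where g: "z \<longlonglongrightarrow> g" using Cauchy_convergent convergent_def by blast
  have gcl: "g \<in> closure V" using g z(1) closure_sequential by blast
  have eq: "\<Lambda> v = g \<bullet> v" if v: "v \<in> V" for v
  proof -
    \<comment> \<open>Expanding \<open>Q\<close> around the almost minimal \<open>z n\<close> in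
      direction \<open>v\<close> costs an error \<open>1 / real (Suc n)\<close>, which disappears in
      the limit. What remains has no constant term, so the linear term must vanish.\<close>
    have ineq: "t * (g \<bullet> v - \<Lambda> v) + t\<^sup>2 * (norm v)\<^sup>2 / 2 \<ge> 0" for t
    proof -
      have "t * (z n \<bullet> v - \<Lambda> v) + t\<^sup>2 * (norm v)\<^sup>2 / 2 \<ge> - (1 / real (Suc n))" for n
      proof -
        have "z n + t *\<^sub>R v \<in> V" by (intro subspace_scale subspace_add V z v)
        from mle[OF this] z(2)[of n] have "Q (z n + t *\<^sub>R v) \<ge> Q (z n) - 1 / real (Suc n)" by linarith
        moreover have "\<Lambda> (z n + t *\<^sub>R v) = \<Lambda> (z n) + t * \<Lambda> v"
          using add[OF z(1) subspace_scale[OF V v]] scale[OF v] by simp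
        moreover have "(norm (z n + t *\<^sub>R v))\<^sup>2 = (norm (z n))\<^sup>2 + 2 * t * (z n \<bullet> v) + t\<^sup>2 * (norm v)\<^sup>2"
          unfolding power2_norm_eq_inner by (simp add: inner_simps inner_commute power2_eq_square algebra_simps)
        ultimately show ?thesis unfolding Q_def by (simp add: field_simps)
      qed
      moreover have "(\<lambda>n. t * (z n \<bullet> v - \<Lambda> v) + t\<^sup>2 * (norm v)\<^sup>2 / 2) \<longlonglongrightarrow> t * (g \<bullet> v - \<Lambda> v) + t\<^sup>2 * (norm v)\<^sup>2 / 2"
        by (intro tendsto_intros g)
      moreover have "(\<lambda>n. - (1 / real (Suc n))) \<longlonglongrightarrow> 0"
        using tendsto_minus[OF LIMSEQ_inverse_real_of_nat] by (simp add: inverse_eq_divide)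
      ultimately show ?thesis
        by (intro LIMSEQ_le[of "\<lambda>n. - (1 / real (Suc n))" 0
              "\<lambda>n. t * (z n \<bullet> v - \<Lambda> v) + t\<^sup>2 * (norm v)\<^sup>2 / 2"]) auto
    qed
    define d where "d = g \<bullet> v - \<Lambda> v"
    \<comment> \<open>The vertex of the parabola would be at \<open>- d / (norm v)\<^sup>2\<close>;
      adding 1 avoids a case distinction for \<open>v = 0\<close> and still gives a negative value
      unless \<open>d = 0\<close>.\<close>
    define q where "q = (norm v)\<^sup>2 + 1"
    have "q > 0" by (simp add: q_def add_nonneg_pos)
    have "(- d / q) * d + (- d / q)\<^sup>2 * (norm v)\<^sup>2 / 2 \<ge> 0" using ineq[of "- d / q"] by (simp add: d_def)
    moreover have "(- d / q)\<^sup>2 * (norm v)\<^sup>2 / 2 \<le> (- d / q)\<^sup>2 * q / 2"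
      by (intro divide_right_mono mult_left_mono) (auto simp: q_def)
    moreover have "(- d / q)\<^sup>2 * q / 2 = d\<^sup>2 / q / 2" using \<open>q > 0\<close> by (simp add: power2_eq_square)
    moreover have "(- d / q) * d = - (d\<^sup>2 / q)" by (simp add: power2_eq_square)
    ultimately have "0 \<le> - (d\<^sup>2 / q) + d\<^sup>2 / q / 2" by argo
    then have "d\<^sup>2 / q \<le> 0" by simp
    then have "d = 0" using \<open>q > 0\<close> by (simp add: divide_le_0_iff)
    then show ?thesis by (simp add: d_def)
  qed
  have "(norm g)\<^sup>2 \<le> C * norm g"
  proof -
    have "(\<lambda>n. C * norm (z n)) \<longlonglongrightarrow> C * norm g" by (intro tendsto_intros g)
    moreover have "(\<lambda>n. g \<bullet> z n) \<longlonglongrightarrow> g \<bullet> g" by (intro tendsto_intros g)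
    moreover have "g \<bullet> z n \<le> C * norm (z n)" for n
      using eq[OF z(1), of n] bound[OF z(1), of n] by linarith
    ultimately have "g \<bullet> g \<le> C * norm g"
      by (intro LIMSEQ_le[of "\<lambda>n. g \<bullet> z n" "g \<bullet> g" "\<lambda>n. C * norm (z n)"]) auto
    then show ?thesis by (simp add: power2_norm_eq_inner)
  qed
  then have "norm g \<le> C" using C
    by (cases "norm g = 0") (auto simp: power2_eq_square)
  then show thesis using that gcl eq by blast
qed

text \<open>The functional \<open>f \<bullet> _\<close> on \<open>V\<close> is represented by some
  \<open>g\<close> in the closure; then \<open>f - g\<close> is orthogonal to \<open>V\<close>, so
  \<open>f = g\<close>.\<close>

lemma dense_subspaceI:
  fixes V :: "'a::{real_inner,complete_space} set"
  assumes V: "subspace V" and orth: "\<And>z. (\<And>v. v \<in> V \<Longrightarrow> v \<bullet> z = 0) \<Longrightarrow> z = 0"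
  shows "closure V = UNIV"
proof -
  have "f \<in> closure V" for f
  proof -
    obtain g where g: "g \<in> closure V" "\<And>z. z \<in> V \<Longrightarrow> f \<bullet> z = g \<bullet> z"
    proof (rule bounded_functional_representation[OF V, of "\<lambda>z. f \<bullet> z" "norm f"])
      show "\<bar>f \<bullet> x\<bar> \<le> norm f * norm x" for x by (rule Cauchy_Schwarz_ineq2)
    qed (auto simp: inner_simps)
    then have "v \<bullet> (f - g) = 0" if "v \<in> V" for v using g(2)[OF that] by (simp add: inner_diff_right inner_commute)
    then have "f - g = 0" by (rule orth)
    then show ?thesis using g(1) by simp
  qed
  then show ?thesis by auto
qed

text \<open>Duality: along a sequence in \<open>V\<close> tending to \<open>z\<close> itself, the
  hypothesis becomes \<open>z \<bullet> z \<le> C * norm z\<close>.\<close>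

lemma dense_norm_le:
  fixes V :: "'a::real_inner set"
  assumes V: "closure V = UNIV" and le: "\<And>v. v \<in> V \<Longrightarrow> z \<bullet> v \<le> C * norm v"
    and C: "C \<ge> 0"
  shows "norm z \<le> C"
proof -
  obtain v where v: "\<And>n::nat. v n \<in> V" "v \<longlonglongrightarrow> z"
    using V closure_sequential[of z V] by auto
  have "(\<lambda>n. C * norm (v n)) \<longlonglongrightarrow> C * norm z" by (intro tendsto_intros v)
  moreover have "(\<lambda>n. z \<bullet> v n) \<longlonglongrightarrow> z \<bullet> z" by (intro tendsto_intros v)
  ultimately have "z \<bullet> z \<le> C * norm z"
    using le v(1) by (intro LIMSEQ_le[of "\<lambda>n. z \<bullet> v n" "z \<bullet> z" "\<lambda>n. C * norm (v n)"]) auto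
  then show ?thesis using C by (cases "norm z = 0") (auto simp: power2_norm_eq_inner[symmetric] power2_eq_square)
qed

section \<open>The Hille--Yosida theorem for contraction semigroups\<close>

text \<open>Bounded operators as a Banach algebra, so that the library exponential applies to them;
  \<open>perfect_space\<close> guarantees that the identity has norm 1.\<close>

typedef (overloaded) ('a::real_normed_vector) endo = "UNIV :: ('a \<Rightarrow>\<^sub>L 'a) set" ..

setup_lifting type_definition_endo

instantiation endo :: (real_normed_vector) real_normed_vector
begin

lift_definition zero_endo :: "'a endo" is 0 .
lift_definition plus_endo :: "'a endo \<Rightarrow> 'a endo \<Rightarrow> 'a endo" is "(+)" .
lift_definition minus_endo :: "'a endo \<Rightarrow> 'a endo \<Rightarrow> 'a endo" is "(-)" .
lift_definition uminus_endo :: "'a endo \<Rightarrow> 'a endo" is uminus .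
lift_definition scaleR_endo :: "real \<Rightarrow> 'a endo \<Rightarrow> 'a endo" is scaleR .
lift_definition norm_endo :: "'a endo \<Rightarrow> real" is norm .
definition dist_endo :: "'a endo \<Rightarrow> 'a endo \<Rightarrow> real" where "dist_endo x y = norm (x - y)"
definition sgn_endo :: "'a endo \<Rightarrow> 'a endo" where "sgn_endo x = scaleR (inverse (norm x)) x"
definition uniformity_endo :: "('a endo \<times> 'a endo) filter" where "uniformity_endo = (INF e\<in>{0<..}. principal {(x, y). dist x y < e})"
definition open_endo :: "'a endo set \<Rightarrow> bool" where "open_endo (U :: 'a endo set) \<longleftrightarrow> (\<forall>x\<in>U. eventually (\<lambda>(x', y). x' = x \<longrightarrow> y \<in> U) uniformity)"

instance
  by standard
    (auto simp: dist_endo_def sgn_endo_def uniformity_endo_def open_endo_def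
       | transfer, simp add: algebra_simps norm_triangle_ineq)+

end

lift_definition endo_app :: "'a::real_normed_vector endo \<Rightarrow> 'a \<Rightarrow> 'a" is blinfun_apply .

instantiation endo :: ("{real_normed_vector,perfect_space}") real_normed_algebra_1
begin

lift_definition one_endo :: "'a endo" is id_blinfun .
lift_definition times_endo :: "'a endo \<Rightarrow> 'a endo \<Rightarrow> 'a endo" is "(o\<^sub>L)" .

instance
proof
  show "(0::'a endo) \<noteq> 1"
  proof
    assume "(0::'a endo) = 1"
    then have "norm (0::'a endo) = norm (1::'a endo)" by simp
    then show False by transfer (simp add: norm_blinfun_id)
  qed
qed (transfer; auto intro!: blinfun_eqI simp: blinfun.bilinear_simps norm_blinfun_compose norm_blinfun_id)+

end

instance endo :: (banach) banach
proof
  fix X :: "nat \<Rightarrow> 'a endo" assume "Cauchy X"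
  have d: "dist x y = dist (Rep_endo x) (Rep_endo y)" for x y :: "'a endo"
    by (simp add: dist_endo_def norm_endo.rep_eq minus_endo.rep_eq dist_norm)
  have "Cauchy (\<lambda>n. Rep_endo (X n))" using \<open>Cauchy X\<close> unfolding Cauchy_def d .
  then obtain L where "(\<lambda>n. Rep_endo (X n)) \<longlonglongrightarrow> L" using Cauchy_convergent convergent_def by blast
  then have "X \<longlonglongrightarrow> Abs_endo L" unfolding tendsto_iff d by (simp add: Abs_endo_inverse)
  then show "convergent X" by (auto simp: convergent_def)
qed

lemma endo_app_mult: "endo_app (S * S') x = endo_app S (endo_app S' x)"
  by transfer simp

lemma bounded_bilinear_endo_app: "bounded_bilinear endo_app"
proof
  fix a a' :: "'a endo" and b b' :: 'a and r :: real
  show "endo_app (a + a') b = endo_app a b + endo_app a' b" by transfer (simp add: blinfun.bilinear_simps)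
  show "endo_app a (b + b') = endo_app a b + endo_app a b'" by transfer (simp add: blinfun.bilinear_simps)
  show "endo_app (r *\<^sub>R a) b = r *\<^sub>R endo_app a b" by transfer (simp add: blinfun.bilinear_simps)
  show "endo_app a (r *\<^sub>R b) = r *\<^sub>R endo_app a b" by transfer (simp add: blinfun.bilinear_simps)
  show "\<exists>K. \<forall>a b. norm (endo_app a b) \<le> norm a * norm b * K"
    by (rule exI[of _ 1], transfer) (simp add: norm_blinfun)
qed

interpretation endo_app: bounded_bilinear endo_app by (rule bounded_bilinear_endo_app)

lemma norm_endo_app: "norm (endo_app S x) \<le> norm S * norm x"
  by transfer (rule norm_blinfun)

lemma endo_app_one [simp]: "endo_app 1 x = x"
  by transfer simp

lemma endo_ext: "(\<And>x. endo_app S x = endo_app S' x) \<Longrightarrow> S = S'"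
  by transfer (rule blinfun_eqI)

lemma endo_of_bounded_linear:
  assumes "bounded_linear f" "\<And>x. norm (f x) \<le> C * norm x" "0 \<le> C"
  obtains S where "\<And>x. endo_app S x = f x" "norm S \<le> C"
proof -
  define S where "S = Abs_endo (Blinfun f)"
  have "endo_app S x = f x" for x
    by (simp add: S_def endo_app.rep_eq Abs_endo_inverse bounded_linear_Blinfun_apply[OF assms(1)])
  moreover have "norm S \<le> C"
    unfolding S_def norm_endo.rep_eq using assms
    by (simp add: Abs_endo_inverse norm_blinfun_bound bounded_linear_Blinfun_apply[OF assms(1)])
  ultimately show ?thesis using that by blast
qed

text \<open>The norm of \<open>J - 1\<close> may be 2, so the general bound on \<open>exp\<close>
  would grow with \<open>s\<close>. The scalar part commutes and splits off as the factor
  \<open>exp (- s)\<close>, which cancels \<open>exp s\<close>, the bound for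
  \<open>exp (s *\<^sub>R J)\<close>.\<close>

lemma norm_exp_scaled_diff_one_le:
  fixes J :: "'a::{banach,perfect_space} endo"
  assumes "norm J \<le> 1" "0 \<le> s"
  shows "norm (exp (s *\<^sub>R (J - 1))) \<le> 1"
proof -
  have "exp (s *\<^sub>R (J - 1)) = exp (s *\<^sub>R J + (-s) *\<^sub>R 1)" by (simp add: scaleR_diff_right)
  also have "\<dots> = exp (s *\<^sub>R J) * exp ((-s) *\<^sub>R 1)" by (rule exp_add_commuting) simp
  also have "exp ((-s) *\<^sub>R 1) = (of_real (exp (-s)) :: 'a endo)"
    by (metis exp_of_real scaleR_conv_of_real mult.right_neutral)
  finally have "norm (exp (s *\<^sub>R (J - 1))) \<le> norm (exp (s *\<^sub>R J)) * exp (-s)"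
    by (metis norm_mult_ineq norm_of_real abs_exp_cancel)
  also have "norm (exp (s *\<^sub>R J)) \<le> exp s"
  proof -
    have "norm (exp (s *\<^sub>R J)) \<le> exp (norm (s *\<^sub>R J))" by (rule norm_exp)
    also have "\<dots> \<le> exp s" using assms by (simp add: mult_left_le)
    finally show ?thesis .
  qed
  finally show ?thesis by (simp add: exp_minus)
qed

lemma has_vector_derivative_bound:
  fixes f :: "real \<Rightarrow> 'a::real_normed_vector"
  assumes S: "convex S"
    and der: "\<And>s. s \<in> S \<Longrightarrow> (f has_vector_derivative f' s) (at s within S)"
    and bound: "\<And>s. s \<in> S \<Longrightarrow> norm (f' s) \<le> B" and ab: "a \<in> S" "b \<in> S"
  shows "norm (f b - f a) \<le> B * \<bar>b - a\<bar>"
proof -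
  have "norm (f b - f a) \<le> B * norm (b - a)"
  proof (rule differentiable_bound[OF S _ _ ab(2,1), of f "\<lambda>s h. h *\<^sub>R f' s"])
    fix s assume s: "s \<in> S"
    show "(f has_derivative (\<lambda>h. h *\<^sub>R f' s)) (at s within S)"
      using der[OF s] by (simp add: has_vector_derivative_def)
    show "onorm (\<lambda>h. h *\<^sub>R f' s) \<le> B"
      using bound[OF s] by (intro onorm_le) (simp add: mult.commute[of B] mult_left_mono)
  qed
  then show ?thesis by simp
qed

text \<open>Only \<open>(Q - P) x\<close> enters, not the norm of \<open>Q - P\<close>: for Yosida
  approximations the operator norms may diverge, while their difference tends to 0 on vectors of the
  domain.\<close>

lemma exp_perturbation_bound:
  fixes P Q :: "'a::{banach,perfect_space} endo"
  assumes comm: "P * Q = Q * P" and t: "0 \<le> t"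
    and P: "\<And>s. 0 \<le> s \<Longrightarrow> norm (exp (s *\<^sub>R P)) \<le> 1" and Q: "\<And>s. 0 \<le> s \<Longrightarrow> norm (exp (s *\<^sub>R Q)) \<le> 1"
  shows "norm (endo_app (exp (t *\<^sub>R Q)) x - endo_app (exp (t *\<^sub>R P)) x) \<le> t * norm (endo_app (Q - P) x)"
proof -
  \<comment> \<open>A path from \<open>exp (t *\<^sub>R P)\<close> at \<open>s = 0\<close> to
    \<open>exp (t *\<^sub>R Q)\<close> at \<open>s = t\<close>. This form shows that the derivative
    is \<open>f s * (Q - P)\<close>; the form in \<open>split\<close> shows that \<open>f s\<close>
    is a contraction.\<close>
  define f where "f s = exp (t *\<^sub>R P) * exp (s *\<^sub>R (Q - P))" for s
  have split: "f s = exp ((t - s) *\<^sub>R P) * exp (s *\<^sub>R Q)" for s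
  proof -
    have "f s = exp (t *\<^sub>R P + s *\<^sub>R (Q - P))"
      unfolding f_def by (rule exp_add_commuting[symmetric]) (simp add: algebra_simps comm)
    also have "t *\<^sub>R P + s *\<^sub>R (Q - P) = (t - s) *\<^sub>R P + s *\<^sub>R Q" by (simp add: algebra_simps)
    also have "exp \<dots> = exp ((t - s) *\<^sub>R P) * exp (s *\<^sub>R Q)"
      by (rule exp_add_commuting) (simp add: algebra_simps comm)
    finally show ?thesis .
  qed
  have nf: "norm (f s) \<le> 1" if "s \<in> {0..t}" for s
  proof -
    have "norm (f s) \<le> norm (exp ((t - s) *\<^sub>R P)) * norm (exp (s *\<^sub>R Q))"
      unfolding split by (rule norm_mult_ineq)
    also have "\<dots> \<le> 1" using P[of "t - s"] Q[of s] that by (simp add: mult_le_one)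
    finally show ?thesis .
  qed
  have der: "((\<lambda>s. endo_app (f s) x) has_vector_derivative endo_app (f s * (Q - P)) x) (at s within {0..t})" for s
  proof -
    have "((\<lambda>s. exp (s *\<^sub>R (Q - P))) has_vector_derivative exp (s *\<^sub>R (Q - P)) * (Q - P)) (at s within {0..t})"
      by (rule exp_scaleR_has_vector_derivative_right)
    then have "(f has_vector_derivative exp (t *\<^sub>R P) * (exp (s *\<^sub>R (Q - P)) * (Q - P))) (at s within {0..t})"
      unfolding f_def by (rule bounded_linear.has_vector_derivative[OF bounded_linear_mult_right])
    then show ?thesis
      using bounded_linear.has_vector_derivative[OF endo_app.bounded_linear_left]
      by (fastforce simp: f_def mult.assoc)
  qed
  have "norm (endo_app (f t) x - endo_app (f 0) x) \<le> norm (endo_app (Q - P) x) * \<bar>t - 0\<bar>"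
  proof (rule has_vector_derivative_bound[OF _ der])
    fix s assume s: "s \<in> {0..t}"
    have "norm (endo_app (f s * (Q - P)) x) \<le> norm (f s) * norm (endo_app (Q - P) x)"
      unfolding endo_app_mult by (rule norm_endo_app)
    also have "\<dots> \<le> 1 * norm (endo_app (Q - P) x)" by (intro mult_right_mono nf s) simp
    finally show "norm (endo_app (f s * (Q - P)) x) \<le> norm (endo_app (Q - P) x)" by simp
  qed (use t in auto)
  then show ?thesis using split[of t] split[of 0] t by (simp add: mult.commute)
qed

lemma norm_add_diff_le: "norm (a + b - c) \<le> norm a + norm b + norm (c :: 'a::real_normed_vector)"
  using norm_triangle_ineq4[of "a + b" c] norm_triangle_ineq[of a b] by linarith

text \<open>The generator is represented by its graph \<open>G\<close>. Below, \<open>J n\<close> is its resolvent \<open>(1 - G / kap n)\<^sup>-\<^sup>1\<close>,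
  \<open>Y n\<close> its Yosida approximation \<open>G \<circ> J n\<close> and \<open>E n\<close> the semigroup generated by \<open>Y n\<close>.\<close>

locale contraction_generator =
  fixes G :: "('a::{banach,perfect_space} \<times> 'a) set"
  assumes sub: "subspace G" and cl: "closed G"
    and dissip: "\<And>x y c. (x, y) \<in> G \<Longrightarrow> c > 0 \<Longrightarrow> norm x \<le> norm (x - c *\<^sub>R y)"
    and range: "\<And>c z. c > 0 \<Longrightarrow> \<exists>x y. (x, y) \<in> G \<and> x - c *\<^sub>R y = z"
    and dense: "closure (fst ` G) = UNIV"
begin

lemma G_add: "(x, y) \<in> G \<Longrightarrow> (x', y') \<in> G \<Longrightarrow> (x + x', y + y') \<in> G"
  using subspace_add[OF sub, of "(x,y)" "(x',y')"] by simp

lemma G_diff: "(x, y) \<in> G \<Longrightarrow> (x', y') \<in> G \<Longrightarrow> (x - x', y - y') \<in> G"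
  using subspace_diff[OF sub, of "(x,y)" "(x',y')"] by simp

lemma G_scale: "(x, y) \<in> G \<Longrightarrow> (c *\<^sub>R x, c *\<^sub>R y) \<in> G"
  using subspace_scale[OF sub, of "(x,y)" c] by simp

section \<open>Resolvents and Yosida approximations\<close>

definition kap :: "nat \<Rightarrow> real" where "kap n = real (Suc n)"

lemma kap_pos [simp]: "kap n > 0" "kap n \<noteq> 0" "kap n \<ge> 0"
  by (simp_all add: kap_def)

definition J :: "nat \<Rightarrow> 'a \<Rightarrow> 'a" where
  "J n z = (SOME x. (x, kap n *\<^sub>R (x - z)) \<in> G)"

lemma kap_cancel [simp]: "inverse (kap n) *\<^sub>R (kap n *\<^sub>R v) = (v :: 'a)" "kap n *\<^sub>R (inverse (kap n) *\<^sub>R v) = v"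
proof -
  have "kap n * inverse (kap n) = 1" "inverse (kap n) * kap n = 1" by simp_all
  then show "inverse (kap n) *\<^sub>R (kap n *\<^sub>R v) = v" "kap n *\<^sub>R (inverse (kap n) *\<^sub>R v) = v"
    by (simp_all only: scaleR_scaleR scaleR_one)
qed

lemma J_graph: "(J n z, kap n *\<^sub>R (J n z - z)) \<in> G"
proof -
  have "inverse (kap n) > 0" by simp
  from range[OF this, of z] obtain x y
    where xy: "(x, y) \<in> G" "x - inverse (kap n) *\<^sub>R y = z" by blast
  have "x - z = inverse (kap n) *\<^sub>R y" unfolding xy(2)[symmetric] by (simp only: diff_diff_eq2 add_diff_cancel_left')
  then have "kap n *\<^sub>R (x - z) = y" by (simp only: kap_cancel)
  then have "\<exists>x. (x, kap n *\<^sub>R (x - z)) \<in> G" using xy(1) by blast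
  from someI_ex[OF this] show ?thesis unfolding J_def .
qed

text \<open>Two solutions of one resolvent equation differ by a vector whose image in
  \<open>G\<close> is \<open>kap n\<close> times itself; dissipativity bounds its norm by that of 0.
  Hence the choice in \<open>J\<close> is forced.\<close>

lemma J_eqI:
  assumes "(x, y) \<in> G"
  shows "J n (x - inverse (kap n) *\<^sub>R y) = x"
proof -
  define z where "z = x - inverse (kap n) *\<^sub>R y"
  have "norm (J n z - x) \<le> norm ((J n z - x) - inverse (kap n) *\<^sub>R (kap n *\<^sub>R (J n z - z) - y))"
    by (rule dissip[OF G_diff[OF J_graph assms]]) simp
  also have "inverse (kap n) *\<^sub>R (kap n *\<^sub>R (J n z - z) - y) = (J n z - z) - inverse (kap n) *\<^sub>R y"
    by (simp only: scaleR_diff_right[of "inverse (kap n)"] kap_cancel)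
  also have "(J n z - x) - \<dots> = 0" by (simp add: z_def)
  finally have "J n z - x = 0" by (simp only: norm_zero norm_le_zero_iff)
  then show ?thesis unfolding z_def[symmetric] by (simp only: right_minus_eq)
qed

lemma J_norm: "norm (J n z) \<le> norm z"
proof -
  have "norm (J n z) \<le> norm (J n z - inverse (kap n) *\<^sub>R (kap n *\<^sub>R (J n z - z)))"
    by (rule dissip[OF J_graph]) simp
  then show ?thesis unfolding kap_cancel by simp
qed

lemma J_bounded_linear: "bounded_linear (J n)"
proof (rule bounded_linear_intro[where K=1])
  fix z z' r
  have "J n (J n z + J n z' - inverse (kap n) *\<^sub>R (kap n *\<^sub>R (J n z - z) + kap n *\<^sub>R (J n z' - z')))
      = J n z + J n z'" by (rule J_eqI[OF G_add[OF J_graph J_graph]])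
  also have "J n z + J n z' - inverse (kap n) *\<^sub>R (kap n *\<^sub>R (J n z - z) + kap n *\<^sub>R (J n z' - z')) = z + z'"
    unfolding scaleR_add_right[of "inverse (kap n)"] kap_cancel by simp
  finally show "J n (z + z') = J n z + J n z'" .
  have "J n (r *\<^sub>R J n z - inverse (kap n) *\<^sub>R (r *\<^sub>R (kap n *\<^sub>R (J n z - z)))) = r *\<^sub>R J n z"
    by (rule J_eqI[OF G_scale[OF J_graph]])
  also have "r *\<^sub>R J n z - inverse (kap n) *\<^sub>R (r *\<^sub>R (kap n *\<^sub>R (J n z - z))) = r *\<^sub>R z"
    unfolding scaleR_left_commute[of "inverse (kap n)" r] kap_cancel by (simp add: scaleR_diff_right)
  finally show "J n (r *\<^sub>R z) = r *\<^sub>R J n z" .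
  show "norm (J n z) \<le> norm z * 1" using J_norm by simp
qed

lemmas J_simps = linear_add[OF bounded_linear.linear[OF J_bounded_linear]]
  linear_diff[OF bounded_linear.linear[OF J_bounded_linear]]
  linear_scale[OF bounded_linear.linear[OF J_bounded_linear]]

text \<open>The resolvent commutes with the generator. On the domain, the Yosida approximation
  applied to \<open>x\<close> is therefore \<open>J n y\<close>, which converges to
  \<open>y\<close>.\<close>

lemma J_maps_graph:
  assumes "(x, y) \<in> G"
  shows "(J n x, J n y) \<in> G" "kap n *\<^sub>R (J n x - x) = J n y"
proof -
  have "J n x - inverse (kap n) *\<^sub>R J n y = x"
    using J_eqI[OF assms, of n] by (simp add: J_simps)
  then have "J n x - x = inverse (kap n) *\<^sub>R J n y" by (simp add: algebra_simps)
  then show eq: "kap n *\<^sub>R (J n x - x) = J n y" by (simp)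
  show "(J n x, J n y) \<in> G" using J_graph[of n x] by (simp add: eq)
qed

text \<open>Commuting resolvents give commuting Yosida approximations, which the comparison of their
  exponentials requires.\<close>

lemma J_commute: "J n (J m z) = J m (J n z)"
proof -
  have "J m (J n (J m z) - inverse (kap m) *\<^sub>R J n (kap m *\<^sub>R (J m z - z))) = J n (J m z)"
    by (rule J_eqI[OF J_maps_graph(1)[OF J_graph]])
  then show ?thesis by (simp add: J_simps)
qed

text \<open>On the domain \<open>J n x - x\<close> is \<open>J n y\<close> divided by
  \<open>kap n\<close>, hence small; density and the uniform bound on \<open>J n\<close> extend this
  to all vectors.\<close>

lemma J_tendsto: "(\<lambda>n. J n z) \<longlonglongrightarrow> z"
proof (rule LIMSEQ_I)
  fix e :: real assume e: "e > 0"
  obtain x where x: "x \<in> fst ` G" "dist x z < e / 4"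
    using dense closure_approachable[of z "fst ` G"] e by (metis UNIV_I zero_less_divide_iff zero_less_numeral)
  then obtain y where xy: "(x, y) \<in> G" by force
  obtain N where N: "inverse (kap N) * norm y < e / 2"
  proof -
    obtain N where "norm y / (e / 2) < real N" using reals_Archimedean2 by blast
    then have "norm y / (e / 2) < kap N" by (simp add: kap_def)
    then have "norm y < kap N * (e / 2)" using e by (simp only: pos_divide_less_eq half_gt_zero)
    then have "inverse (kap N) * norm y < e / 2" by (simp add: pos_divide_less_eq inverse_eq_divide mult.commute)
    then show ?thesis by (rule that)
  qed
  show "\<exists>N. \<forall>n\<ge>N. norm (J n z - z) < e"
  proof (intro exI allI impI)
    fix n assume n: "n \<ge> N"
    have "J n x - x = inverse (kap n) *\<^sub>R J n y"
      using J_maps_graph(2)[OF xy, of n, symmetric] by (simp)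
    then have "norm (J n x - x) = inverse (kap n) * norm (J n y)" by simp
    also have "\<dots> \<le> inverse (kap N) * norm y"
      using n J_norm[of n y] by (intro mult_mono le_imp_inverse_le) (auto simp: kap_def)
    finally have 1: "norm (J n x - x) < e / 2" using N by linarith
    have 2: "norm (J n z - J n x) \<le> norm (z - x)" using J_norm[of n "z - x"] by (simp add: J_simps)
    have 3: "norm (z - x) < e / 4" using x(2) by (simp add: dist_norm norm_minus_commute)
    have "J n z - z = (J n z - J n x) + (J n x - x) - (z - x)" by simp
    then have "norm (J n z - z) \<le> norm (J n z - J n x) + norm (J n x - x) + norm (z - x)"
      by (simp only: norm_add_diff_le)
    then show "norm (J n z - z) < e" using 1 2 3 by linarith
  qed
qed

definition Jop :: "nat \<Rightarrow> 'a endo" where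
  "Jop n = (SOME S. (\<forall>x. endo_app S x = J n x) \<and> norm S \<le> 1)"

lemma Jop: "endo_app (Jop n) x = J n x" "norm (Jop n) \<le> 1"
proof -
  obtain S where "\<And>x. endo_app S x = J n x" "norm S \<le> 1"
    using endo_of_bounded_linear[OF J_bounded_linear, of n 1] J_norm by auto
  then have "\<exists>S. (\<forall>x. endo_app S x = J n x) \<and> norm S \<le> 1" by auto
  from someI_ex[OF this] have "(\<forall>x. endo_app (Jop n) x = J n x) \<and> norm (Jop n) \<le> 1"
    unfolding Jop_def .
  then show "endo_app (Jop n) x = J n x" "norm (Jop n) \<le> 1" by auto
qed

definition Y :: "nat \<Rightarrow> 'a endo" where "Y n = kap n *\<^sub>R (Jop n - 1)"

definition E :: "nat \<Rightarrow> real \<Rightarrow> 'a endo" where "E n t = exp (t *\<^sub>R Y n)"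

lemma Y_app: "endo_app (Y n) x = kap n *\<^sub>R (J n x - x)"
  by (simp add: Y_def endo_app.scaleR_left endo_app.diff_left Jop)

lemma Y_commute: "Y n * Y m = Y m * Y n"
proof (rule endo_ext)
  fix x show "endo_app (Y n * Y m) x = endo_app (Y m * Y n) x"
    by (simp add: endo_app_mult Y_app J_simps J_commute[of n m] algebra_simps)
qed

lemma E_norm: "0 \<le> t \<Longrightarrow> norm (E n t) \<le> 1"
  unfolding E_def Y_def scaleR_scaleR
  by (rule norm_exp_scaled_diff_one_le) (auto simp: Jop)

lemma E_app_norm: "0 \<le> t \<Longrightarrow> norm (endo_app (E n t) x) \<le> norm x"
  using norm_endo_app[of "E n t" x] mult_right_mono[OF E_norm, of t "norm x" n] by simp

lemma E_diff: "0 \<le> t \<Longrightarrow> norm (endo_app (E n t) x - endo_app (E m t) x) \<le> t * norm (endo_app (Y n) x - endo_app (Y m) x)"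
  using exp_perturbation_bound[OF Y_commute, of t m n x] E_norm[unfolded E_def]
  by (simp add: E_def endo_app.diff_left)

text \<open>For \<open>x\<close> in the domain two approximations differ by at most
  \<open>T * norm (J m y - J n y)\<close>, uniformly in time. Contractivity lets \<open>z\<close> be
  replaced by such an \<open>x\<close> with an error independent of \<open>n\<close> and
  \<open>t\<close>.\<close>

lemma E_uniformly_convergent:
  assumes T: "T > 0"
  shows "uniformly_convergent_on {0..T} (\<lambda>n t. endo_app (E n t) z)"
proof (rule Cauchy_uniformly_convergent, rule uniformly_Cauchy_onI)
  fix e :: real assume e: "e > 0"
  obtain x where x: "x \<in> fst ` G" "dist x z < e / 4"
    using dense closure_approachable[of z "fst ` G"] e by (metis UNIV_I zero_less_divide_iff zero_less_numeral)
  then obtain y where xy: "(x, y) \<in> G" by force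
  have "Cauchy (\<lambda>n. J n y)" using J_tendsto LIMSEQ_imp_Cauchy by blast
  then obtain M where M: "\<And>m n. m \<ge> M \<Longrightarrow> n \<ge> M \<Longrightarrow> dist (J m y) (J n y) < e / (2 * T)"
    unfolding Cauchy_def using e T by (metis divide_pos_pos mult_pos_pos zero_less_numeral)
  show "\<exists>M. \<forall>t\<in>{0..T}. \<forall>m\<ge>M. \<forall>n\<ge>M. dist (endo_app (E m t) z) (endo_app (E n t) z) < e"
  proof (intro exI ballI allI impI)
    fix t m n assume t: "t \<in> {0..T}" and mn: "m \<ge> M" "n \<ge> M"
    have 1: "norm (endo_app (E k t) z - endo_app (E k t) x) < e / 4" for k
    proof -
      have "norm (endo_app (E k t) (z - x)) \<le> norm (z - x)" using t by (intro E_app_norm) simp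
      then show ?thesis using x(2) by (simp add: endo_app.diff_right dist_norm norm_minus_commute)
    qed
    have "norm (endo_app (E m t) x - endo_app (E n t) x) \<le> t * norm (J m y - J n y)"
      using E_diff[of t m x n] t by (simp add: Y_app J_maps_graph(2)[OF xy])
    also have "\<dots> \<le> T * (e / (2 * T))"
      using t M[OF mn] T by (intro mult_mono) (auto simp: dist_norm)
    finally have 2: "norm (endo_app (E m t) x - endo_app (E n t) x) \<le> e / 2" using T by simp
    have "endo_app (E m t) z - endo_app (E n t) z = (endo_app (E m t) z - endo_app (E m t) x)
        + (endo_app (E m t) x - endo_app (E n t) x) - (endo_app (E n t) z - endo_app (E n t) x)" by simp
    then have "norm (endo_app (E m t) z - endo_app (E n t) z) \<le> norm (endo_app (E m t) z - endo_app (E m t) x)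
        + norm (endo_app (E m t) x - endo_app (E n t) x) + norm (endo_app (E n t) z - endo_app (E n t) x)"
      by (simp only: norm_add_diff_le)
    then show "dist (endo_app (E m t) z) (endo_app (E n t) z) < e"
      using 1[of m] 1[of n] 2 by (simp add: dist_norm)
  qed
qed

text \<open>\<open>S\<close>, the limit of \<open>E n t\<close> applied to \<open>y\<close>, serves
  twice: it is the time derivative of the orbit of \<open>x\<close> and, by closedness of the graph,
  the image of that orbit under the generator.\<close>

theorem hille_yosida:
  assumes T: "T > 0" and xy: "(x, y) \<in> G"
  obtains X Y where "X 0 = x" "\<And>t. t \<in> {0..T} \<Longrightarrow> (X t, Y t) \<in> G"
    "\<And>t. t \<in> {0..T} \<Longrightarrow> (X has_vector_derivative Y t) (at t within {0..T})"
    "continuous_on {0..T} Y"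
    "\<And>t. t \<in> {0..T} \<Longrightarrow> norm (X t) \<le> norm x" "\<And>t. t \<in> {0..T} \<Longrightarrow> norm (Y t) \<le> norm y"
proof -
  obtain S where S: "uniform_limit {0..T} (\<lambda>n t. endo_app (E n t) y) S sequentially"
    using E_uniformly_convergent[OF T, of y] by (auto simp: uniformly_convergent_on_def)
  obtain X where X: "uniform_limit {0..T} (\<lambda>n t. endo_app (E n t) x) X sequentially"
    using E_uniformly_convergent[OF T, of x] by (auto simp: uniformly_convergent_on_def)
  have Xt: "(\<lambda>n. endo_app (E n t) x) \<longlonglongrightarrow> X t" if "t \<in> {0..T}" for t using tendsto_uniform_limitI[OF X that] .
  have St: "(\<lambda>n. endo_app (E n t) y) \<longlonglongrightarrow> S t" if "t \<in> {0..T}" for t using tendsto_uniform_limitI[OF S that] .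
  have derE: "((\<lambda>t. endo_app (E n t) x) has_vector_derivative endo_app (E n t) (J n y)) (at t within {0..T})" for n t
  proof -
    have "((\<lambda>t. exp (t *\<^sub>R Y n)) has_vector_derivative exp (t *\<^sub>R Y n) * Y n) (at t within {0..T})"
      by (rule exp_scaleR_has_vector_derivative_right)
    then have "((\<lambda>t. endo_app (exp (t *\<^sub>R Y n)) x) has_vector_derivative endo_app (exp (t *\<^sub>R Y n) * Y n) x) (at t within {0..T})"
      by (rule bounded_linear.has_vector_derivative[OF endo_app.bounded_linear_left])
    then show ?thesis by (simp add: E_def endo_app_mult Y_app J_maps_graph(2)[OF xy])
  qed
  \<comment> \<open>The derivatives contain \<open>J n y\<close> instead of \<open>y\<close>; since
    \<open>E n t\<close> is a contraction, the replacement costs at most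
    \<open>norm (J n y - y)\<close>, uniformly in \<open>t\<close>.\<close>
  have EJ: "uniform_limit {0..T} (\<lambda>n t. endo_app (E n t) (J n y)) S sequentially"
  proof (rule uniform_limitI)
    fix e :: real assume e: "e > 0"
    have "\<forall>\<^sub>F n in sequentially. \<forall>t\<in>{0..T}. dist (endo_app (E n t) y) (S t) < e / 2"
      using S e unfolding uniform_limit_iff by (meson half_gt_zero)
    moreover have "\<forall>\<^sub>F n in sequentially. dist (J n y) y < e / 2"
      using J_tendsto[of y] e unfolding tendsto_iff by (meson half_gt_zero)
    ultimately show "\<forall>\<^sub>F n in sequentially. \<forall>t\<in>{0..T}. dist (endo_app (E n t) (J n y)) (S t) < e"
    proof eventually_elim
      case (elim n)
      show ?case
      proof
        fix t assume t: "t \<in> {0..T}"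
        have "norm (endo_app (E n t) (J n y - y)) \<le> norm (J n y - y)" using t by (intro E_app_norm) simp
        then have "dist (endo_app (E n t) (J n y)) (endo_app (E n t) y) < e / 2"
          using elim(2) by (simp add: endo_app.diff_right dist_norm)
        then show "dist (endo_app (E n t) (J n y)) (S t) < e"
          using elim(1) t dist_triangle_half_l by (metis dist_commute)
      qed
    qed
  qed
  have "\<exists>g. \<forall>t\<in>{0..T}. (\<lambda>n. endo_app (E n t) x) \<longlonglongrightarrow> g t \<and> (g has_derivative (\<lambda>h. h *\<^sub>R S t)) (at t within {0..T})"
  proof (rule has_derivative_sequence[where f' = "\<lambda>n t h. h *\<^sub>R endo_app (E n t) (J n y)"])
    show "((\<lambda>t. endo_app (E n t) x) has_derivative (\<lambda>h. h *\<^sub>R endo_app (E n t) (J n y))) (at t within {0..T})" for n t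
      using derE[of n t] by (simp add: has_vector_derivative_def)
    show "\<forall>\<^sub>F n in sequentially. \<forall>t\<in>{0..T}. \<forall>h. norm (h *\<^sub>R endo_app (E n t) (J n y) - h *\<^sub>R S t) \<le> e * norm h" if e: "e > 0" for e
    proof -
      have "\<forall>\<^sub>F n in sequentially. \<forall>t\<in>{0..T}. dist (endo_app (E n t) (J n y)) (S t) < e"
        using EJ e unfolding uniform_limit_iff by blast
      then show ?thesis
      proof eventually_elim
        case (elim n)
        show ?case
        proof (intro ballI allI)
          fix t h assume "t \<in> {0..T}"
          with elim have "norm (endo_app (E n t) (J n y) - S t) \<le> e" by (auto simp: dist_norm intro: less_imp_le)
          then show "norm (h *\<^sub>R endo_app (E n t) (J n y) - h *\<^sub>R S t) \<le> e * norm h"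
            by (simp add: scaleR_diff_right[symmetric] mult.commute[of e] mult_left_mono)
        qed
      qed
    qed
    show "(\<lambda>n. endo_app (E n 0) x) \<longlonglongrightarrow> X 0" using Xt[of 0] T by simp
    show "0 \<in> {0..T}" using T by simp
  qed simp
  then obtain g where g: "\<And>t. t \<in> {0..T} \<Longrightarrow> (\<lambda>n. endo_app (E n t) x) \<longlonglongrightarrow> g t"
    "\<And>t. t \<in> {0..T} \<Longrightarrow> (g has_vector_derivative S t) (at t within {0..T})"
    unfolding has_vector_derivative_def by blast
  show thesis
  proof (rule that[of g S])
    have "(\<lambda>n. endo_app (E n 0) x) \<longlonglongrightarrow> g 0" using g(1)[of 0] T by simp
    then show "g 0 = x" by (simp add: E_def LIMSEQ_const_iff)
    show "continuous_on {0..T} S"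
    proof (rule uniform_limit_theorem[OF _ S])
      have "continuous_on {0..T} (\<lambda>t. endo_app (E n t) y)" for n
        unfolding E_def
        by (intro endo_app.continuous_on continuous_on_const
              continuous_on_vector_derivative[OF exp_scaleR_has_vector_derivative_right])
      then show "\<forall>\<^sub>F n in sequentially. continuous_on {0..T} (\<lambda>t. endo_app (E n t) y)" by simp
    qed simp
    fix t assume t: "t \<in> {0..T}"
    show "(g has_vector_derivative S t) (at t within {0..T})" by (rule g(2)[OF t])
    show "norm (g t) \<le> norm x"
      using Lim_norm_ubound[OF _ g(1)[OF t]] E_app_norm t by simp
    show "norm (S t) \<le> norm y"
      using Lim_norm_ubound[OF _ St[OF t]] E_app_norm t by simp
    let ?z = "\<lambda>n. endo_app (E n t) x"
    have JE: "J n (endo_app (E n t) v) = endo_app (E n t) (J n v)" for n v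
    proof -
      have "Jop n * E n t = E n t * Jop n"
      proof -
        have "exp (t *\<^sub>R Y n) * Y n = Y n * exp (t *\<^sub>R Y n)"
        \<comment> \<open>An exponential commutes with its argument \<open>t *\<^sub>R Y n\<close>;
          the scalar can be cancelled only for \<open>t \<noteq> 0\<close>.\<close>
        proof (cases "t = 0")
          case False
          then show ?thesis using exp_times_arg_commute[of "t *\<^sub>R Y n"] by simp
        qed simp
        moreover have "Jop n = inverse (kap n) *\<^sub>R Y n + 1" by (simp add: Y_def)
        ultimately show ?thesis by (simp add: E_def algebra_simps)
      qed
      then show ?thesis by (metis Jop(1) endo_app_mult)
    qed
    \<comment> \<open>The image of \<open>?z n\<close> under \<open>J n\<close> lies in the domain
      by construction, and both components of these graph points converge, so closedness of
      \<open>G\<close> applies to the limit.\<close>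
    have "(J n (?z n), endo_app (E n t) (J n y)) \<in> G" for n
    proof -
      have "kap n *\<^sub>R (J n (?z n) - ?z n) = endo_app (E n t) (kap n *\<^sub>R (J n x - x))"
        unfolding JE by (simp add: endo_app.scaleR_right endo_app.diff_right)
      then show ?thesis using J_graph[of n "?z n"] J_maps_graph(2)[OF xy, of n] by simp
    qed
    moreover have "(\<lambda>n. J n (?z n)) \<longlonglongrightarrow> g t"
    proof -
      have "(\<lambda>n. J n (?z n - g t)) \<longlonglongrightarrow> 0"
      proof (rule Lim_null_comparison)
        show "\<forall>\<^sub>F n in sequentially. norm (J n (?z n - g t)) \<le> norm (?z n - g t)" by (simp add: J_norm)
        show "(\<lambda>n. norm (?z n - g t)) \<longlonglongrightarrow> 0" using g(1)[OF t] by (simp add: LIM_zero tendsto_norm_zero)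
      qed
      then have "(\<lambda>n. J n (?z n - g t) + J n (g t)) \<longlonglongrightarrow> 0 + g t" by (intro tendsto_add J_tendsto)
      then show ?thesis by (simp add: J_simps)
    qed
    moreover have "(\<lambda>n. endo_app (E n t) (J n y)) \<longlonglongrightarrow> S t" using tendsto_uniform_limitI[OF EJ t] .
    ultimately show "(g t, S t) \<in> G"
      using closed_sequentially[OF cl, of "\<lambda>n. (J n (?z n), endo_app (E n t) (J n y))" "(g t, S t)"] tendsto_Pair by blast
  qed
qed

end

section \<open>The Hilbert space of square integrable functions\<close>

lemma L2_D: "f \<in> L2 \<Longrightarrow> f \<in> borel_measurable lborel" "f \<in> L2 \<Longrightarrow> integrable lborel (\<lambda>x. (f x)\<^sup>2)"
  by (auto simp: L2_def)

lemma L2_measurable [measurable_dest]: "f \<in> L2 \<Longrightarrow> f \<in> borel_measurable borel"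
  by (auto simp: L2_def)

lemma L2_mult_integrable:
  assumes "f \<in> L2" "g \<in> L2"
  shows "integrable lborel (\<lambda>x. f x * g x)"
proof (rule Bochner_Integration.integrable_bound)
  show "integrable lborel (\<lambda>x. (f x)\<^sup>2 + (g x)\<^sup>2)" using assms by (intro Bochner_Integration.integrable_add L2_D)
  show "(\<lambda>x. f x * g x) \<in> borel_measurable lborel" using assms by (intro borel_measurable_times L2_D)
  have "\<bar>a * b\<bar> \<le> a\<^sup>2 + b\<^sup>2" for a b :: real
  proof -
    have "0 \<le> (\<bar>a\<bar> - \<bar>b\<bar>)\<^sup>2" by simp
    then have "2 * (\<bar>a\<bar> * \<bar>b\<bar>) \<le> a\<^sup>2 + b\<^sup>2" by (simp add: power2_diff)
    moreover have "0 \<le> \<bar>a\<bar> * \<bar>b\<bar>" by simp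
    ultimately show ?thesis unfolding abs_mult by linarith
  qed
  then show "AE x in lborel. norm (f x * g x) \<le> norm ((f x)\<^sup>2 + (g x)\<^sup>2)" by simp
qed

lemma L2_add: "f \<in> L2 \<Longrightarrow> g \<in> L2 \<Longrightarrow> (\<lambda>x. f x + g x) \<in> L2"
  using L2_mult_integrable[of f g] unfolding L2_def
  by (auto simp: power2_sum mult.assoc)

lemma L2_scale: "f \<in> L2 \<Longrightarrow> (\<lambda>x. c * f x) \<in> L2"
  unfolding L2_def by (auto simp: power_mult_distrib)

lemma L2_minus: "f \<in> L2 \<Longrightarrow> (\<lambda>x. - f x) \<in> L2"
  using L2_scale[of f "-1"] by simp

lemma L2_diff: "f \<in> L2 \<Longrightarrow> g \<in> L2 \<Longrightarrow> (\<lambda>x. f x - g x) \<in> L2"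
  using L2_add[of f "\<lambda>x. - g x"] L2_minus[of g] by simp

lemma L2_zero: "(\<lambda>x. 0) \<in> L2"
  by (simp add: L2_def)

\<comment> \<open>The relation is partial: a function outside \<open>L2\<close> is not related even
  to itself and has no class. A type of classes is wanted because the semigroup theory and the
  representation of functionals are stated for types with a complete norm or inner product.\<close>
quotient_type 'n l2 = "real ^ 'n::finite \<Rightarrow> real" / partial: "\<lambda>f g. f \<in> L2 \<and> g \<in> L2 \<and> (AE x in lborel. f x = g x)"
proof (rule part_equivpI)
  show "\<exists>f. f \<in> L2 \<and> f \<in> L2 \<and> (AE x in lborel. f x = f x)" using L2_zero by auto
  show "symp (\<lambda>f g. f \<in> L2 \<and> g \<in> L2 \<and> (AE x in lborel. f x = g x))" by (auto simp: symp_def)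
  show "transp (\<lambda>f g. f \<in> L2 \<and> g \<in> L2 \<and> (AE x in lborel. f x = g x))"
    by (auto simp: transp_def)
qed

instantiation l2 :: (finite) real_vector
begin

lift_definition zero_l2 :: "'a l2" is "\<lambda>x. 0" by (simp add: L2_zero)
lift_definition plus_l2 :: "'a l2 \<Rightarrow> 'a l2 \<Rightarrow> 'a l2" is "\<lambda>f g x. f x + g x" by (auto simp: L2_add)
lift_definition minus_l2 :: "'a l2 \<Rightarrow> 'a l2 \<Rightarrow> 'a l2" is "\<lambda>f g x. f x - g x" by (auto simp: L2_diff)
lift_definition uminus_l2 :: "'a l2 \<Rightarrow> 'a l2" is "\<lambda>f x. - f x" by (auto simp: L2_minus)
lift_definition scaleR_l2 :: "real \<Rightarrow> 'a l2 \<Rightarrow> 'a l2" is "\<lambda>c f x. c * f x" by (auto simp: L2_scale)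

instance
  by standard (transfer; auto simp: algebra_simps L2_add L2_scale L2_minus L2_diff L2_zero)+

end

instantiation l2 :: (finite) real_inner
begin

lift_definition inner_l2 :: "'a l2 \<Rightarrow> 'a l2 \<Rightarrow> real" is "\<lambda>f g. LINT x|lborel. f x * g x"
  by (intro integral_cong_AE) (auto simp: L2_D)
definition norm_l2 :: "'a l2 \<Rightarrow> real" where "norm_l2 a = sqrt (a \<bullet> a)"
definition dist_l2 :: "'a l2 \<Rightarrow> 'a l2 \<Rightarrow> real" where "dist_l2 a b = norm (a - b)"
definition sgn_l2 :: "'a l2 \<Rightarrow> 'a l2" where "sgn_l2 a = scaleR (inverse (norm a)) a"
definition uniformity_l2 :: "('a l2 \<times> 'a l2) filter" where
  "uniformity_l2 = (INF e\<in>{0<..}. principal {(x, y). dist x y < e})"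
definition open_l2 :: "'a l2 set \<Rightarrow> bool" where
  "open_l2 U \<longleftrightarrow> (\<forall>x\<in>U. eventually (\<lambda>(x', y). x' = x \<longrightarrow> y \<in> U) uniformity)"

instance
proof
  fix a b c :: "'a l2" and r :: real and U :: "'a l2 set"
  show "dist a b = norm (a - b)" "sgn a = a /\<^sub>R norm a" "norm a = sqrt (a \<bullet> a)"
    "uniformity = (INF e\<in>{0<..}. principal {(x, y :: 'a l2). dist x y < e})"
    "open U \<longleftrightarrow> (\<forall>x\<in>U. eventually (\<lambda>(x', y). x' = x \<longrightarrow> y \<in> U) uniformity)"
    by (simp_all add: dist_l2_def sgn_l2_def norm_l2_def uniformity_l2_def open_l2_def)
  show "a \<bullet> b = b \<bullet> a" by transfer (simp add: mult.commute)
  show "(a + b) \<bullet> c = a \<bullet> c + b \<bullet> c"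
    by transfer (simp add: distrib_right L2_mult_integrable Bochner_Integration.integral_add)
  show "(r *\<^sub>R a) \<bullet> b = r * (a \<bullet> b)" by transfer (simp add: mult.assoc)
  show "0 \<le> a \<bullet> a" by transfer simp
  show "a \<bullet> a = 0 \<longleftrightarrow> a = 0"
  proof transfer
    fix f :: "real ^ 'a \<Rightarrow> real" assume f: "f \<in> L2 \<and> f \<in> L2 \<and> (AE x in lborel. f x = f x)"
    have "(LINT x|lborel. f x * f x) = 0 \<longleftrightarrow> (AE x in lborel. f x * f x = 0)"
      using f L2_mult_integrable by (intro integral_nonneg_eq_0_iff_AE) auto
    then show "(LINT x|lborel. f x * f x) = 0 \<longleftrightarrow> f \<in> L2 \<and> (\<lambda>x. 0) \<in> L2 \<and> (AE x in lborel. f x = 0)"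
      using f L2_zero by auto
  qed
qed

end

definition to_l2 :: "(real ^ 'n::finite \<Rightarrow> real) \<Rightarrow> 'n l2" where "to_l2 = abs_l2"
definition of_l2 :: "'n::finite l2 \<Rightarrow> real ^ 'n \<Rightarrow> real" where "of_l2 = rep_l2"

lemma to_l2_of_l2 [simp]: "to_l2 (of_l2 a) = a"
  using Quotient_abs_rep[OF Quotient_l2] by (simp add: to_l2_def of_l2_def)

lemma of_l2_L2 [simp]: "of_l2 a \<in> L2"
  using Quotient_rep_reflp[OF Quotient_l2] by (simp add: of_l2_def)

lemma of_l2_measurable [measurable, simp]: "of_l2 a \<in> borel_measurable borel"
  using of_l2_L2 by (rule L2_measurable)

lemma to_l2_eq_iff: "f \<in> L2 \<Longrightarrow> g \<in> L2 \<Longrightarrow> to_l2 f = to_l2 g \<longleftrightarrow> (AE x in lborel. f x = g x)"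
  using Quotient_rel[OF Quotient_l2, of f g] by (simp add: to_l2_def)

lemma of_l2_to_l2: "f \<in> L2 \<Longrightarrow> AE x in lborel. of_l2 (to_l2 f) x = f x"
  by (subst to_l2_eq_iff[symmetric]) auto

lemma to_l2_simps:
  assumes "f \<in> L2" "g \<in> L2"
  shows to_l2_add: "to_l2 (\<lambda>x. f x + g x) = to_l2 f + to_l2 g"
    and to_l2_diff: "to_l2 (\<lambda>x. f x - g x) = to_l2 f - to_l2 g"
    and to_l2_inner: "to_l2 f \<bullet> to_l2 g = (LINT x|lborel. f x * g x)"
  using assms
  by (simp_all add: to_l2_def plus_l2.abs_eq minus_l2.abs_eq inner_l2.abs_eq)

lemma to_l2_scale: "f \<in> L2 \<Longrightarrow> to_l2 (\<lambda>x. c * f x) = c *\<^sub>R to_l2 f"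
  and to_l2_uminus: "f \<in> L2 \<Longrightarrow> to_l2 (\<lambda>x. - f x) = - to_l2 f"
  and to_l2_zero: "to_l2 (\<lambda>x. 0) = 0"
  by (simp_all add: to_l2_def scaleR_l2.abs_eq uminus_l2.abs_eq zero_l2.abs_eq)

lemma norm_to_l2: "f \<in> L2 \<Longrightarrow> norm (to_l2 f) = L2_norm f"
  by (simp add: norm_eq_sqrt_inner to_l2_inner L2_norm_def power2_eq_square)

lemma norm_l2_eq: "norm a = L2_norm (of_l2 a)"
  using norm_to_l2[of "of_l2 a"] by simp

lemma inner_l2_eq: "a \<bullet> b = (LINT x|lborel. of_l2 a x * of_l2 b x)"
  using to_l2_inner[of "of_l2 a" "of_l2 b"] by simp

lemma nn_integral_square_l2: "f \<in> L2 \<Longrightarrow> (\<integral>\<^sup>+ x. ennreal ((f x)\<^sup>2) \<partial>lborel) = ennreal ((norm (to_l2 f))\<^sup>2)"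
  by (subst nn_integral_eq_integral)
    (auto simp: L2_D norm_to_l2 L2_norm_def real_sqrt_pow2 integral_nonneg_AE)

text \<open>The operators form an algebra with unit of norm 1 only if the space contains a nonzero
  vector. The indicator of the unit cube is one, and its small multiples show that no point is
  isolated.\<close>

instance l2 :: (finite) perfect_space
proof
  fix a :: "'a l2"
  define B where "B = (cbox 0 One :: (real ^ 'a) set)"
  have [measurable]: "B \<in> sets lborel" by (simp add: B_def)
  have sq: "(indicator B x :: real)\<^sup>2 = indicator B x" for x by (simp add: indicator_def)
  have B2: "(indicator B :: _ \<Rightarrow> real) \<in> L2"
  proof -
    have "emeasure lborel B < \<infinity>" by (simp add: B_def emeasure_lborel_cbox_finite)
    then have "integrable lborel (indicator B :: _ \<Rightarrow> real)" by (intro integrable_real_indicator) (auto simp: B_def)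
    then show ?thesis by (simp add: L2_def sq)
  qed
  have "measure lborel B = 1" unfolding B_def by (subst content_cbox) auto
  define b where "b = to_l2 (indicator B :: real ^ 'a \<Rightarrow> real)"
  have "b \<bullet> b = (LINT x|lborel. indicator B x)"
    unfolding b_def to_l2_inner[OF B2 B2] power2_eq_square[symmetric] sq ..
  also have "\<dots> = 1" using \<open>measure lborel B = 1\<close> by (simp add: B_def)
  finally have b: "b \<noteq> 0" by auto
  show "\<not> open {a}"
  proof
    assume "open {a}"
    then obtain e where e: "e > 0" "\<And>y. dist y a < e \<Longrightarrow> y = a" unfolding open_dist by auto
    define y where "y = a + (e / (2 * norm b)) *\<^sub>R b"
    have "dist y a = e / 2" using b e by (simp add: y_def dist_norm)
    then have "y = a" using e by simp
    then show False using b e by (simp add: y_def)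
  qed
qed

instance l2 :: (finite) complete_space
proof
  fix X :: "nat \<Rightarrow> 'a l2" assume X: "Cauchy X"
  \<comment> \<open>Along a fast subsequence \<open>\<Sum> 2\<^sup>n |f\<^sub>n\<^sub>+\<^sub>1 - f\<^sub>n|\<^sup>2\<close> is integrable; almost everywhere convergence then follows
    from \<open>g \<le> 2\<^sup>n g\<^sup>2 + 2\<^sup>-\<^sup>n\<close>.\<close>
  have "\<exists>N. \<forall>m\<ge>N. \<forall>n\<ge>N. dist (X m) (X n) < (1/2) ^ k" for k :: nat
    using X unfolding Cauchy_def by simp
  then obtain N where N: "\<And>k m n. m \<ge> N k \<Longrightarrow> n \<ge> N k \<Longrightarrow> dist (X m) (X n) < (1/2) ^ k" by metis
  \<comment> \<open>The sum dominates every \<open>N k\<close> with \<open>k \<le> n\<close>, so one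
    index serves all these accuracies although \<open>N\<close> may fail to be monotone.\<close>
  define r where "r n = (\<Sum>i\<le>n. N i)" for n :: nat
  have r: "N k \<le> r n" if "k \<le> n" for k n
    unfolding r_def using that by (intro member_le_sum) auto
  define f where "f n = of_l2 (X (r n))" for n
  have fL2: "f n \<in> L2" for n by (simp add: f_def)
  have [measurable]: "f n \<in> borel_measurable borel" for n by (simp add: f_def)
  define F where "F x = (\<Sum>n. ennreal (2 ^ n * (f (Suc n) x - f n x)\<^sup>2))" for x
  have "(\<integral>\<^sup>+ x. F x \<partial>lborel) = (\<Sum>n. \<integral>\<^sup>+ x. ennreal (2 ^ n * (f (Suc n) x - f n x)\<^sup>2) \<partial>lborel)"
    unfolding F_def by (rule nn_integral_suminf) simp
  also have "\<dots> \<le> (\<Sum>n. ennreal ((1/2) ^ n))"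
  proof (intro suminf_le)
    fix n
    have d: "(norm (to_l2 (\<lambda>x. f (Suc n) x - f n x)))\<^sup>2 \<le> ((1/2) ^ n)\<^sup>2"
    proof (rule power_mono)
      have "to_l2 (\<lambda>x. f (Suc n) x - f n x) = X (r (Suc n)) - X (r n)"
        using to_l2_diff[OF fL2 fL2] by (simp add: f_def)
      then show "norm (to_l2 (\<lambda>x. f (Suc n) x - f n x)) \<le> (1/2) ^ n"
        using N[OF r r, of n "Suc n" n] by (simp add: dist_norm)
    qed simp
    have "(\<integral>\<^sup>+ x. ennreal (2 ^ n * (f (Suc n) x - f n x)\<^sup>2) \<partial>lborel) = 2 ^ n * (\<integral>\<^sup>+ x. ennreal ((f (Suc n) x - f n x)\<^sup>2) \<partial>lborel)"
      by (simp add: ennreal_mult' nn_integral_cmult ennreal_power[symmetric])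
    also have "\<dots> = ennreal (2 ^ n * (norm (to_l2 (\<lambda>x. f (Suc n) x - f n x)))\<^sup>2)"
      by (simp add: nn_integral_square_l2 L2_diff fL2 ennreal_mult' ennreal_power[symmetric])
    also have "\<dots> \<le> ennreal (2 ^ n * ((1/2) ^ n)\<^sup>2)"
      by (intro ennreal_leI mult_left_mono d) simp
    also have "2 ^ n * ((1/2) ^ n)\<^sup>2 = ((1/2) ^ n :: real)"
      by (simp add: power2_eq_square power_divide)
    finally show "(\<integral>\<^sup>+ x. ennreal (2 ^ n * (f (Suc n) x - f n x)\<^sup>2) \<partial>lborel) \<le> ennreal ((1/2) ^ n)" .
  qed auto
  also have "\<dots> = ennreal (\<Sum>n. (1/2) ^ n)"
    by (rule suminf_ennreal2) (auto intro: summable_geometric)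
  finally have "(\<integral>\<^sup>+ x. F x \<partial>lborel) \<noteq> \<infinity>" by (auto simp: top_unique)
  moreover have "F \<in> borel_measurable lborel" unfolding F_def by measurable
  ultimately have "AE x in lborel. F x \<noteq> \<infinity>" using nn_integral_noteq_infinite by blast
  then have conv: "AE x in lborel. convergent (\<lambda>n. f n x)"
  proof eventually_elim
    case (elim x)
    have s1: "summable (\<lambda>n. 2 ^ n * (f (Suc n) x - f n x)\<^sup>2)"
      using elim unfolding F_def by (intro summable_suminf_not_top) auto
    have s2: "summable (\<lambda>n. (1/2 :: real) ^ n)" by (rule summable_geometric) simp
    have "summable (\<lambda>n. f (Suc n) x - f n x)"
    proof (rule summable_comparison_test[OF _ summable_add[OF s1 s2]], intro exI allI impI)
      fix n :: nat
      define g where "g = \<bar>f (Suc n) x - f n x\<bar>"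
      have "g \<le> 2 ^ n * g\<^sup>2 + (1/2) ^ n"
      proof -
        have "0 \<le> (2 ^ n * g - 1)\<^sup>2" by simp
        then have "2 ^ n * (2 * g) \<le> 2 ^ n * (2 ^ n * g\<^sup>2 + (1/2) ^ n)"
          by (simp add: power2_diff power_mult_distrib algebra_simps power_divide power2_eq_square)
        then have "2 * g \<le> 2 ^ n * g\<^sup>2 + (1/2) ^ n" by (rule mult_left_le_imp_le) simp
        moreover have "0 \<le> g" by (simp add: g_def)
        ultimately show ?thesis by linarith
      qed
      then show "norm (f (Suc n) x - f n x) \<le> 2 ^ n * (f (Suc n) x - f n x)\<^sup>2 + (1/2) ^ n"
        by (simp add: g_def)
    qed
    then have "convergent (\<lambda>n. \<Sum>i<n. f (Suc i) x - f i x)" by (simp add: summable_iff_convergent)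
    then have "convergent (\<lambda>n. f n x - f 0 x)" using sum_lessThan_telescope[of "\<lambda>i. f i x"] by simp
    then show ?case using convergent_diff_const_right_iff[of "\<lambda>n. f n x" "f 0 x"] by simp
  qed
  define g where "g x = lim (\<lambda>n. f n x)" for x
  have [measurable]: "g \<in> borel_measurable borel" unfolding g_def by measurable
  have lim: "AE x in lborel. (\<lambda>n. f n x) \<longlonglongrightarrow> g x"
    using conv by eventually_elim (simp add: g_def convergent_LIMSEQ_iff)
  \<comment> \<open>Fatou along the subsequence turns the Cauchy estimate into a bound on the
    distance to \<open>g\<close>, for all later members of the original sequence. The case
    \<open>k = 0\<close> puts \<open>g\<close> into \<open>L2\<close>, the other cases give
    convergence.\<close>
  have fatou: "(\<integral>\<^sup>+ x. ennreal ((of_l2 (X m) x - g x)\<^sup>2) \<partial>lborel) \<le> ennreal (((1/2) ^ k)\<^sup>2)" if m: "m \<ge> N k" for m k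
  proof -
    have "(\<integral>\<^sup>+ x. ennreal ((of_l2 (X m) x - g x)\<^sup>2) \<partial>lborel) = (\<integral>\<^sup>+ x. liminf (\<lambda>n. ennreal ((of_l2 (X m) x - f n x)\<^sup>2)) \<partial>lborel)"
    proof (rule nn_integral_cong_AE)
      show "AE x in lborel. ennreal ((of_l2 (X m) x - g x)\<^sup>2) = liminf (\<lambda>n. ennreal ((of_l2 (X m) x - f n x)\<^sup>2))"
        using lim
      proof eventually_elim
        case (elim x)
        have "(\<lambda>n. ennreal ((of_l2 (X m) x - f n x)\<^sup>2)) \<longlonglongrightarrow> ennreal ((of_l2 (X m) x - g x)\<^sup>2)"
          by (intro tendsto_intros elim)
        then show ?case by (intro lim_imp_Liminf[symmetric]) simp_all
      qed
    qed
    also have "\<dots> \<le> liminf (\<lambda>n. \<integral>\<^sup>+ x. ennreal ((of_l2 (X m) x - f n x)\<^sup>2) \<partial>lborel)"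
      by (rule nn_integral_liminf) simp
    also have "\<dots> \<le> limsup (\<lambda>n. \<integral>\<^sup>+ x. ennreal ((of_l2 (X m) x - f n x)\<^sup>2) \<partial>lborel)"
      by (rule Liminf_le_Limsup) simp
    also have "\<dots> \<le> ennreal (((1/2) ^ k)\<^sup>2)"
    proof (rule Limsup_bounded, rule eventually_sequentiallyI)
      fix n assume n: "n \<ge> k"
      have "to_l2 (\<lambda>x. of_l2 (X m) x - f n x) = X m - X (r n)"
        using to_l2_diff[OF of_l2_L2 fL2] by (simp add: f_def)
      then have "(norm (to_l2 (\<lambda>x. of_l2 (X m) x - f n x)))\<^sup>2 \<le> ((1/2) ^ k)\<^sup>2"
        using N[OF m r[OF n]] by (intro power_mono) (auto simp: dist_norm)
      then show "(\<integral>\<^sup>+ x. ennreal ((of_l2 (X m) x - f n x)\<^sup>2) \<partial>lborel) \<le> ennreal (((1/2) ^ k)\<^sup>2)"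
        by (simp add: nn_integral_square_l2 L2_diff fL2 ennreal_leI)
    qed
    finally show ?thesis .
  qed
  have dL2: "(\<lambda>x. of_l2 (X (N 0)) x - g x) \<in> L2"
    unfolding L2_def
  proof (safe intro!: integrableI_nonneg)
    show "(\<integral>\<^sup>+ x. ennreal ((of_l2 (X (N 0)) x - g x)\<^sup>2) \<partial>lborel) < \<infinity>"
      using le_less_trans[OF fatou[of 0 "N 0"] ennreal_less_top] by simp
  qed auto
  have gL2: "g \<in> L2" using L2_diff[OF of_l2_L2[of "X (N 0)"] dL2] by simp
  have "X \<longlonglongrightarrow> to_l2 g"
  proof (rule LIMSEQ_I)
    fix e :: real assume "e > 0"
    then obtain k where k: "(1/2) ^ k < e" using real_arch_pow_inv[of e "1/2"] by auto
    show "\<exists>M. \<forall>m\<ge>M. norm (X m - to_l2 g) < e"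
    proof (intro exI allI impI)
      fix m assume m: "m \<ge> N k"
      have "X m - to_l2 g = to_l2 (\<lambda>x. of_l2 (X m) x - g x)" by (simp add: to_l2_diff gL2)
      then have "ennreal ((norm (X m - to_l2 g))\<^sup>2) \<le> ennreal (((1/2) ^ k)\<^sup>2)"
        using fatou[OF m] by (simp add: nn_integral_square_l2 L2_diff gL2)
      then have "(norm (X m - to_l2 g))\<^sup>2 \<le> ((1/2) ^ k)\<^sup>2" by (subst (asm) ennreal_le_iff) auto
      then have "norm (X m - to_l2 g) \<le> (1/2) ^ k" by (rule power2_le_imp_le) simp
      then show "norm (X m - to_l2 g) < e" using k by linarith
    qed
  qed
  then show "convergent X" by (auto simp: convergent_def)
qed

instance l2 :: (finite) banach ..

text \<open>The state space of the first-order system is a product, and its operators must again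
  form an algebra with unit of norm 1.\<close>

instance prod :: ("{perfect_space,topological_space}", topological_space) perfect_space
proof
  fix p :: "'a \<times> 'b"
  show "\<not> open {p}"
  proof
    assume "open {p}"
    then have "open (fst ` {p})" by (rule open_image_fst)
    then show False using not_open_singleton[of "fst p"] by simp
  qed
qed

section \<open>Test functions\<close>

lemma partial_eq: "(f has_derivative D) (at x) \<Longrightarrow> partial i f x = D (axis i 1)"
  unfolding partial_def by (simp add: frechet_derivative_at[symmetric])

lemma partial_has_derivative:
  "f differentiable (at x) \<Longrightarrow> (f has_derivative frechet_derivative f (at x)) (at x)"
  by (simp add: frechet_derivative_works)

text \<open>Unlike \<open>smooth\<close>, finite orders of differentiability allow an induction for products.\<close>

fun Ck :: "nat \<Rightarrow> (real ^ 'n::finite \<Rightarrow> real) \<Rightarrow> bool" where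
  "Ck 0 f \<longleftrightarrow> (\<forall>x. f differentiable (at x))"
| "Ck (Suc m) f \<longleftrightarrow> (\<forall>x. f differentiable (at x)) \<and> (\<forall>i. Ck m (partial i f))"

lemma Ck_differentiable: "Ck m f \<Longrightarrow> f differentiable (at x)"
  by (cases m) auto

lemma Ck_Suc_D: "Ck (Suc m) f \<Longrightarrow> Ck m f"
  by (induction m arbitrary: f) auto

lemma partials_append: "partials (ks @ [i]) f = partials ks (partial i f)"
  by (simp add: partials_def)

text \<open>\<open>partials\<close> folds from the right, so the last direction of the list is
  differentiated first; the induction therefore splits the list at its end.\<close>

lemma Ck_iff: "Ck m f \<longleftrightarrow> (\<forall>ks. length ks \<le> m \<longrightarrow> partials ks f differentiable_on UNIV)"
proof (induction m arbitrary: f)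
  case 0
  then show ?case by (simp add: partials_def differentiable_on_def)
next
  case (Suc m)
  show ?case
  proof
    assume *: "Ck (Suc m) f"
    show "\<forall>ks. length ks \<le> Suc m \<longrightarrow> partials ks f differentiable_on UNIV"
    proof (intro allI impI)
      fix ks :: "'a list" assume "length ks \<le> Suc m"
      then show "partials ks f differentiable_on UNIV"
        using * Suc by (cases ks rule: rev_cases) (auto simp: partials_append partials_def differentiable_on_def)
    qed
  next
    assume *: "\<forall>ks. length ks \<le> Suc m \<longrightarrow> partials ks f differentiable_on UNIV"
    have "partials [] f differentiable_on UNIV" using *[rule_format, of "[]"] by simp
    then have "f differentiable (at x)" for x by (simp add: partials_def differentiable_on_def)
    moreover have "Ck m (partial i f)" for i
      unfolding Suc
    proof (intro allI impI)
      fix ks :: "'a list" assume "length ks \<le> m"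
      then show "partials ks (partial i f) differentiable_on UNIV"
        using *[rule_format, of "ks @ [i]"] by (simp add: partials_append)
    qed
    ultimately show "Ck (Suc m) f" by simp
  qed
qed

lemma smooth_iff_Ck: "smooth f \<longleftrightarrow> (\<forall>m. Ck m f)"
  unfolding smooth_def Ck_iff by blast

lemma partial_add:
  assumes "\<And>x. f differentiable (at x)" "\<And>x. g differentiable (at x)"
  shows "partial i (\<lambda>x. f x + g x) = (\<lambda>x. partial i f x + partial i g x)"
proof
  fix x
  have "((\<lambda>x. f x + g x) has_derivative
      (\<lambda>h. frechet_derivative f (at x) h + frechet_derivative g (at x) h)) (at x)"
    by (intro has_derivative_add partial_has_derivative assms)
  then show "partial i (\<lambda>x. f x + g x) x = partial i f x + partial i g x"
    by (simp add: partial_eq) (simp add: partial_def)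
qed

lemma partial_scale:
  assumes "\<And>x. f differentiable (at x)"
  shows "partial i (\<lambda>x. c * f x) = (\<lambda>x. c * partial i f x)"
proof
  fix x
  have "((\<lambda>x. c * f x) has_derivative (\<lambda>h. c * frechet_derivative f (at x) h)) (at x)"
    by (intro has_derivative_mult_right partial_has_derivative assms)
  then show "partial i (\<lambda>x. c * f x) x = c * partial i f x" by (simp add: partial_eq) (simp add: partial_def)
qed

lemma partial_mult:
  assumes "\<And>x. f differentiable (at x)" "\<And>x. g differentiable (at x)"
  shows "partial i (\<lambda>x. f x * g x) = (\<lambda>x. f x * partial i g x + partial i f x * g x)"
proof
  fix x
  have "((\<lambda>x. f x * g x) has_derivative
      (\<lambda>h. f x * frechet_derivative g (at x) h + frechet_derivative f (at x) h * g x)) (at x)"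
    by (intro has_derivative_mult partial_has_derivative assms)
  then show "partial i (\<lambda>x. f x * g x) x = f x * partial i g x + partial i f x * g x"
    by (simp add: partial_eq) (simp add: partial_def)
qed

lemma partial_affine:
  assumes "\<And>x. f differentiable (at x)"
  shows "partial i (\<lambda>x. f (a + c *\<^sub>R x)) = (\<lambda>x. c * partial i f (a + c *\<^sub>R x))"
proof
  fix x
  have "((\<lambda>x. a + c *\<^sub>R x) has_derivative (\<lambda>h. c *\<^sub>R h)) (at x)" by (auto intro!: derivative_eq_intros)
  from has_derivative_compose[OF this partial_has_derivative[OF assms]]
  have *: "((\<lambda>x. f (a + c *\<^sub>R x)) has_derivative (\<lambda>h. frechet_derivative f (at (a + c *\<^sub>R x)) (c *\<^sub>R h))) (at x)" .
  have "linear (frechet_derivative f (at (a + c *\<^sub>R x)))" using assms by (rule linear_frechet_derivative)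
  then show "partial i (\<lambda>x. f (a + c *\<^sub>R x)) x = c * partial i f (a + c *\<^sub>R x)"
    by (simp add: partial_eq[OF *] linear_scale) (simp add: partial_def)
qed

lemma Ck_add: "Ck m f \<Longrightarrow> Ck m g \<Longrightarrow> Ck m (\<lambda>x. f x + g x)"
  by (induction m arbitrary: f g) (auto simp: partial_add)

lemma Ck_scale: "Ck m f \<Longrightarrow> Ck m (\<lambda>x. c * f x)"
  by (induction m arbitrary: f) (auto simp: partial_scale)

lemma Ck_mult: "Ck m f \<Longrightarrow> Ck m g \<Longrightarrow> Ck m (\<lambda>x. f x * g x)"
proof (induction m arbitrary: f g)
  case (Suc m)
  have "Ck m f" "Ck m g" using Suc.prems Ck_Suc_D by auto
  then show ?case using Suc by (auto simp: partial_mult intro!: Ck_add)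
qed auto

lemma Ck_affine: "Ck m f \<Longrightarrow> Ck m (\<lambda>x. f (a + c *\<^sub>R x))"
proof (induction m arbitrary: f)
  case 0
  have "(\<lambda>x. f (a + c *\<^sub>R x)) differentiable (at x)" for x
    by (rule differentiable_compose[of f]) (use 0 in auto)
  then show ?case by simp
next
  case (Suc m)
  have "(\<lambda>x. f (a + c *\<^sub>R x)) differentiable (at x)" for x
    by (rule differentiable_compose[of f]) (use Suc.prems in auto)
  then show ?case using Suc by (auto simp: partial_affine intro!: Ck_scale)
qed

lemma smooth_differentiable: "smooth f \<Longrightarrow> f differentiable (at x)"
  using Ck_differentiable smooth_iff_Ck by blast

lemma smooth_partial: "smooth f \<Longrightarrow> smooth (partial i f)"
  unfolding smooth_iff_Ck using Ck.simps(2) by blast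

lemma test_functions_iff:
  "\<phi> \<in> test_functions \<longleftrightarrow> smooth \<phi> \<and> (\<exists>R. \<forall>x. R < norm x \<longrightarrow> \<phi> x = 0)"
proof
  assume "\<phi> \<in> test_functions"
  then obtain K where K: "compact K" "smooth \<phi>" "\<And>x. x \<notin> K \<Longrightarrow> \<phi> x = 0"
    by (auto simp: test_functions_def test_on_def)
  obtain R where "\<And>x. x \<in> K \<Longrightarrow> norm x \<le> R" using compact_imp_bounded[OF K(1)] bounded_iff by metis
  then show "smooth \<phi> \<and> (\<exists>R. \<forall>x. R < norm x \<longrightarrow> \<phi> x = 0)" using K by (meson not_le)
next
  assume "smooth \<phi> \<and> (\<exists>R. \<forall>x. R < norm x \<longrightarrow> \<phi> x = 0)"
  then obtain R where R: "smooth \<phi>" "\<And>x. R < norm x \<Longrightarrow> \<phi> x = 0" by blast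
  then have "\<phi> \<in> test_on (cball 0 R)" by (auto simp: test_on_def)
  then show "\<phi> \<in> test_functions" unfolding test_functions_def using compact_cball by blast
qed

lemma test_support:
  assumes "\<phi> \<in> test_functions"
  obtains R where "R > 0" "\<And>x. R < norm x \<Longrightarrow> \<phi> x = 0"
proof -
  obtain R where "\<And>x. R < norm x \<Longrightarrow> \<phi> x = 0" using assms by (auto simp: test_functions_iff)
  then show thesis by (intro that[of "max R 1"]) auto
qed

lemma test_differentiable: "\<phi> \<in> test_functions \<Longrightarrow> \<phi> differentiable (at x)"
  by (simp add: test_functions_iff smooth_differentiable)

lemma test_continuous: "\<phi> \<in> test_functions \<Longrightarrow> continuous_on A \<phi>"
  using test_differentiable differentiable_imp_continuous_within
  by (metis continuous_at_imp_continuous_on)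

lemma test_measurable: "\<phi> \<in> test_functions \<Longrightarrow> \<phi> \<in> borel_measurable borel"
  using test_continuous by (rule borel_measurable_continuous_onI)

lemma test_add: "\<phi> \<in> test_functions \<Longrightarrow> \<eta> \<in> test_functions \<Longrightarrow> (\<lambda>x. \<phi> x + \<eta> x) \<in> test_functions"
proof -
  assume *: "\<phi> \<in> test_functions" "\<eta> \<in> test_functions"
  obtain R R' where "\<And>x. R < norm x \<Longrightarrow> \<phi> x = 0" "\<And>x. R' < norm x \<Longrightarrow> \<eta> x = 0"
    using * by (auto simp: test_functions_iff)
  then have "\<forall>x. max R R' < norm x \<longrightarrow> \<phi> x + \<eta> x = 0" by simp
  moreover have "smooth (\<lambda>x. \<phi> x + \<eta> x)" using * by (auto simp: test_functions_iff smooth_iff_Ck intro: Ck_add)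
  ultimately show ?thesis unfolding test_functions_iff by blast
qed

lemma test_scale: "\<phi> \<in> test_functions \<Longrightarrow> (\<lambda>x. c * \<phi> x) \<in> test_functions"
  unfolding test_functions_iff smooth_iff_Ck using Ck_scale by fastforce

lemma test_mult: "\<phi> \<in> test_functions \<Longrightarrow> \<eta> \<in> test_functions \<Longrightarrow> (\<lambda>x. \<phi> x * \<eta> x) \<in> test_functions"
  unfolding test_functions_iff smooth_iff_Ck using Ck_mult by fastforce

lemma test_affine:
  assumes "\<phi> \<in> test_functions" "c \<noteq> 0"
  shows "(\<lambda>x. \<phi> (a + c *\<^sub>R x)) \<in> test_functions"
proof -
  obtain R where R: "R > 0" "\<And>x. R < norm x \<Longrightarrow> \<phi> x = 0" using test_support[OF assms(1)] by blast
  have "\<phi> (a + c *\<^sub>R x) = 0" if "(R + norm a) / \<bar>c\<bar> < norm x" for x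
  proof (rule R(2))
    have "R + norm a < norm (c *\<^sub>R x)" using that assms(2) by (simp add: field_simps)
    then show "R < norm (a + c *\<^sub>R x)" using norm_diff_ineq[of "c *\<^sub>R x" a] by (simp add: add.commute)
  qed
  then show ?thesis using assms(1) Ck_affine unfolding test_functions_iff smooth_iff_Ck by blast
qed

lemma test_translate: "\<phi> \<in> test_functions \<Longrightarrow> (\<lambda>x. \<phi> (x + a)) \<in> test_functions"
  using test_affine[of \<phi> 1 a] by (simp add: add.commute)

lemma test_partial: "\<phi> \<in> test_functions \<Longrightarrow> partial i \<phi> \<in> test_functions"
proof -
  assume *: "\<phi> \<in> test_functions"
  then obtain R where R: "R > 0" "\<And>x. R < norm x \<Longrightarrow> \<phi> x = 0" using test_support by blast
  have "partial i \<phi> x = 0" if "R < norm x" for x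
  proof -
    have "((\<lambda>x. 0) has_derivative (\<lambda>h. 0)) (at x)" by simp
    then have "(\<phi> has_derivative (\<lambda>h. 0)) (at x)"
    proof (rule has_derivative_transform_within_open)
      show "open (- cball 0 R :: (real ^ 'a) set)" by (simp add: open_Compl)
    qed (use that R in auto)
    then show ?thesis by (simp add: partial_eq)
  qed
  then show ?thesis using * smooth_partial unfolding test_functions_iff by blast
qed

lemma partial_translate:
  assumes "\<phi> \<in> test_functions"
  shows "partial i (\<lambda>x. \<phi> (x + a)) = (\<lambda>x. partial i \<phi> (x + a))"
  using partial_affine[of \<phi> i a 1] test_differentiable[OF assms] by (simp add: add.commute)

lemma test_bounded:
  assumes "\<phi> \<in> test_functions"
  obtains M where "M \<ge> 0" "\<And>x. \<bar>\<phi> x\<bar> \<le> M"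
proof -
  obtain R where R: "R > 0" "\<And>x. R < norm x \<Longrightarrow> \<phi> x = 0" using test_support[OF assms] by blast
  have "bounded (\<phi> ` cball 0 R)"
    by (intro compact_imp_bounded compact_continuous_image test_continuous assms compact_cball)
  then obtain B where B: "\<And>x. x \<in> cball 0 R \<Longrightarrow> \<bar>\<phi> x\<bar> \<le> B" by (force simp: bounded_iff)
  show thesis
  proof (rule that[of "max B 0"])
    show "\<bar>\<phi> x\<bar> \<le> max B 0" for x using B[of x] R(2)[of x] by (cases "norm x \<le> R") auto
  qed simp
qed

section \<open>Local integrability and pairing with test functions\<close>

lemma locally_integrable_measurable: "locally_integrable k \<Longrightarrow> k \<in> borel_measurable borel"
  by (simp add: locally_integrable_def)

lemma locally_integrable_cball:
  "locally_integrable k \<Longrightarrow> integrable lborel (\<lambda>x. indicator (cball a R) x * k x)"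
  using compact_cball unfolding locally_integrable_def set_integrable_def by auto

lemma locally_integrable_mult:
  assumes k: "locally_integrable k" and \<phi>: "\<phi> \<in> borel_measurable borel"
    and supp: "\<And>x. R < norm x \<Longrightarrow> \<phi> x = 0" and bound: "\<And>x. \<bar>\<phi> x\<bar> \<le> M"
  shows "integrable lborel (\<lambda>x. k x * \<phi> x)"
proof (rule Bochner_Integration.integrable_bound)
  show "integrable lborel (\<lambda>x. M * (indicator (cball 0 R) x * k x))"
    by (intro integrable_mult_right locally_integrable_cball k)
  show "(\<lambda>x. k x * \<phi> x) \<in> borel_measurable lborel"
    using \<phi> locally_integrable_measurable[OF k] by simp
  have M: "M \<ge> 0" using bound[of 0] by linarith
  have "norm (k x * \<phi> x) \<le> norm (M * (indicator (cball 0 R) x * k x))" for x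
  proof (cases "norm x \<le> R")
    case True
    have "\<bar>k x\<bar> * \<bar>\<phi> x\<bar> \<le> \<bar>k x\<bar> * M" by (intro mult_left_mono bound) simp
    then show ?thesis using True M by (simp add: abs_mult mult.commute)
  next
    case False
    then show ?thesis using supp[of x] by simp
  qed
  then show "AE x in lborel. norm (k x * \<phi> x) \<le> norm (M * (indicator (cball 0 R) x * k x))" by simp
qed

lemma locally_integrable_test:
  assumes "locally_integrable k" "\<phi> \<in> test_functions"
  shows "integrable lborel (\<lambda>x. k x * \<phi> x)"
proof -
  obtain R M where "\<And>x. R < norm x \<Longrightarrow> \<phi> x = 0" "\<And>x. \<bar>\<phi> x\<bar> \<le> M"
    using test_support[OF assms(2)] test_bounded[OF assms(2)] by metis
  then show ?thesis using locally_integrable_mult[OF assms(1) test_measurable[OF assms(2)]] by blast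
qed

lemma locally_integrable_add:
  "locally_integrable f \<Longrightarrow> locally_integrable g \<Longrightarrow> locally_integrable (\<lambda>x. f x + g x)"
  unfolding locally_integrable_def by (auto intro!: set_integral_add)

lemma locally_integrable_scale: "locally_integrable f \<Longrightarrow> locally_integrable (\<lambda>x. c * f x)"
  unfolding locally_integrable_def by auto

lemma locally_integrable_bounded:
  assumes "f \<in> borel_measurable borel" "AE x in lborel. \<bar>f x\<bar> \<le> M"
  shows "locally_integrable f"
  unfolding locally_integrable_def set_integrable_def
proof (intro conjI allI impI)
  fix K :: "(real ^ 'a) set" assume K: "compact K"
  then have [measurable]: "K \<in> sets borel" using borel_compact by blast
  have "emeasure lborel K < \<infinity>" using K emeasure_compact_finite by blast
  then have "integrable lborel (\<lambda>x. M * indicator K x)"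
    by (intro integrable_mult_right integrable_real_indicator) auto
  then show "integrable lborel (\<lambda>x. indicator K x *\<^sub>R f x)"
  proof (rule Bochner_Integration.integrable_bound)
    show "AE x in lborel. norm (indicator K x *\<^sub>R f x) \<le> norm (M * indicator K x :: real)"
      using assms(2) by eventually_elim (auto simp: indicator_def)
  qed (use assms(1) in simp)
qed (use assms(1) in simp)

lemma locally_integrable_L2:
  assumes "f \<in> L2" shows "locally_integrable f"
  unfolding locally_integrable_def set_integrable_def
proof (intro conjI allI impI)
  fix K :: "(real ^ 'a) set" assume K: "compact K"
  then have [measurable]: "K \<in> sets borel" using borel_compact by blast
  have "emeasure lborel K < \<infinity>" using K emeasure_compact_finite by blast
  then have "integrable lborel (\<lambda>x. indicator K x + (f x)\<^sup>2)"
    by (intro Bochner_Integration.integrable_add integrable_real_indicator L2_D assms) auto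
  then show "integrable lborel (\<lambda>x. indicator K x *\<^sub>R f x)"
  proof (rule Bochner_Integration.integrable_bound)
    have "\<bar>f x\<bar> \<le> 1 + (f x)\<^sup>2" for x
    proof -
      have "0 \<le> (\<bar>f x\<bar> - 1)\<^sup>2" by simp
      then have "2 * \<bar>f x\<bar> \<le> 1 + (f x)\<^sup>2" by (simp add: power2_diff)
      then show ?thesis using abs_ge_zero[of "f x"] by linarith
    qed
    then show "AE x in lborel. norm (indicator K x *\<^sub>R f x) \<le> norm (indicator K x + (f x)\<^sup>2 :: real)"
      by (auto simp: indicator_def)
  qed (use assms L2_D in simp)
qed (use assms L2_D in simp)

lemma test_L2:
  assumes "\<phi> \<in> test_functions" shows "\<phi> \<in> L2"
proof -
  obtain M where M: "\<And>x. \<bar>\<phi> x\<bar> \<le> M" using test_bounded[OF assms] by metis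
  have "locally_integrable \<phi>"
    by (rule locally_integrable_bounded[of _ M]) (use M test_measurable[OF assms] in auto)
  then have "integrable lborel (\<lambda>x. \<phi> x * \<phi> x)" using assms by (rule locally_integrable_test)
  then show ?thesis using test_measurable[OF assms] by (simp add: L2_def power2_eq_square)
qed

lemma test_integrable:
  assumes "\<phi> \<in> test_functions" shows "integrable lborel \<phi>"
proof -
  have "locally_integrable (\<lambda>x::real^'a. 1)" by (rule locally_integrable_bounded[of _ 1]) auto
  from locally_integrable_test[OF this assms] show ?thesis by simp
qed

section \<open>The fundamental lemma of the calculus of variations\<close>

lemma integral_affine:
  fixes f :: "real ^ 'n::finite \<Rightarrow> real"
  assumes [measurable]: "f \<in> borel_measurable borel" and c: "c \<noteq> 0"
  shows "(LINT x|lborel. f x) = \<bar>c\<bar> ^ CARD('n) * (LINT x|lborel. f (t + c *\<^sub>R x))"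
  by (subst lborel_affine[OF c, of t]) (simp add: integral_density integral_distr)

lemma integral_translate:
  fixes f :: "real ^ 'n::finite \<Rightarrow> real"
  assumes [measurable]: "f \<in> borel_measurable borel"
  shows "(LINT x|lborel. f (x + a)) = (LINT x|lborel. f x)"
  using integral_affine[OF assms, of 1 a] by (simp add: add.commute)

lemma integrable_translate:
  fixes f :: "real ^ 'n::finite \<Rightarrow> real"
  assumes f: "integrable lborel f"
  shows "integrable lborel (\<lambda>x. f (x + a))"
proof -
  have [measurable]: "f \<in> borel_measurable borel" using borel_measurable_integrable[OF f] by simp
  have "integrable (distr lborel borel ((+) a)) f" using f by (simp add: lborel_distr_plus)
  then show ?thesis by (simp add: integrable_distr_eq add.commute)
qed

lemma AE_translate:
  fixes P :: "real ^ 'n::finite \<Rightarrow> bool"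
  assumes "AE x in lborel. P x"
  shows "AE x in lborel. P (x + a)"
proof -
  have "AE x in distr lborel borel ((+) a). P x" unfolding lborel_distr_plus by (rule assms)
  then have "AE x in lborel. P (a + x)" by (rule AE_distrD[rotated]) simp
  then show ?thesis by (simp add: add.commute)
qed

lemma (in pair_sigma_finite) integrable_prod_mult:
  fixes u v :: "_ \<Rightarrow> real"
  assumes u: "integrable M1 u" and v: "integrable M2 v"
  shows "integrable (M1 \<Otimes>\<^sub>M M2) (\<lambda>(x, y). u x * v y)"
proof (rule Fubini_integrable)
  have [measurable]: "u \<in> borel_measurable M1" "v \<in> borel_measurable M2" using u v by auto
  show "(\<lambda>(x, y). u x * v y) \<in> borel_measurable (M1 \<Otimes>\<^sub>M M2)" by measurable
  show "integrable M1 (\<lambda>x. \<integral>y. norm (case (x, y) of (x, y) \<Rightarrow> u x * v y) \<partial>M2)"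
    using u by (simp add: abs_mult)
  show "AE x in M1. integrable M2 (\<lambda>y. case (x, y) of (x, y) \<Rightarrow> u x * v y)"
    using v by simp
qed

text \<open>Lebesgue differentiation: off a negligible set the value of \<open>k\<close> is the
  limit of its averages over small cubes with a corner at the point, and these averages are
  nonnegative.\<close>

lemma integral_cbox_nonneg_imp_AE_nonneg:
  fixes k :: "real ^ 'n::finite \<Rightarrow> real"
  assumes k: "locally_integrable k"
    and pos: "\<And>a b. 0 \<le> (LINT x|lborel. indicator (cbox a b) x * k x)"
  shows "AE x in lborel. 0 \<le> k x"
proof -
  have [measurable]: "k \<in> borel_measurable borel" using k by (rule locally_integrable_measurable)
  have si: "set_integrable lborel (cbox a b) k" for a b
    using k compact_cbox unfolding locally_integrable_def by blast
  have int: "k integrable_on cbox a b" for a b using set_borel_integral_eq_integral(1)[OF si] .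
  have nn: "0 \<le> integral (cbox a b) k" for a b
    using set_borel_integral_eq_integral(2)[OF si, of a b] pos[of a b]
    by (simp add: set_lebesgue_integral_def)
  obtain N where N: "negligible N"
    "\<And>x e. \<lbrakk>x \<notin> N; 0 < e\<rbrakk> \<Longrightarrow> \<exists>d>0. \<forall>h. 0 < h \<and> h < d \<longrightarrow>
        norm (integral (cbox x (x + h *\<^sub>R One)) k /\<^sub>R h ^ DIM(real ^ 'n) - k x) < e"
    using integrable_ccontinuous_explicit[OF int] by blast
  have "0 \<le> k x" if x: "x \<notin> N" for x
  proof (rule ccontr)
    assume "\<not> 0 \<le> k x"
    then obtain d where d: "d > 0" "\<And>h. 0 < h \<and> h < d \<Longrightarrow>
        norm (integral (cbox x (x + h *\<^sub>R One)) k /\<^sub>R h ^ DIM(real ^ 'n) - k x) < - k x"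
      using N(2)[OF x, of "- k x"] by auto
    define I where "I = integral (cbox x (x + (d/2) *\<^sub>R One)) k /\<^sub>R (d/2) ^ DIM(real ^ 'n)"
    have "I \<ge> 0" unfolding I_def using nn d(1) by (intro scaleR_nonneg_nonneg) auto
    moreover have "\<bar>I - k x\<bar> < - k x" using d(2)[of "d/2"] d(1) unfolding I_def by simp
    ultimately show False by linarith
  qed
  then have "{x. \<not> 0 \<le> k x} \<subseteq> N" by blast
  then have "negligible {x. \<not> 0 \<le> k x}" using N(1) negligible_subset by blast
  then have "{x. \<not> 0 \<le> k x} \<in> null_sets lborel"
    by (simp add: negligible_iff_null_sets null_sets_completion_iff)
  then show ?thesis by (rule AE_I'[where P="\<lambda>x. 0 \<le> k x"]) auto
qed

lemma mollifierD:
  assumes "friedrichs_mollifier \<psi>"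
  shows "\<psi> \<in> test_functions" "0 \<le> \<psi> x" "integral\<^sup>L lborel \<psi> = 1"
  using assms by (auto simp: friedrichs_mollifier_def)

text \<open>Fubini moves the mollifier from \<open>k\<close> to the indicator of the box, so that only translates of \<open>\<psi>\<close>
  are needed as test functions.\<close>

lemma mollified_box_nonneg:
  fixes k :: "real ^ 'n::finite \<Rightarrow> real"
  assumes k: "locally_integrable k" and \<psi>: "friedrichs_mollifier \<psi>" and \<epsilon>: "\<epsilon> > 0"
    and pos: "\<And>x. 0 \<le> (LINT y|lborel. k y * \<psi> ((1 / \<epsilon>) *\<^sub>R (x - y)))"
  shows "0 \<le> (LINT y|lborel. k y * (LINT z|lborel. indicator (cbox a b) (y + \<epsilon> *\<^sub>R z) * \<psi> z))"
proof -
  have [measurable]: "k \<in> borel_measurable borel" using k by (rule locally_integrable_measurable)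
  have [measurable]: "\<psi> \<in> borel_measurable borel" using mollifierD[OF \<psi>] test_measurable by blast
  obtain R where R: "R > 0" "\<And>x. R < norm x \<Longrightarrow> \<psi> x = 0" using test_support mollifierD[OF \<psi>] by metis
  obtain M where M: "M \<ge> 0" "\<And>x. \<bar>\<psi> x\<bar> \<le> M" using test_bounded mollifierD[OF \<psi>] by metis
  obtain L where L: "\<And>x. x \<in> cbox a b \<Longrightarrow> norm x \<le> L" using bounded_cbox bounded_iff by metis
  define B where "B = cbox a b"
  have [measurable]: "B \<in> sets borel" by (simp add: B_def)
  \<comment> \<open>The indicator makes the double integral finite: it confines \<open>x\<close> to
    the box, and the support of \<open>\<psi>\<close> then confines \<open>y\<close> to the ball of
    radius \<open>L + \<epsilon> * R\<close>.\<close>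
  define F where "F x y = indicator B x * (k y * \<psi> ((1 / \<epsilon>) *\<^sub>R (x - y)))" for x y
  have "integrable (lborel \<Otimes>\<^sub>M lborel) (\<lambda>(x, y). indicator B x * (M * (indicator (cball 0 (L + \<epsilon> * R)) y * k y)))"
    by (intro lborel_pair.integrable_prod_mult integrable_mult_right locally_integrable_cball k integrable_real_indicator)
      (use emeasure_lborel_cbox_finite[of a b] in \<open>simp_all add: B_def top.not_eq_extremum\<close>)
  then have intF: "integrable (lborel \<Otimes>\<^sub>M lborel) (\<lambda>(x, y). F x y)"
  proof (rule Bochner_Integration.integrable_bound)
    show "(\<lambda>(x, y). F x y) \<in> borel_measurable (lborel \<Otimes>\<^sub>M lborel)" unfolding F_def by measurable
    have "norm (F x y) \<le> norm (indicator B x * (M * (indicator (cball 0 (L + \<epsilon> * R)) y * k y)))" for x y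
    proof (cases "x \<in> B \<and> \<psi> ((1 / \<epsilon>) *\<^sub>R (x - y)) \<noteq> 0")
      case True
      then have "norm x \<le> L" "norm ((1 / \<epsilon>) *\<^sub>R (x - y)) \<le> R" using L R(2) by (auto simp: B_def not_less[symmetric])
      moreover have "norm ((1 / \<epsilon>) *\<^sub>R (x - y)) = norm (x - y) / \<epsilon>" using \<epsilon> by simp
      ultimately have "norm (x - y) \<le> \<epsilon> * R" using \<epsilon> by (simp add: pos_divide_le_eq mult.commute)
      then have "norm y \<le> L + \<epsilon> * R" using \<open>norm x \<le> L\<close> norm_triangle_sub[of y x] by (simp add: norm_minus_commute)
      moreover have "\<bar>k y\<bar> * \<bar>\<psi> ((1 / \<epsilon>) *\<^sub>R (x - y))\<bar> \<le> M * \<bar>k y\<bar>"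
        using M(2)[of "(1 / \<epsilon>) *\<^sub>R (x - y)"] by (simp add: mult.commute[of M] mult_left_mono)
      ultimately show ?thesis using True M(1) by (simp add: F_def abs_mult)
    next
      case False
      then have "F x y = 0" by (auto simp: F_def indicator_def)
      then show ?thesis by simp
    qed
    then show "AE p in lborel \<Otimes>\<^sub>M lborel. norm (case p of (x, y) \<Rightarrow> F x y) \<le>
        norm (case p of (x, y) \<Rightarrow> indicator B x * (M * (indicator (cball 0 (L + \<epsilon> * R)) y * k y)))"
      by (auto split: prod.split)
  qed
  have "0 \<le> (LINT x|lborel. LINT y|lborel. F x y)"
  proof (rule Bochner_Integration.integral_nonneg)
    fix x
    have "(LINT y|lborel. F x y) = indicator B x * (LINT y|lborel. k y * \<psi> ((1 / \<epsilon>) *\<^sub>R (x - y)))"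
      by (simp add: F_def)
    then show "0 \<le> (LINT y|lborel. F x y)" using pos by simp
  qed
  also have "\<dots> = (LINT y|lborel. LINT x|lborel. F x y)" by (rule lborel_pair.Fubini_integral[OF intF, symmetric])
  also have "\<dots> = (LINT y|lborel. \<epsilon> ^ CARD('n) * (k y * (LINT z|lborel. indicator B (y + \<epsilon> *\<^sub>R z) * \<psi> z)))"
  proof (rule Bochner_Integration.integral_cong)
    fix y
    have "(LINT x|lborel. F x y) = (LINT x|lborel. k y * (indicator B x * \<psi> ((1 / \<epsilon>) *\<^sub>R (x - y))))"
      unfolding F_def by (simp add: mult_ac)
    also have "\<dots> = k y * (LINT x|lborel. indicator B x * \<psi> ((1 / \<epsilon>) *\<^sub>R (x - y)))" by simp
    \<comment> \<open>Substitution of \<open>x = y + \<epsilon> *\<^sub>R z\<close>; the Jacobian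
      \<open>\<epsilon> ^ CARD('n)\<close> is positive and is cancelled at the end.\<close>
    also have "(LINT x|lborel. indicator B x * \<psi> ((1 / \<epsilon>) *\<^sub>R (x - y)))
        = \<epsilon> ^ CARD('n) * (LINT z|lborel. indicator B (y + \<epsilon> *\<^sub>R z) * \<psi> z)"
      using integral_affine[of "\<lambda>x. indicator B x * \<psi> ((1 / \<epsilon>) *\<^sub>R (x - y))" \<epsilon> y] \<epsilon> by simp
    finally show "(LINT x|lborel. F x y) = \<epsilon> ^ CARD('n) * (k y * (LINT z|lborel. indicator B (y + \<epsilon> *\<^sub>R z) * \<psi> z))"
      by simp
  qed simp
  also have "\<dots> = \<epsilon> ^ CARD('n) * (LINT y|lborel. k y * (LINT z|lborel. indicator B (y + \<epsilon> *\<^sub>R z) * \<psi> z))" by simp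
  finally have "\<epsilon> ^ CARD('n) * 0 \<le> \<epsilon> ^ CARD('n) * (LINT y|lborel. k y * (LINT z|lborel. indicator B (y + \<epsilon> *\<^sub>R z) * \<psi> z))"
    by simp
  then show ?thesis unfolding B_def by (rule mult_left_le_imp_le) (use \<epsilon> in simp)
qed

text \<open>As \<open>\<epsilon>\<close> tends to 0 in the box inequality, the mollified indicators
  tend to the indicator of the box almost everywhere, so \<open>k\<close> has nonnegative integral
  over every box.\<close>

lemma mollified_nonneg_imp_AE_nonneg:
  fixes k :: "real ^ 'n::finite \<Rightarrow> real"
  assumes k: "locally_integrable k" and \<psi>: "friedrichs_mollifier \<psi>"
    and pos: "\<And>\<epsilon> x. 0 < \<epsilon> \<Longrightarrow> 0 \<le> (LINT y|lborel. k y * \<psi> ((1 / \<epsilon>) *\<^sub>R (x - y)))"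
  shows "AE x in lborel. 0 \<le> k x"
proof (rule integral_cbox_nonneg_imp_AE_nonneg[OF k])
  fix a b :: "real ^ 'n"
  have [measurable]: "k \<in> borel_measurable borel" using k by (rule locally_integrable_measurable)
  have [measurable]: "\<psi> \<in> borel_measurable borel" using mollifierD[OF \<psi>] test_measurable by blast
  have i\<psi>: "integrable lborel \<psi>" using mollifierD[OF \<psi>] test_integrable by blast
  obtain R where R: "R > 0" "\<And>x. R < norm x \<Longrightarrow> \<psi> x = 0" using test_support mollifierD[OF \<psi>] by metis
  obtain L where L: "\<And>x. x \<in> cbox a b \<Longrightarrow> norm x \<le> L" using bounded_cbox bounded_iff by metis
  define B where "B = cbox a b"
  have [measurable]: "B \<in> sets borel" by (simp add: B_def)
  \<comment> \<open>Steps of at most 1 keep the supports of all \<open>g n\<close> in the one ball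
    of radius \<open>L + R\<close>, as dominated convergence requires.\<close>
  define e where "e n = 1 / real (Suc n)" for n
  have e: "0 < e n" "e n \<le> 1" for n by (auto simp: e_def)
  have elim: "e \<longlonglongrightarrow> 0" unfolding e_def using LIMSEQ_inverse_real_of_nat by (simp add: inverse_eq_divide)
  define g where "g n y = (LINT z|lborel. indicator B (y + e n *\<^sub>R z) * \<psi> z)" for n y
  have [measurable]: "g n \<in> borel_measurable borel" for n
    unfolding g_def by measurable
  have ig: "integrable lborel (\<lambda>z. indicator B (y + e n *\<^sub>R z) * \<psi> z)" for n y
    by (rule Bochner_Integration.integrable_bound[OF i\<psi>]) (auto simp: indicator_def)
  have g01: "0 \<le> g n y" "g n y \<le> 1" for n y
  proof -
    show "0 \<le> g n y" unfolding g_def using mollifierD(2)[OF \<psi>] by (intro Bochner_Integration.integral_nonneg) simp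
    have "g n y \<le> (LINT z|lborel. \<psi> z)" unfolding g_def
      using mollifierD(2)[OF \<psi>] by (intro integral_mono ig i\<psi>) (auto simp: indicator_def)
    then show "g n y \<le> 1" using mollifierD(3)[OF \<psi>] by simp
  qed
  have gsupp: "g n y = 0" if "L + R < norm y" for n y
  proof -
    have "indicator B (y + e n *\<^sub>R z) * \<psi> z = 0" for z
    proof (cases "R < norm z")
      case False
      have "norm (e n *\<^sub>R z) \<le> 1 * R" unfolding norm_scaleR using False e[of n] by (intro mult_mono) auto
      then have "L < norm (y + e n *\<^sub>R z)" using that norm_diff_ineq[of y "e n *\<^sub>R z"] by linarith
      then have "y + e n *\<^sub>R z \<notin> B" using L unfolding B_def by (meson not_le)
      then show ?thesis by simp
    qed (use R in simp)
    then have "(\<lambda>z. indicator B (y + e n *\<^sub>R z) * \<psi> z) = (\<lambda>z. 0)" by blast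
    then show ?thesis by (simp only: g_def Bochner_Integration.integral_zero)
  qed
  have nz: "0 \<le> (LINT y|lborel. k y * g n y)" for n
    using mollified_box_nonneg[OF k \<psi> e(1)[of n] pos[OF e(1)[of n]], of a b] by (simp add: g_def B_def)
  have "(\<lambda>n. LINT y|lborel. k y * g n y) \<longlonglongrightarrow> (LINT y|lborel. k y * indicator B y)"
  proof (rule integral_dominated_convergence)
    show "integrable lborel (\<lambda>y. \<bar>indicator (cball 0 (L + R)) y * k y\<bar>)"
      by (intro integrable_abs locally_integrable_cball k)
    show "AE y in lborel. norm (k y * g n y) \<le> \<bar>indicator (cball 0 (L + R)) y * k y\<bar>" for n
    proof (rule AE_I2)
      fix y
      show "norm (k y * g n y) \<le> \<bar>indicator (cball 0 (L + R)) y * k y\<bar>"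
      proof (cases "norm y \<le> L + R")
        case True
        then show ?thesis using mult_left_mono[of "\<bar>g n y\<bar>" 1 "\<bar>k y\<bar>"] g01[of n y] by (simp add: abs_mult)
      next
        case False
        then show ?thesis using gsupp by simp
      qed
    qed
    \<comment> \<open>Off the boundary of the box, a null set, \<open>y\<close> has a neighbourhood
      entirely inside or entirely outside the box, so \<open>g n y\<close> is eventually equal to
      the indicator.\<close>
    have "cbox a b - box a b \<in> null_sets lborel"
      using negligible_frontier_interval[of a b] by (simp add: negligible_iff_null_sets null_sets_completion_iff)
    then have "AE y in lborel. y \<notin> cbox a b - box a b" by (rule AE_not_in)
    then show "AE y in lborel. (\<lambda>n. k y * g n y) \<longlonglongrightarrow> k y * indicator B y"
    proof eventually_elim
      case (elim y)
      obtain U where U: "open U" "y \<in> U" "(U \<subseteq> B) \<or> (U \<subseteq> - B)"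
      proof (cases "y \<in> B")
        case True
        then show ?thesis using elim box_subset_cbox[of a b] by (intro that[of "box a b"]) (auto simp: B_def)
      next
        case False
        then show ?thesis by (intro that[of "- B"]) (auto simp: B_def open_Compl)
      qed
      then obtain d where d: "d > 0" "ball y d \<subseteq> U" using open_contains_ball by blast
      have "\<forall>\<^sub>F n in sequentially. e n * R < d"
      proof -
        have "(\<lambda>n. e n * R) \<longlonglongrightarrow> 0 * R" by (intro tendsto_mult elim[unfolded e_def] tendsto_const) (fact \<open>e \<longlonglongrightarrow> 0\<close>)
        then show ?thesis using d(1) by (intro order_tendstoD(2)) auto
      qed
      then have "\<forall>\<^sub>F n in sequentially. k y * g n y = k y * indicator B y"
      proof eventually_elim
        case (elim n)
        have "indicator B (y + e n *\<^sub>R z) * \<psi> z = indicator B y * \<psi> z" for z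
        proof (cases "R < norm z")
          case False
          have "norm (e n *\<^sub>R z) \<le> e n * R" unfolding norm_scaleR using False e[of n] by (intro mult_mono) auto
          then have "y + e n *\<^sub>R z \<in> ball y d" using elim by (simp add: dist_norm)
          then have "y + e n *\<^sub>R z \<in> B \<longleftrightarrow> y \<in> B" using U d by auto
          then show ?thesis by (simp add: indicator_def)
        qed (use R in simp)
        then have "(\<lambda>z. indicator B (y + e n *\<^sub>R z) * \<psi> z) = (\<lambda>z. indicator B y * \<psi> z)" by blast
        then have "g n y = (LINT z|lborel. indicator B y * \<psi> z)" by (simp only: g_def)
        then have "g n y = indicator B y" using mollifierD(3)[OF \<psi>] by simp
        then show ?case by simp
      qed
      then show ?case by (rule tendsto_eventually)
    qed
  qed simp_all
  then have "0 \<le> (LINT y|lborel. k y * indicator B y)" using nz by (intro LIMSEQ_le_const) auto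
  then show "0 \<le> (LINT x|lborel. indicator (cbox a b) x * k x)" by (simp add: B_def mult.commute)
qed

lemma kernel_test:
  assumes \<psi>: "friedrichs_mollifier \<psi>" and "\<epsilon> > 0"
  shows "(\<lambda>y. \<psi> ((1 / \<epsilon>) *\<^sub>R (x - y))) \<in> test_functions"
proof -
  have "(\<lambda>y. \<psi> ((1 / \<epsilon>) *\<^sub>R x + (- (1 / \<epsilon>)) *\<^sub>R y)) \<in> test_functions"
    using assms by (intro test_affine mollifierD) auto
  then show ?thesis by (simp add: algebra_simps)
qed

lemma test_nonneg_imp_AE_nonneg:
  fixes \<psi> k :: "real ^ 'n::finite \<Rightarrow> real"
  assumes \<psi>: "friedrichs_mollifier \<psi>" and k: "locally_integrable k"
    and pos: "\<And>\<phi>. \<phi> \<in> test_functions \<Longrightarrow> (\<And>x. 0 \<le> \<phi> x) \<Longrightarrow> 0 \<le> (LINT y|lborel. k y * \<phi> y)"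
  shows "AE x in lborel. 0 \<le> k x"
  by (rule mollified_nonneg_imp_AE_nonneg[OF k \<psi>]) (intro pos kernel_test \<psi> mollifierD(2)[OF \<psi>])

lemma test_zero_imp_AE_zero:
  fixes \<psi> k :: "real ^ 'n::finite \<Rightarrow> real"
  assumes \<psi>: "friedrichs_mollifier \<psi>" and k: "locally_integrable k"
    and zero: "\<And>\<phi>. \<phi> \<in> test_functions \<Longrightarrow> (LINT y|lborel. k y * \<phi> y) = 0"
  shows "AE x in lborel. k x = 0"
proof -
  have "AE x in lborel. 0 \<le> k x" by (rule test_nonneg_imp_AE_nonneg[OF \<psi> k]) (simp add: zero)
  moreover have "AE x in lborel. 0 \<le> - 1 * k x"
    by (rule test_nonneg_imp_AE_nonneg[OF \<psi> locally_integrable_scale[OF k]]) (simp add: zero)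
  ultimately show ?thesis by eventually_elim simp
qed

text \<open>Nonnegativity of \<open>L + k\<close> and of \<open>L - k\<close>, each tested with
  nonnegative functions.\<close>

lemma test_bound_imp_AE_bound:
  fixes \<psi> k :: "real ^ 'n::finite \<Rightarrow> real"
  assumes \<psi>: "friedrichs_mollifier \<psi>" and k: "locally_integrable k"
    and bound: "\<And>\<phi>. \<phi> \<in> test_functions \<Longrightarrow> (\<And>x. 0 \<le> \<phi> x) \<Longrightarrow>
        \<bar>LINT y|lborel. k y * \<phi> y\<bar> \<le> L * (LINT y|lborel. \<phi> y)"
  shows "AE x in lborel. \<bar>k x\<bar> \<le> L"
proof -
  have one: "locally_integrable (\<lambda>x. L)" by (rule locally_integrable_bounded[of _ "\<bar>L\<bar>"]) auto
  have "AE x in lborel. 0 \<le> L + c * k x" if c: "\<bar>c\<bar> = 1" for c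
  proof (rule test_nonneg_imp_AE_nonneg[OF \<psi> locally_integrable_add[OF one locally_integrable_scale[OF k]]])
    fix \<phi> :: "real ^ 'n \<Rightarrow> real" assume \<phi>: "\<phi> \<in> test_functions" "\<And>x. 0 \<le> \<phi> x"
    have "(LINT y|lborel. (L + c * k y) * \<phi> y) = (LINT y|lborel. L * \<phi> y + c * (k y * \<phi> y))"
      by (simp add: algebra_simps)
    also have "\<dots> = L * (LINT y|lborel. \<phi> y) + c * (LINT y|lborel. k y * \<phi> y)"
      using test_integrable[OF \<phi>(1)] locally_integrable_test[OF k \<phi>(1)] by simp
    also have "\<dots> \<ge> 0"
    proof -
      have "\<bar>c * (LINT y|lborel. k y * \<phi> y)\<bar> \<le> L * (LINT y|lborel. \<phi> y)"
        using bound[OF \<phi>] c by (simp add: abs_mult)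
      then show ?thesis by linarith
    qed
    finally show "0 \<le> (LINT y|lborel. (L + c * k y) * \<phi> y)" .
  qed
  from this[of 1] this[of "-1"] have "AE x in lborel. 0 \<le> L + k x" "AE x in lborel. k x \<le> L" by simp_all
  then show ?thesis by eventually_elim simp
qed

section \<open>Mean values and derivatives of correlations with test functions\<close>

lemma test_line_derivative:
  assumes "\<phi> \<in> test_functions"
  shows "((\<lambda>r. \<phi> (x + r *\<^sub>R axis i 1)) has_real_derivative partial i \<phi> (x + r *\<^sub>R axis i 1)) (at r)"
proof -
  have "((\<lambda>r. x + r *\<^sub>R axis i 1) has_derivative (\<lambda>h. h *\<^sub>R axis i 1)) (at r)"
    by (auto intro!: derivative_eq_intros)
  note der = has_derivative_compose[OF this partial_has_derivative[OF test_differentiable[OF assms]]]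
  have "linear (frechet_derivative \<phi> (at (x + r *\<^sub>R axis i 1)))"
    using assms by (intro linear_frechet_derivative test_differentiable)
  then show ?thesis
    unfolding has_field_derivative_def
    by (intro has_derivative_eq_rhs[OF der] ext) (simp add: linear_scale partial_def)
qed

lemma mvt_everywhere:
  fixes F :: "real \<Rightarrow> real"
  assumes der: "\<And>r. (F has_real_derivative F' r) (at r)"
  obtains \<xi> where "\<bar>\<xi>\<bar> \<le> \<bar>s\<bar>" "F s - F 0 = s * F' \<xi>"
proof (cases s "0::real" rule: linorder_cases)
  case less
  obtain \<xi> where "s < \<xi>" "\<xi> < 0" "F 0 - F s = (0 - s) * F' \<xi>" using MVT2[OF less, of F F'] der by blast
  then show thesis using less by (intro that[of \<xi>]) (auto simp: algebra_simps)
next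
  case equal
  then show thesis by (intro that[of 0]) auto
next
  case greater
  obtain \<xi> where "0 < \<xi>" "\<xi> < s" "F s - F 0 = (s - 0) * F' \<xi>" using MVT2[OF greater, of F F'] der by blast
  then show thesis using greater by (intro that[of \<xi>]) auto
qed

text \<open>The shift sits on \<open>\<phi>\<close>, whose difference quotients are bounded by a
  bound for \<open>partial i \<phi>\<close> and vanish outside a fixed ball; this is domination for
  a locally integrable \<open>k\<close>.\<close>

lemma correlation_derivative_0:
  assumes k: "locally_integrable k" and \<phi>: "\<phi> \<in> test_functions"
  shows "((\<lambda>r. LINT x|lborel. k x * \<phi> (x + r *\<^sub>R axis i 1)) has_real_derivative
    (LINT x|lborel. k x * partial i \<phi> x)) (at 0)"
  unfolding DERIV_def tendsto_at_iff_sequentially comp_def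
proof (intro allI impI)
  fix h :: "nat \<Rightarrow> real" assume h0: "\<forall>n. h n \<in> UNIV - {0}" and h: "h \<longlonglongrightarrow> 0"
  have [measurable]: "k \<in> borel_measurable borel" "\<phi> \<in> borel_measurable borel" "partial i \<phi> \<in> borel_measurable borel"
    using k \<phi> by (auto intro: locally_integrable_measurable test_measurable test_partial)
  obtain R where R: "R > 0" "\<And>x. R < norm x \<Longrightarrow> \<phi> x = 0" using test_support[OF \<phi>] by metis
  obtain M where M: "M \<ge> 0" "\<And>x. \<bar>partial i \<phi> x\<bar> \<le> M" using test_bounded[OF test_partial[OF \<phi>]] by metis
  \<comment> \<open>A convergent sequence of steps is bounded, so the shifted supports stay in one
    ball.\<close>
  obtain H where H: "H > 0" "\<And>n. \<bar>h n\<bar> \<le> H"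
    using convergent_imp_Bseq[of h] h by (auto simp: convergent_def Bseq_def)
  define q where "q n x = (\<phi> (x + h n *\<^sub>R axis i 1) - \<phi> x) / h n" for n x
  have [measurable]: "q n \<in> borel_measurable borel" for n unfolding q_def by measurable
  have qb: "\<bar>q n x\<bar> \<le> M" for n x
  proof -
    obtain \<xi> where "\<phi> (x + h n *\<^sub>R axis i 1) - \<phi> (x + 0 *\<^sub>R axis i 1) = h n * partial i \<phi> (x + \<xi> *\<^sub>R axis i 1)"
      using mvt_everywhere[OF test_line_derivative[OF \<phi>, of x i], of "h n"] by metis
    then have "q n x = partial i \<phi> (x + \<xi> *\<^sub>R axis i 1)" using h0 by (simp add: q_def)
    then show ?thesis using M by simp
  qed
  have qs: "q n x = 0" if "R + H < norm x" for n x
  proof -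
    have "norm (h n *\<^sub>R (axis i 1 :: real ^ 'a)) \<le> H" using H by simp
    then have "R < norm (x + h n *\<^sub>R axis i 1)"
      using norm_diff_ineq[of x "h n *\<^sub>R axis i 1"] that by linarith
    then show ?thesis using R(2) that H(1) by (simp add: q_def)
  qed
  have "(\<lambda>n. LINT x|lborel. k x * q n x) \<longlonglongrightarrow> (LINT x|lborel. k x * partial i \<phi> x)"
  proof (rule integral_dominated_convergence)
    show "integrable lborel (\<lambda>x. M * \<bar>indicator (cball 0 (R + H)) x * k x\<bar>)"
      by (intro integrable_mult_right integrable_abs locally_integrable_cball k)
    show "AE x in lborel. norm (k x * q n x) \<le> M * \<bar>indicator (cball 0 (R + H)) x * k x\<bar>" for n
    proof (rule AE_I2)
      fix x
      show "norm (k x * q n x) \<le> M * \<bar>indicator (cball 0 (R + H)) x * k x\<bar>"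
      proof (cases "norm x \<le> R + H")
        case True
        then show ?thesis using mult_left_mono[OF qb[of n x], of "\<bar>k x\<bar>"] by (simp add: abs_mult mult.commute)
      next
        case False
        then show ?thesis using qs by simp
      qed
    qed
    have "(\<lambda>n. q n x) \<longlonglongrightarrow> partial i \<phi> x" for x
    proof -
      have "((\<lambda>r. \<phi> (x + r *\<^sub>R axis i 1)) has_real_derivative partial i \<phi> x) (at 0)"
        using test_line_derivative[OF \<phi>, of x i 0] by simp
      then show ?thesis unfolding DERIV_def tendsto_at_iff_sequentially comp_def q_def using h0 h by auto
    qed
    then show "AE x in lborel. (\<lambda>n. k x * q n x) \<longlonglongrightarrow> k x * partial i \<phi> x"
      by (intro AE_I2 tendsto_mult tendsto_const)
  qed simp_all
  moreover have "(LINT x|lborel. k x * q n x) =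
      ((LINT x|lborel. k x * \<phi> (x + (0 + h n) *\<^sub>R axis i 1)) - (LINT x|lborel. k x * \<phi> (x + 0 *\<^sub>R axis i 1))) / h n" for n
  proof -
    have "(LINT x|lborel. k x * q n x) = (LINT x|lborel. (k x * \<phi> (x + h n *\<^sub>R axis i 1) - k x * \<phi> x) / h n)"
      by (simp add: q_def right_diff_distrib)
    also have "\<dots> = (LINT x|lborel. k x * \<phi> (x + h n *\<^sub>R axis i 1) - k x * \<phi> x) / h n" by simp
    also have "(LINT x|lborel. k x * \<phi> (x + h n *\<^sub>R axis i 1) - k x * \<phi> x)
      = (LINT x|lborel. k x * \<phi> (x + h n *\<^sub>R axis i 1)) - (LINT x|lborel. k x * \<phi> x)"
      by (intro Bochner_Integration.integral_diff locally_integrable_test k test_translate \<phi>)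
    finally show ?thesis by simp
  qed
  ultimately show "(\<lambda>n. ((LINT x|lborel. k x * \<phi> (x + (0 + h n) *\<^sub>R axis i 1)) - (LINT x|lborel. k x * \<phi> (x + 0 *\<^sub>R axis i 1))) / h n)
      \<longlonglongrightarrow> (LINT x|lborel. k x * partial i \<phi> x)" by simp
qed

lemma correlation_derivative:
  assumes k: "locally_integrable k" and \<phi>: "\<phi> \<in> test_functions"
  shows "((\<lambda>r. LINT x|lborel. k x * \<phi> (x + r *\<^sub>R axis i 1)) has_real_derivative
    (LINT x|lborel. k x * partial i \<phi> (x + r *\<^sub>R axis i 1))) (at r)"
  using correlation_derivative_0[OF k test_translate[OF \<phi>, of "r *\<^sub>R axis i 1"], of i]
    DERIV_shift[of "\<lambda>r. LINT x|lborel. k x * \<phi> (x + r *\<^sub>R axis i 1)" _ 0 r]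
  by (simp add: partial_translate[OF \<phi>] algebra_simps)

text \<open>The intermediate point depends on \<open>\<phi>\<close>. This is harmless wherever the
  factor containing \<open>\<xi>\<close> is estimated independently of translations or of small
  ones.\<close>

lemma correlation_mvt:
  assumes k: "locally_integrable k" and \<phi>: "\<phi> \<in> test_functions"
  obtains \<xi> where "\<bar>\<xi>\<bar> \<le> \<bar>s\<bar>"
    "(LINT x|lborel. k x * \<phi> (x + s *\<^sub>R axis i 1)) - (LINT x|lborel. k x * \<phi> x)
      = s * (LINT x|lborel. k x * partial i \<phi> (x + \<xi> *\<^sub>R axis i 1))"
  using mvt_everywhere[OF correlation_derivative[OF k \<phi>, of i], of s] by auto

section \<open>Weak derivatives and difference quotients\<close>

definition tests :: "'n::finite l2 set" where "tests = to_l2 ` test_functions"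

text \<open>A relation between classes, so that it can be added, translated and passed to limits
  without naming a representative. It includes the requirement that the derivative lies in
  \<open>L2\<close>.\<close>

definition wd :: "'n::finite \<Rightarrow> 'n l2 \<Rightarrow> 'n l2 \<Rightarrow> bool" where
  "wd i f g \<longleftrightarrow> (\<forall>\<phi>\<in>test_functions. f \<bullet> to_l2 (partial i \<phi>) = - (g \<bullet> to_l2 \<phi>))"

definition tr :: "real ^ 'n::finite \<Rightarrow> 'n l2 \<Rightarrow> 'n l2" where
  "tr a f = to_l2 (\<lambda>x. of_l2 f (x + a))"

text \<open>Division by zero gives \<open>dq i 0 f = 0\<close>, so bounds on difference quotients
  can be stated for every \<open>s\<close>.\<close>

definition dq :: "'n::finite \<Rightarrow> real \<Rightarrow> 'n l2 \<Rightarrow> 'n l2" where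
  "dq i s f = (tr (s *\<^sub>R axis i 1) f - f) /\<^sub>R s"

lemma inner_to_l2_right: "g \<in> L2 \<Longrightarrow> f \<bullet> to_l2 g = (LINT x|lborel. of_l2 f x * g x)"
  using to_l2_inner[of "of_l2 f" g] by simp

lemma inner_test: "\<phi> \<in> test_functions \<Longrightarrow> f \<bullet> to_l2 \<phi> = (LINT x|lborel. of_l2 f x * \<phi> x)"
  by (simp add: inner_to_l2_right test_L2)

lemma L2_translate: "f \<in> L2 \<Longrightarrow> (\<lambda>x. f (x + a)) \<in> L2"
  unfolding L2_def using integrable_translate[of "\<lambda>x. (f x)\<^sup>2" a] by auto

lemma tr_to_l2:
  assumes "f \<in> L2" shows "tr a (to_l2 f) = to_l2 (\<lambda>x. f (x + a))"
proof -
  have "AE x in lborel. of_l2 (to_l2 f) (x + a) = f (x + a)"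
    by (rule AE_translate[OF of_l2_to_l2[OF assms]])
  then show ?thesis unfolding tr_def by (simp add: to_l2_eq_iff L2_translate assms)
qed

lemma tr_tr: "tr a (tr b f) = tr (a + b) f"
proof -
  have "tr a (tr b f) = to_l2 (\<lambda>x. of_l2 f (x + a + b))"
    unfolding tr_def[of b] by (simp add: tr_to_l2 L2_translate)
  then show ?thesis by (simp add: tr_def add.assoc)
qed

lemma tr_0 [simp]: "tr 0 f = f"
  by (simp add: tr_def)

lemma tr_inner_tr: "tr a f \<bullet> tr a g = f \<bullet> g"
proof -
  have "tr a f \<bullet> tr a g = (LINT x|lborel. of_l2 f (x + a) * of_l2 g (x + a))"
    by (simp add: tr_def to_l2_inner L2_translate)
  also have "\<dots> = (LINT x|lborel. of_l2 f x * of_l2 g x)"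
    by (rule integral_translate[of "\<lambda>x. of_l2 f x * of_l2 g x"]) simp
  finally show ?thesis by (simp add: inner_l2_eq)
qed

lemma tr_inner: "tr a f \<bullet> g = f \<bullet> tr (- a) g"
  using tr_inner_tr[of a f "tr (- a) g"] by (simp add: tr_tr)

lemma norm_tr [simp]: "norm (tr a f) = norm f"
  by (simp add: norm_eq_sqrt_inner tr_inner_tr)

lemma tr_add: "tr a (f + g) = tr a f + tr a g"
  and tr_diff: "tr a (f - g) = tr a f - tr a g"
  and tr_scale: "tr a (c *\<^sub>R f) = c *\<^sub>R tr a f"
proof -
  have "tr a (to_l2 (of_l2 f) + to_l2 (of_l2 g)) = tr a f + tr a g"
    by (simp only: to_l2_add[symmetric] of_l2_L2 tr_to_l2 L2_add) (simp add: to_l2_add L2_translate tr_def)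
  then show "tr a (f + g) = tr a f + tr a g" by simp
  have "tr a (to_l2 (of_l2 f) - to_l2 (of_l2 g)) = tr a f - tr a g"
    by (simp only: to_l2_diff[symmetric] of_l2_L2 tr_to_l2 L2_diff) (simp add: to_l2_diff L2_translate tr_def)
  then show "tr a (f - g) = tr a f - tr a g" by simp
  have "tr a (c *\<^sub>R to_l2 (of_l2 f)) = c *\<^sub>R tr a f"
    by (simp only: to_l2_scale[symmetric] of_l2_L2 tr_to_l2 L2_scale) (simp add: to_l2_scale L2_translate tr_def)
  then show "tr a (c *\<^sub>R f) = c *\<^sub>R tr a f" by simp
qed

text \<open>Discrete integration by parts: the adjoint of a translation is the opposite
  translation.\<close>

lemma dq_inner: "dq i s f \<bullet> g = - (f \<bullet> dq i (- s) g)"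
  by (simp add: dq_def tr_inner inner_diff_left inner_diff_right algebra_simps)

lemma wd_D: "wd i f g \<Longrightarrow> \<phi> \<in> test_functions \<Longrightarrow> f \<bullet> to_l2 (partial i \<phi>) = - (g \<bullet> to_l2 \<phi>)"
  by (simp add: wd_def)

lemma wd_add: "wd i f g \<Longrightarrow> wd i f' g' \<Longrightarrow> wd i (f + f') (g + g')"
  and wd_diff: "wd i f g \<Longrightarrow> wd i f' g' \<Longrightarrow> wd i (f - f') (g - g')"
  and wd_scale: "wd i f g \<Longrightarrow> wd i (c *\<^sub>R f) (c *\<^sub>R g)"
  by (auto simp: wd_def inner_add_left inner_diff_left)

lemma wd_zero: "wd i 0 0"
  by (simp add: wd_def)

lemma wd_translate:
  assumes "wd i f g" shows "wd i (tr a f) (tr a g)"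
  unfolding wd_def
proof
  fix \<phi> :: "real ^ 'a \<Rightarrow> real" assume \<phi>: "\<phi> \<in> test_functions"
  have "partial i (\<lambda>x. \<phi> (x + - a)) = (\<lambda>x. partial i \<phi> (x + - a))" by (rule partial_translate[OF \<phi>])
  then show "tr a f \<bullet> to_l2 (partial i \<phi>) = - (tr a g \<bullet> to_l2 \<phi>)"
    using wd_D[OF assms test_translate[OF \<phi>, of "- a"]] \<phi>
    by (simp add: tr_inner tr_to_l2 test_L2 test_partial)
qed

lemma wd_dq: "wd i f g \<Longrightarrow> wd i (dq j s f) (dq j s g)"
  unfolding dq_def by (intro wd_scale wd_diff wd_translate)

lemma wd_closed:
  assumes wd: "\<And>n. wd i (f n) (g n)" and f: "f \<longlonglongrightarrow> f'" and g: "g \<longlonglongrightarrow> g'"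
  shows "wd i f' g'"
  unfolding wd_def
proof
  fix \<phi> :: "real ^ 'a \<Rightarrow> real" assume \<phi>: "\<phi> \<in> test_functions"
  have "(\<lambda>n. f n \<bullet> to_l2 (partial i \<phi>)) \<longlonglongrightarrow> f' \<bullet> to_l2 (partial i \<phi>)" by (intro tendsto_intros f)
  moreover have "(\<lambda>n. f n \<bullet> to_l2 (partial i \<phi>)) \<longlonglongrightarrow> - (g' \<bullet> to_l2 \<phi>)"
    unfolding wd_D[OF wd \<phi>] by (intro tendsto_intros g)
  ultimately show "f' \<bullet> to_l2 (partial i \<phi>) = - (g' \<bullet> to_l2 \<phi>)" by (rule LIMSEQ_unique)
qed

lemma Ck_zero: "Ck m (\<lambda>x. 0)"
proof (induction m)
  case (Suc m)
  have "partial i (\<lambda>x. 0) = (\<lambda>x. 0)" for i :: 'a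
    by (rule ext) (simp add: partial_eq[OF has_derivative_const])
  then show ?case using Suc by simp
qed simp

lemma filterlim_uminus_at_0: "filterlim (\<lambda>s. - s) (at (0::real)) (at 0)"
  by (rule filterlim_atI) (auto simp: eventually_at_filter intro!: tendsto_eq_intros)

lemma tests_subspace: "subspace tests"
proof (rule subspaceI)
  have "(\<lambda>x::real^'a. 0) \<in> test_functions" by (auto simp: test_functions_iff smooth_iff_Ck Ck_zero)
  then show "0 \<in> (tests :: 'a l2 set)" unfolding tests_def by (metis to_l2_zero image_eqI)
  show "x + y \<in> tests" if "x \<in> tests" "y \<in> tests" for x y :: "'a l2"
  proof -
    obtain \<phi> \<eta> where "\<phi> \<in> test_functions" "\<eta> \<in> test_functions" "x = to_l2 \<phi>" "y = to_l2 \<eta>"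
      using \<open>x \<in> tests\<close> \<open>y \<in> tests\<close> by (auto simp: tests_def)
    then show ?thesis unfolding tests_def
      by (intro image_eqI[of _ _ "\<lambda>x. \<phi> x + \<eta> x"]) (auto simp: to_l2_add test_L2 test_add)
  qed
  show "c *\<^sub>R x \<in> tests" if "x \<in> tests" for c and x :: "'a l2"
  proof -
    obtain \<phi> where "\<phi> \<in> test_functions" "x = to_l2 \<phi>" using \<open>x \<in> tests\<close> by (auto simp: tests_def)
    then show ?thesis unfolding tests_def
      by (intro image_eqI[of _ _ "\<lambda>x. c * \<phi> x"]) (auto simp: to_l2_scale test_L2 test_scale)
  qed
qed

text \<open>The mean value theorem bounds the pointwise change by \<open>\<bar>s\<bar>\<close> times
  a constant on a fixed ball, so its \<open>L2\<close> norm is at most linear in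
  \<open>s\<close>.\<close>

lemma tr_test_tendsto:
  assumes \<phi>: "\<phi> \<in> test_functions"
  shows "((\<lambda>s. tr (s *\<^sub>R axis i 1) (to_l2 \<phi>)) \<longlongrightarrow> to_l2 \<phi>) (at 0)"
proof -
  obtain R where R: "R > 0" "\<And>x. R < norm x \<Longrightarrow> \<phi> x = 0" using test_support[OF \<phi>] by metis
  obtain M where M: "M \<ge> 0" "\<And>x. \<bar>partial i \<phi> x\<bar> \<le> M" using test_bounded[OF test_partial[OF \<phi>]] by metis
  \<comment> \<open>The radius is enlarged by 1 to contain the supports of all translates with
    \<open>\<bar>s\<bar> \<le> 1\<close>.\<close>
  define I where "I = (\<lambda>x :: real ^ 'a. M * indicator (cball 0 (R + 1)) x :: real)"
  have IL2: "I \<in> L2"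
  proof -
    have "integrable lborel (\<lambda>x::real^'a. M\<^sup>2 * indicator (cball 0 (R + 1)) x :: real)"
      using emeasure_compact_finite[OF compact_cball, of "0 :: real ^ 'a" "R + 1"]
      by (intro integrable_mult_right integrable_real_indicator) (auto simp: top.not_eq_extremum)
    moreover have "(I x)\<^sup>2 = M\<^sup>2 * indicator (cball 0 (R + 1)) x" for x
      by (simp add: I_def power_mult_distrib indicator_def)
    moreover have "I \<in> borel_measurable borel"
      unfolding I_def by (intro borel_measurable_times borel_measurable_const borel_measurable_indicator) auto
    ultimately show ?thesis by (simp add: L2_def)
  qed
  have bound: "norm (tr (s *\<^sub>R axis i 1) (to_l2 \<phi>) - to_l2 \<phi>) \<le> \<bar>s\<bar> * L2_norm I" if s: "\<bar>s\<bar> \<le> 1" for s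
  proof -
    define d where "d x = \<phi> (x + s *\<^sub>R axis i 1) - \<phi> x" for x
    have dL2: "d \<in> L2" unfolding d_def by (intro L2_diff test_L2 test_translate \<phi>)
    have "\<bar>d x\<bar> \<le> \<bar>s\<bar> * I x" for x
    proof (cases "norm x \<le> R + 1")
      case True
      obtain \<xi> where "\<phi> (x + s *\<^sub>R axis i 1) - \<phi> (x + 0 *\<^sub>R axis i 1) = s * partial i \<phi> (x + \<xi> *\<^sub>R axis i 1)"
        using mvt_everywhere[OF test_line_derivative[OF \<phi>, of x i], of s] by metis
      then have "d x = s * partial i \<phi> (x + \<xi> *\<^sub>R axis i 1)" by (simp add: d_def)
      then show ?thesis using True M by (simp add: I_def abs_mult mult_left_mono)
    next
      case False
      have "norm (s *\<^sub>R (axis i 1 :: real ^ 'a)) \<le> 1" using s by simp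
      then have "R < norm (x + s *\<^sub>R axis i 1)"
        using norm_diff_ineq[of x "s *\<^sub>R axis i 1"] False by linarith
      then show ?thesis using False R(2) by (simp add: d_def I_def)
    qed
    then have "(d x)\<^sup>2 \<le> s\<^sup>2 * (I x)\<^sup>2" for x
      using power_mono[of "\<bar>d x\<bar>" "\<bar>s\<bar> * I x" 2] by (simp add: power_mult_distrib)
    then have "(LINT x|lborel. (d x)\<^sup>2) \<le> (LINT x|lborel. s\<^sup>2 * (I x)\<^sup>2)"
      using L2_D[OF dL2] L2_D[OF IL2] by (intro integral_mono) auto
    then have "L2_norm d \<le> sqrt (s\<^sup>2 * (LINT x|lborel. (I x)\<^sup>2))" by (simp add: L2_norm_def)
    also have "\<dots> = \<bar>s\<bar> * L2_norm I" by (simp add: L2_norm_def real_sqrt_mult)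
    also have "L2_norm d = norm (to_l2 d)" by (simp add: norm_to_l2 dL2)
    also have "to_l2 d = tr (s *\<^sub>R axis i 1) (to_l2 \<phi>) - to_l2 \<phi>"
      unfolding d_def by (simp add: to_l2_diff test_L2 L2_translate \<phi> tr_to_l2)
    finally show ?thesis .
  qed
  have "((\<lambda>s. tr (s *\<^sub>R axis i 1) (to_l2 \<phi>) - to_l2 \<phi>) \<longlongrightarrow> 0) (at 0)"
  proof (rule Lim_null_comparison)
    show "\<forall>\<^sub>F s in at 0. norm (tr (s *\<^sub>R axis i 1) (to_l2 \<phi>) - to_l2 \<phi>) \<le> \<bar>s\<bar> * L2_norm I"
      unfolding eventually_at by (rule exI[of _ 1]) (auto intro: bound)
    show "((\<lambda>s. \<bar>s\<bar> * L2_norm I) \<longlongrightarrow> 0) (at 0)" by (auto intro!: tendsto_eq_intros)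
  qed
  then show ?thesis by (simp add: LIM_zero_iff)
qed

text \<open>The mollifier of the problem is also the source of test functions: its scaled translates
  feed the fundamental lemma, hence the density of \<open>tests\<close> and the uniqueness of weak
  derivatives.\<close>

locale mollifier =
  fixes \<psi> :: "real ^ 'n::finite \<Rightarrow> real"
  assumes \<psi>: "friedrichs_mollifier \<psi>"
begin

text \<open>Orthogonality to all test functions is exactly the hypothesis of the fundamental
  lemma.\<close>

lemma tests_dense: "closure (tests :: 'n l2 set) = UNIV"
proof (rule dense_subspaceI[OF tests_subspace])
  fix z :: "'n l2" assume z: "\<And>v. v \<in> tests \<Longrightarrow> v \<bullet> z = 0"
  have "AE x in lborel. of_l2 z x = 0"
  proof (rule test_zero_imp_AE_zero[OF \<psi>])
    show "locally_integrable (of_l2 z)" by (intro locally_integrable_L2) simp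
    show "(LINT y|lborel. of_l2 z y * \<phi> y) = 0" if "\<phi> \<in> test_functions" for \<phi>
      using z[of "to_l2 \<phi>"] that by (simp add: tests_def inner_test inner_commute)
  qed
  then have "to_l2 (of_l2 z) = to_l2 (\<lambda>x. 0)" by (subst to_l2_eq_iff) (auto simp: L2_zero)
  then show "z = 0" by (simp add: to_l2_zero)
qed

lemma norm_le_testI:
  fixes z :: "'n l2"
  assumes "\<And>\<phi>. \<phi> \<in> test_functions \<Longrightarrow> \<bar>z \<bullet> to_l2 \<phi>\<bar> \<le> C * norm (to_l2 \<phi>)" "C \<ge> 0"
  shows "norm z \<le> C"
  by (rule dense_norm_le[OF tests_dense _ assms(2)]) (use assms(1) in \<open>fastforce simp: tests_def\<close>)

lemma eq_testI:
  fixes f g :: "'n l2"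
  assumes "\<And>\<phi>. \<phi> \<in> test_functions \<Longrightarrow> f \<bullet> to_l2 \<phi> = g \<bullet> to_l2 \<phi>"
  shows "f = g"
proof -
  have "norm (f - g) \<le> 0" by (rule norm_le_testI) (use assms in \<open>auto simp: inner_diff_left\<close>)
  then show ?thesis by simp
qed

lemma wd_unique: "wd i (f :: 'n l2) g \<Longrightarrow> wd i f g' \<Longrightarrow> g = g'"
  by (rule eq_testI) (auto simp: wd_def)

text \<open>Translations are isometries, so strong continuity has to be checked only on the dense
  set of test functions.\<close>

lemma tr_tendsto: "((\<lambda>s. tr (s *\<^sub>R axis i 1) f) \<longlongrightarrow> (f :: 'n l2)) (at 0)"
proof (rule tendstoI)
  fix e :: real assume e: "e > 0"
  obtain z where "z \<in> tests" and z: "dist z f < e / 3"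
    using tests_dense closure_approachable[of f tests] e by (metis UNIV_I zero_less_divide_iff zero_less_numeral)
  then obtain \<phi> where \<phi>: "\<phi> \<in> test_functions" "z = to_l2 \<phi>" by (auto simp: tests_def)
  have "\<forall>\<^sub>F s in at 0. dist (tr (s *\<^sub>R axis i 1) z) z < e / 3"
    using tendstoD[OF tr_test_tendsto[OF \<phi>(1), of i], of "e/3"] e by (simp add: \<phi>(2))
  then show "\<forall>\<^sub>F s in at 0. dist (tr (s *\<^sub>R axis i 1) f) f < e"
  proof eventually_elim
    case (elim s)
    have "norm (tr (s *\<^sub>R axis i 1) f - tr (s *\<^sub>R axis i 1) z) = norm (f - z)" by (simp add: tr_diff[symmetric])
    moreover have "tr (s *\<^sub>R axis i 1) f - f = (tr (s *\<^sub>R axis i 1) f - tr (s *\<^sub>R axis i 1) z) + (tr (s *\<^sub>R axis i 1) z - z) - (f - z)"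
      by simp
    ultimately have "norm (tr (s *\<^sub>R axis i 1) f - f) \<le> norm (f - z) + norm (tr (s *\<^sub>R axis i 1) z - z) + norm (f - z)"
      by (metis norm_add_diff_le)
    then show ?case using elim z by (simp add: dist_norm norm_minus_commute)
  qed
qed

text \<open>Mean value theorem in weak form: the translation is moved to \<open>\<phi>\<close> and
  back. It is useful because all translates of \<open>g\<close> have the same norm.\<close>

lemma wd_mvt:
  assumes wd: "wd i (f :: 'n l2) g" and \<phi>: "\<phi> \<in> test_functions"
  obtains \<xi> where "\<bar>\<xi>\<bar> \<le> \<bar>s\<bar>" "(tr (s *\<^sub>R axis i 1) f - f) \<bullet> to_l2 \<phi> = s * (tr (\<xi> *\<^sub>R axis i 1) g \<bullet> to_l2 \<phi>)"
proof -
  have "locally_integrable (of_l2 f)" by (intro locally_integrable_L2) simp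
  \<comment> \<open>Shifting \<open>f\<close> by \<open>s\<close> means shifting
    \<open>\<phi>\<close> by \<open>- s\<close>; the same change of sign turns \<open>\<xi>\<close>
    into \<open>- \<xi>\<close> at the end.\<close>
  from correlation_mvt[OF this \<phi>, of "- s" i] obtain \<xi> where \<xi>: "\<bar>\<xi>\<bar> \<le> \<bar>s\<bar>"
    "(LINT x|lborel. of_l2 f x * \<phi> (x + (- s) *\<^sub>R axis i 1)) - (LINT x|lborel. of_l2 f x * \<phi> x)
      = (- s) * (LINT x|lborel. of_l2 f x * partial i \<phi> (x + \<xi> *\<^sub>R axis i 1))" by auto
  have t: "(\<lambda>x. \<phi> (x + r *\<^sub>R axis i 1)) \<in> test_functions" for r by (rule test_translate[OF \<phi>])
  have "(LINT x|lborel. of_l2 f x * partial i \<phi> (x + \<xi> *\<^sub>R axis i 1)) = f \<bullet> to_l2 (partial i (\<lambda>x. \<phi> (x + \<xi> *\<^sub>R axis i 1)))"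
    by (subst inner_test[OF test_partial[OF t]], subst partial_translate[OF \<phi>]) (rule refl)
  also have "\<dots> = - (g \<bullet> to_l2 (\<lambda>x. \<phi> (x + \<xi> *\<^sub>R axis i 1)))" by (rule wd_D[OF wd t])
  also have "\<dots> = - (tr ((- \<xi>) *\<^sub>R axis i 1) g \<bullet> to_l2 \<phi>)" by (simp add: tr_inner tr_to_l2 test_L2 \<phi>)
  finally have 1: "(LINT x|lborel. of_l2 f x * partial i \<phi> (x + \<xi> *\<^sub>R axis i 1)) = - (tr ((- \<xi>) *\<^sub>R axis i 1) g \<bullet> to_l2 \<phi>)" .
  have 2: "(LINT x|lborel. of_l2 f x * \<phi> (x + (- s) *\<^sub>R axis i 1)) = tr (s *\<^sub>R axis i 1) f \<bullet> to_l2 \<phi>"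
    by (simp only: inner_test[OF t, symmetric]) (simp add: tr_inner tr_to_l2 test_L2 \<phi>)
  show thesis
    using \<xi> unfolding 1 2 by (intro that[of "- \<xi>"]) (auto simp: inner_diff_left inner_test \<phi>)
qed

lemma norm_dq_le:
  assumes wd: "wd i (f :: 'n l2) g" shows "norm (dq i s f) \<le> norm g"
proof (cases "s = 0")
  case False
  have "norm (tr (s *\<^sub>R axis i 1) f - f) \<le> \<bar>s\<bar> * norm g"
  proof (rule norm_le_testI)
    fix \<phi> :: "real ^ 'n \<Rightarrow> real" assume \<phi>: "\<phi> \<in> test_functions"
    obtain \<xi> where "(tr (s *\<^sub>R axis i 1) f - f) \<bullet> to_l2 \<phi> = s * (tr (\<xi> *\<^sub>R axis i 1) g \<bullet> to_l2 \<phi>)"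
      using wd_mvt[OF wd \<phi>] by metis
    moreover have "\<bar>tr (\<xi> *\<^sub>R axis i 1) g \<bullet> to_l2 \<phi>\<bar> \<le> norm g * norm (to_l2 \<phi>)"
      using Cauchy_Schwarz_ineq2[of "tr (\<xi> *\<^sub>R axis i 1) g" "to_l2 \<phi>"] by simp
    ultimately show "\<bar>(tr (s *\<^sub>R axis i 1) f - f) \<bullet> to_l2 \<phi>\<bar> \<le> \<bar>s\<bar> * norm g * norm (to_l2 \<phi>)"
      by (simp add: abs_mult mult.assoc mult_left_mono)
  qed simp
  moreover have "norm (dq i s f) = norm (tr (s *\<^sub>R axis i 1) f - f) / \<bar>s\<bar>"
    by (simp add: dq_def divide_inverse mult.commute)
  ultimately show ?thesis using False by (simp add: pos_divide_le_eq mult.commute)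
qed (simp add: dq_def)

text \<open>By \<open>wd_mvt\<close> the quotient acts on each \<open>\<phi>\<close> like a
  translate of \<open>g\<close> by at most \<open>\<bar>s\<bar>\<close>. Strong continuity makes the
  error small uniformly in \<open>\<phi>\<close>, although \<open>\<xi>\<close> depends on
  it.\<close>

lemma dq_tendsto:
  assumes wd: "wd i (f :: 'n l2) g" shows "((\<lambda>s. dq i s f) \<longlongrightarrow> g) (at 0)"
proof (rule tendstoI)
  fix e :: real assume e: "e > 0"
  have "\<forall>\<^sub>F s in at 0. dist (tr (s *\<^sub>R axis i 1) g) g < e / 2" using tendstoD[OF tr_tendsto, of "e/2"] e by simp
  then obtain d where d: "d > 0" "\<And>s. s \<noteq> 0 \<Longrightarrow> \<bar>s\<bar> < d \<Longrightarrow> norm (tr (s *\<^sub>R axis i 1) g - g) < e / 2"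
    unfolding eventually_at by (auto simp: dist_norm)
  then have d': "norm (tr (s *\<^sub>R axis i 1) g - g) \<le> e / 2" if "\<bar>s\<bar> < d" for s
    using that e by (cases "s = 0") (auto intro: less_imp_le)
  have "norm (dq i s f - g) \<le> e / 2" if s: "s \<noteq> 0" "\<bar>s\<bar> < d" for s
  proof (rule norm_le_testI)
    fix \<phi> :: "real ^ 'n \<Rightarrow> real" assume \<phi>: "\<phi> \<in> test_functions"
    obtain \<xi> where \<xi>: "\<bar>\<xi>\<bar> \<le> \<bar>s\<bar>" "(tr (s *\<^sub>R axis i 1) f - f) \<bullet> to_l2 \<phi> = s * (tr (\<xi> *\<^sub>R axis i 1) g \<bullet> to_l2 \<phi>)"
      using wd_mvt[OF wd \<phi>] by metis
    have "(dq i s f - g) \<bullet> to_l2 \<phi> = (tr (\<xi> *\<^sub>R axis i 1) g - g) \<bullet> to_l2 \<phi>"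
      using \<xi>(2) s(1) by (simp add: dq_def inner_diff_left)
    also have "\<bar>\<dots>\<bar> \<le> norm (tr (\<xi> *\<^sub>R axis i 1) g - g) * norm (to_l2 \<phi>)" by (rule Cauchy_Schwarz_ineq2)
    also have "\<dots> \<le> e / 2 * norm (to_l2 \<phi>)" using \<xi>(1) s(2) by (intro mult_right_mono d') auto
    finally show "\<bar>(dq i s f - g) \<bullet> to_l2 \<phi>\<bar> \<le> e / 2 * norm (to_l2 \<phi>)" .
  qed (use e in simp)
  then show "\<forall>\<^sub>F s in at 0. dist (dq i s f) g < e"
    unfolding eventually_at using d(1) e by (intro exI[of _ d]) (fastforce simp: dist_norm)
qed

text \<open>The limit of \<open>dq_inner\<close> as \<open>s\<close> tends to 0. Both factors are
  merely weakly differentiable; the argument replaces an approximation by smooth functions in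
  \<open>H1\<close>.\<close>

lemma integration_by_parts:
  assumes f: "wd i (f :: 'n l2) f'" and g: "wd i g g'"
  shows "f' \<bullet> g = - (f \<bullet> g')"
proof -
  have "((\<lambda>s. dq i s f \<bullet> g) \<longlongrightarrow> f' \<bullet> g) (at 0)" by (intro tendsto_intros dq_tendsto f)
  moreover have "((\<lambda>s. - (f \<bullet> dq i (- s) g)) \<longlongrightarrow> - (f \<bullet> g')) (at 0)"
    by (intro tendsto_intros filterlim_compose[OF dq_tendsto[OF g] filterlim_uminus_at_0])
  ultimately show ?thesis unfolding dq_inner by (intro tendsto_unique[of "at (0::real)"]) simp_all
qed

text \<open>The derivative falls on \<open>\<phi>\<close>, so the limit is identified before
  \<open>f\<close> is known to have a weak derivative.\<close>

lemma dq_inner_test_tendsto: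
  fixes f :: "'n l2"
  assumes \<phi>: "\<phi> \<in> test_functions"
  shows "((\<lambda>s. dq i s f \<bullet> to_l2 \<phi>) \<longlongrightarrow> - (f \<bullet> to_l2 (partial i \<phi>))) (at 0)"
proof -
  define F where "F r = (LINT x|lborel. of_l2 f x * \<phi> (x + r *\<^sub>R axis i 1))" for r
  have "locally_integrable (of_l2 f)" by (intro locally_integrable_L2) simp
  from correlation_derivative_0[OF this \<phi>, of i]
  have "(F has_real_derivative f \<bullet> to_l2 (partial i \<phi>)) (at 0)"
    unfolding F_def by (simp add: inner_test test_partial \<phi>)
  then have lim: "((\<lambda>h. (F h - F 0) / h) \<longlongrightarrow> f \<bullet> to_l2 (partial i \<phi>)) (at 0)" by (simp add: DERIV_def)
  from filterlim_compose[OF lim filterlim_uminus_at_0]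
  have "((\<lambda>s. - ((F (- s) - F 0) / (- s))) \<longlongrightarrow> - (f \<bullet> to_l2 (partial i \<phi>))) (at 0)"
    by (intro tendsto_minus) simp
  moreover have "- ((F (- s) - F 0) / (- s)) = dq i s f \<bullet> to_l2 \<phi>" for s
  proof -
    have "F r = f \<bullet> tr (r *\<^sub>R axis i 1) (to_l2 \<phi>)" for r
      by (simp add: F_def tr_to_l2 test_L2 \<phi> inner_test[OF test_translate[OF \<phi>]])
    then show ?thesis by (simp add: dq_def inner_diff_left tr_inner divide_inverse)
  qed
  ultimately show ?thesis by simp
qed

text \<open>The functionals \<open>dq i s f \<bullet> _\<close> converge on test functions; their
  limit inherits the bound \<open>C\<close> and is represented by the weak derivative. This explicit
  limit takes the place of weak compactness.\<close>

lemma wd_of_dq_bound: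
  fixes f :: "'n l2"
  assumes bound: "\<And>s. s \<noteq> 0 \<Longrightarrow> norm (dq i s f) \<le> C" and C: "C \<ge> 0"
  obtains g where "wd i f g" "norm g \<le> C"
proof -
  \<comment> \<open>\<open>Lim\<close> is a meaningful value only where the limit exists, which is
    shown next for \<open>z\<close> in \<open>tests\<close>.\<close>
  define \<Lambda> where "\<Lambda> z = Lim (at 0) (\<lambda>s. dq i s f \<bullet> z)" for z
  have lim: "((\<lambda>s. dq i s f \<bullet> z) \<longlongrightarrow> \<Lambda> z) (at 0)" if z: "z \<in> tests" for z
  proof -
    obtain \<phi> where "\<phi> \<in> test_functions" "z = to_l2 \<phi>" using z by (auto simp: tests_def)
    then show ?thesis using dq_inner_test_tendsto[of \<phi> i f] tendsto_Lim[OF trivial_limit_at]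
      unfolding \<Lambda>_def by metis
  qed
  have eqI: "\<Lambda> z = l" if "z \<in> tests" "((\<lambda>s. dq i s f \<bullet> z) \<longlongrightarrow> l) (at 0)" for z l
    using tendsto_unique[OF trivial_limit_at lim that(2)] that(1) by blast
  obtain g where g: "\<And>z. z \<in> tests \<Longrightarrow> \<Lambda> z = g \<bullet> z" "norm g \<le> C"
  proof (rule bounded_functional_representation[OF tests_subspace, of \<Lambda> C])
    fix x y :: "'n l2" assume xy: "x \<in> tests" "y \<in> tests"
    show "\<Lambda> (x + y) = \<Lambda> x + \<Lambda> y"
      by (rule eqI) (auto simp: inner_add_right intro!: tendsto_add lim xy subspace_add[OF tests_subspace])
  next
    fix c and x :: "'n l2" assume x: "x \<in> tests"
    show "\<Lambda> (c *\<^sub>R x) = c * \<Lambda> x"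
      by (rule eqI) (auto intro!: tendsto_mult_left lim x subspace_scale[OF tests_subspace])
  next
    fix x :: "'n l2" assume x: "x \<in> tests"
    show "\<bar>\<Lambda> x\<bar> \<le> C * norm x"
    proof (rule tendsto_upperbound[OF tendsto_rabs[OF lim[OF x]]])
      have "\<bar>dq i s f \<bullet> x\<bar> \<le> C * norm x" if "s \<noteq> 0" for s
        using Cauchy_Schwarz_ineq2[of "dq i s f" x] mult_right_mono[OF bound[OF that], of "norm x"] by simp
      then show "\<forall>\<^sub>F s in at 0. \<bar>dq i s f \<bullet> x\<bar> \<le> C * norm x"
        by (auto simp: eventually_at_filter)
    qed simp
  qed (use C in auto)
  have "wd i f g"
    unfolding wd_def
  proof
    fix \<phi> :: "real ^ 'n \<Rightarrow> real" assume \<phi>: "\<phi> \<in> test_functions"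
    have "to_l2 \<phi> \<in> tests" using \<phi> by (simp add: tests_def)
    then have "g \<bullet> to_l2 \<phi> = - (f \<bullet> to_l2 (partial i \<phi>))"
      using eqI[OF _ dq_inner_test_tendsto[OF \<phi>]] g(1) by metis
    then show "f \<bullet> to_l2 (partial i \<phi>) = - (g \<bullet> to_l2 \<phi>)" by simp
  qed
  then show thesis using g(2) by (rule that)
qed

end

section \<open>Multiplication operators and elliptic regularity\<close>

definition ebdd :: "(real ^ 'n::finite \<Rightarrow> real) \<Rightarrow> bool" where
  "ebdd m \<longleftrightarrow> m \<in> borel_measurable borel \<and> (\<exists>M. AE x in lborel. \<bar>m x\<bar> \<le> M)"

definition mul :: "(real ^ 'n::finite \<Rightarrow> real) \<Rightarrow> 'n l2 \<Rightarrow> 'n l2" where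
  "mul m f = to_l2 (\<lambda>x. m x * of_l2 f x)"

lemma ebdd_measurable [measurable_dest]: "ebdd m \<Longrightarrow> m \<in> borel_measurable borel"
  by (simp add: ebdd_def)

lemma ebdd_D:
  assumes "ebdd m"
  obtains M where "M \<ge> 0" "AE x in lborel. \<bar>m x\<bar> \<le> M"
proof -
  obtain M where M: "AE x in lborel. \<bar>m x\<bar> \<le> M" using assms by (auto simp: ebdd_def)
  then have "AE x in lborel. \<bar>m x\<bar> \<le> max M 0" by eventually_elim auto
  then show thesis by (rule that[rotated]) simp
qed

lemma ebddI: "m \<in> borel_measurable borel \<Longrightarrow> AE x in lborel. \<bar>m x\<bar> \<le> M \<Longrightarrow> ebdd m"
  by (auto simp: ebdd_def)

lemma ebdd_locally_integrable: "ebdd m \<Longrightarrow> locally_integrable m"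
  unfolding ebdd_def by (blast intro: locally_integrable_bounded)

lemma ebdd_mult_L2:
  assumes m: "ebdd m" and f: "f \<in> L2"
  shows "(\<lambda>x. m x * f x) \<in> L2"
proof -
  have [measurable]: "m \<in> borel_measurable borel" "f \<in> borel_measurable borel"
    using ebdd_measurable[OF m] L2_D[OF f] by auto
  obtain M where M: "AE x in lborel. \<bar>m x\<bar> \<le> M" using m by (auto simp: ebdd_def)
  have "integrable lborel (\<lambda>x. M\<^sup>2 * (f x)\<^sup>2)" using L2_D[OF f] by simp
  then have "integrable lborel (\<lambda>x. (m x * f x)\<^sup>2)"
  proof (rule Bochner_Integration.integrable_bound)
    show "AE x in lborel. norm ((m x * f x)\<^sup>2) \<le> norm (M\<^sup>2 * (f x)\<^sup>2)"
      using M
    proof eventually_elim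
      case (elim x)
      then have "\<bar>m x\<bar>\<^sup>2 \<le> M\<^sup>2" by (intro power_mono) auto
      then show ?case by (simp add: power_mult_distrib mult_right_mono)
    qed
  qed simp
  then show ?thesis by (simp add: L2_def)
qed

lemma mul_to_l2:
  assumes m: "ebdd m" and f: "f \<in> L2"
  shows "mul m (to_l2 f) = to_l2 (\<lambda>x. m x * f x)"
  unfolding mul_def using of_l2_to_l2[OF f] by (subst to_l2_eq_iff) (auto simp: ebdd_mult_L2 m f)

lemma mul_inner_to_l2:
  "ebdd m \<Longrightarrow> g \<in> L2 \<Longrightarrow> mul m f \<bullet> to_l2 g = (LINT x|lborel. m x * of_l2 f x * g x)"
  by (simp add: mul_def to_l2_inner ebdd_mult_L2)

lemma mul_add: "ebdd m \<Longrightarrow> mul m (f + g) = mul m f + mul m g"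
  and mul_diff: "ebdd m \<Longrightarrow> mul m (f - g) = mul m f - mul m g"
  and mul_scale: "ebdd m \<Longrightarrow> mul m (c *\<^sub>R f) = c *\<^sub>R mul m f"
proof -
  assume m: "ebdd m"
  have "mul m (to_l2 (of_l2 f) + to_l2 (of_l2 g)) = mul m f + mul m g"
    unfolding to_l2_add[OF of_l2_L2 of_l2_L2, symmetric] mul_to_l2[OF m L2_add[OF of_l2_L2 of_l2_L2]]
    by (simp add: mul_def distrib_left to_l2_add ebdd_mult_L2 m)
  then show "mul m (f + g) = mul m f + mul m g" by simp
  have "mul m (to_l2 (of_l2 f) - to_l2 (of_l2 g)) = mul m f - mul m g"
    unfolding to_l2_diff[OF of_l2_L2 of_l2_L2, symmetric] mul_to_l2[OF m L2_diff[OF of_l2_L2 of_l2_L2]]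
    by (simp add: mul_def right_diff_distrib to_l2_diff ebdd_mult_L2 m)
  then show "mul m (f - g) = mul m f - mul m g" by simp
  have "mul m (c *\<^sub>R to_l2 (of_l2 f)) = c *\<^sub>R mul m f"
    unfolding to_l2_scale[OF of_l2_L2, symmetric] mul_to_l2[OF m L2_scale[OF of_l2_L2]]
    by (simp add: mul_def mult.left_commute[of _ c] to_l2_scale ebdd_mult_L2 m)
  then show "mul m (c *\<^sub>R f) = c *\<^sub>R mul m f" by simp
qed

lemma mul_zero: "ebdd m \<Longrightarrow> mul m 0 = 0"
  using mul_scale[of m 0 0] by simp

lemma mul_inner: "ebdd m \<Longrightarrow> mul m f \<bullet> g = f \<bullet> mul m g"
  unfolding mul_def inner_to_l2_right[OF ebdd_mult_L2[OF _ of_l2_L2]]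
  by (subst inner_commute) (simp add: inner_to_l2_right ebdd_mult_L2 mult_ac)

lemma ebdd_translate:
  assumes "ebdd m" shows "ebdd (\<lambda>x. m (x + a))"
proof -
  have [measurable]: "m \<in> borel_measurable borel" using ebdd_measurable[OF assms] .
  obtain M where "AE x in lborel. \<bar>m x\<bar> \<le> M" using assms by (auto simp: ebdd_def)
  from AE_translate[OF this, of a] show ?thesis by (intro ebddI) simp_all
qed

lemma ebdd_diff:
  assumes "ebdd m" "ebdd m'" shows "ebdd (\<lambda>x. m x - m' x)"
proof -
  obtain M M' where M: "AE x in lborel. \<bar>m x\<bar> \<le> M" and M': "AE x in lborel. \<bar>m' x\<bar> \<le> M'"
    using assms by (auto simp: ebdd_def)
  then have "AE x in lborel. \<bar>m x - m' x\<bar> \<le> M + M'" by eventually_elim linarith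
  then show ?thesis using assms by (intro ebddI) (auto dest: ebdd_measurable)
qed

lemma mul_mul: "ebdd m \<Longrightarrow> ebdd m' \<Longrightarrow> mul m (mul m' f) = mul (\<lambda>x. m x * m' x) f"
  unfolding mul_def[of m'] by (simp add: mul_to_l2 ebdd_mult_L2) (simp add: mul_def mult.assoc)

lemma mul_one: "mul (\<lambda>x. 1) f = f"
  by (simp add: mul_def)

lemma norm_mul_le:
  assumes m: "ebdd m" and M: "AE x in lborel. \<bar>m x\<bar> \<le> M" "M \<ge> 0"
  shows "norm (mul m f) \<le> M * norm f"
proof -
  define g where "g x = m x * of_l2 f x" for x
  have g: "g \<in> L2" unfolding g_def by (intro ebdd_mult_L2 m of_l2_L2)
  have "(LINT x|lborel. (g x)\<^sup>2) \<le> (LINT x|lborel. M\<^sup>2 * (of_l2 f x)\<^sup>2)"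
  proof (rule integral_mono_AE)
    show "AE x in lborel. (g x)\<^sup>2 \<le> M\<^sup>2 * (of_l2 f x)\<^sup>2"
      using M(1)
    proof eventually_elim
      case (elim x)
      then have "\<bar>m x\<bar>\<^sup>2 \<le> M\<^sup>2" by (intro power_mono) auto
      then show ?case by (simp add: g_def power_mult_distrib mult_right_mono)
    qed
  qed (use L2_D[OF g] L2_D[OF of_l2_L2[of f]] in auto)
  then have "L2_norm g \<le> sqrt (M\<^sup>2 * (LINT x|lborel. (of_l2 f x)\<^sup>2))" by (simp add: L2_norm_def)
  also have "\<dots> = M * norm f" using M(2) by (simp add: norm_l2_eq L2_norm_def real_sqrt_mult)
  finally show ?thesis unfolding mul_def g_def[symmetric] by (simp add: norm_to_l2 g)
qed

lemma mul_bounded_linear: 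
  assumes "ebdd m" shows "bounded_linear (mul m)"
proof -
  obtain M where M: "M \<ge> 0" "AE x in lborel. \<bar>m x\<bar> \<le> M" using ebdd_D[OF assms] .
  show ?thesis
    by (rule bounded_linear_intro[of _ M])
      (use norm_mul_le[OF assms M(2,1)] in \<open>auto simp: mul_add mul_scale assms mult.commute\<close>)
qed

lemma mul_coercive:
  assumes m: "ebdd m" and c: "AE x in lborel. c \<le> m x"
  shows "c * (norm f)\<^sup>2 \<le> mul m f \<bullet> f"
proof -
  have "mul m f \<bullet> f = (LINT x|lborel. m x * of_l2 f x * of_l2 f x)"
    using mul_inner_to_l2[OF m of_l2_L2, of f f] by simp
  moreover have "(LINT x|lborel. c * (of_l2 f x)\<^sup>2) \<le> (LINT x|lborel. m x * of_l2 f x * of_l2 f x)"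
  proof (rule integral_mono_AE)
    show "AE x in lborel. c * (of_l2 f x)\<^sup>2 \<le> m x * of_l2 f x * of_l2 f x"
      using c by eventually_elim (simp add: power2_eq_square mult.assoc mult_right_mono)
    show "integrable lborel (\<lambda>x. m x * of_l2 f x * of_l2 f x)"
      by (intro L2_mult_integrable ebdd_mult_L2 m of_l2_L2)
  qed (use L2_D[OF of_l2_L2[of f]] in auto)
  moreover have "(norm f)\<^sup>2 = (LINT x|lborel. (of_l2 f x)\<^sup>2)"
    by (simp add: norm_l2_eq L2_norm_def integral_nonneg_AE)
  ultimately show ?thesis by simp
qed

lemma tr_mul: "ebdd m \<Longrightarrow> tr a (mul m f) = mul (\<lambda>x. m (x + a)) (tr a f)"
  unfolding mul_def[of m] tr_def[of a f]
  by (simp add: tr_to_l2 mul_to_l2 ebdd_mult_L2 ebdd_translate L2_translate)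

lemma mul_diff_left: "ebdd m \<Longrightarrow> ebdd m' \<Longrightarrow> mul (\<lambda>x. m x - m' x) f = mul m f - mul m' f"
  by (simp add: mul_def left_diff_distrib to_l2_diff ebdd_mult_L2)

text \<open>Discrete product rule. The shifted coefficient stays with the difference quotient and
  keeps any lower bound of \<open>m\<close>; the difference of \<open>m\<close> meets only
  \<open>f\<close> itself.\<close>

lemma dq_mul:
  assumes m: "ebdd m"
  shows "dq i s (mul m f) = mul (\<lambda>x. m (x + s *\<^sub>R axis i 1)) (dq i s f)
    + mul (\<lambda>x. m (x + s *\<^sub>R axis i 1) - m x) f /\<^sub>R s"
  using ebdd_translate[OF m, of "s *\<^sub>R axis i 1"]
  by (simp add: dq_def tr_mul m mul_diff_left mul_scale mul_diff algebra_simps)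

text \<open>The integral of a translate of \<open>\<phi>\<close> does not depend on the shift, and
  its derivative in the shift is the integral of the partial derivative.\<close>

lemma integral_partial_test:
  assumes \<phi>: "\<phi> \<in> test_functions" shows "(LINT x|lborel. partial i \<phi> x) = 0"
proof -
  have one: "locally_integrable (\<lambda>x::real^'a. 1)" by (rule locally_integrable_bounded[of _ 1]) auto
  have "(LINT x|lborel. 1 * \<phi> (x + r *\<^sub>R axis i 1)) = (LINT x|lborel. \<phi> x)" for r
    using integral_translate[OF test_measurable[OF \<phi>], of "r *\<^sub>R axis i 1"] by simp
  with correlation_derivative_0[OF one \<phi>, of i]
  have "((\<lambda>r. LINT x|lborel. \<phi> x) has_real_derivative (LINT x|lborel. 1 * partial i \<phi> x)) (at 0)"
    by simp
  then have "(LINT x|lborel. 1 * partial i \<phi> x) = 0"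
    using DERIV_const DERIV_unique by blast
  then show ?thesis by simp
qed

lemma test_wd:
  assumes \<phi>: "\<phi> \<in> test_functions" shows "wd i (to_l2 \<phi>) (to_l2 (partial i \<phi>))"
  unfolding wd_def
proof
  fix \<eta> :: "real ^ 'a \<Rightarrow> real" assume \<eta>: "\<eta> \<in> test_functions"
  have "(LINT x|lborel. \<phi> x * partial i \<eta> x + partial i \<phi> x * \<eta> x) = 0"
    using integral_partial_test[OF test_mult[OF \<phi> \<eta>], of i]
    by (simp only: partial_mult[OF test_differentiable[OF \<phi>] test_differentiable[OF \<eta>]])
  moreover have "integrable lborel (\<lambda>x. \<phi> x * partial i \<eta> x)" "integrable lborel (\<lambda>x. partial i \<phi> x * \<eta> x)"
    using \<phi> \<eta> by (auto intro!: L2_mult_integrable test_L2 test_partial)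
  ultimately show "to_l2 \<phi> \<bullet> to_l2 (partial i \<eta>) = - (to_l2 (partial i \<phi>) \<bullet> to_l2 \<eta>)"
    using \<phi> \<eta> by (simp add: to_l2_inner test_L2 test_partial)
qed

text \<open>Lipschitz bound by duality: a translate of \<open>\<phi>\<close> has the same integral
  as \<open>\<phi>\<close>, so the position \<open>\<xi>\<close> of the mean value drops
  out.\<close>

lemma weak_partial_translate_bound:
  fixes \<psi> h :: "real ^ 'n::finite \<Rightarrow> real"
  assumes \<psi>: "friedrichs_mollifier \<psi>" and h: "ebdd h" and wp: "has_weak_partial i h h'" and L: "AE x in lborel. \<bar>h' x\<bar> \<le> L"
  shows "AE x in lborel. \<bar>h (x + s *\<^sub>R axis i 1) - h x\<bar> \<le> \<bar>s\<bar> * L"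
proof (rule test_bound_imp_AE_bound[OF \<psi>])
  have li: "locally_integrable h" "locally_integrable h'" using wp by (auto simp: has_weak_partial_def)
  have [measurable]: "h \<in> borel_measurable borel" "h' \<in> borel_measurable borel"
    using li by (auto intro: locally_integrable_measurable)
  have "ebdd (\<lambda>x. h (x + s *\<^sub>R axis i 1) - h x)" by (rule ebdd_diff[OF ebdd_translate[OF h] h])
  then show "locally_integrable (\<lambda>x. h (x + s *\<^sub>R axis i 1) - h x)"
    by (rule ebdd_locally_integrable)
  have lit: "locally_integrable (\<lambda>x. h (x + s *\<^sub>R axis i 1))"
    by (rule ebdd_locally_integrable[OF ebdd_translate[OF h]])
  fix \<phi> :: "real ^ 'n \<Rightarrow> real" assume \<phi>: "\<phi> \<in> test_functions" "\<And>x. 0 \<le> \<phi> x"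
  have [measurable]: "\<phi> \<in> borel_measurable borel" using \<phi> test_measurable by auto
  obtain \<xi> where "\<bar>\<xi>\<bar> \<le> \<bar>- s\<bar>" and \<xi>: "(LINT x|lborel. h x * \<phi> (x + (- s) *\<^sub>R axis i 1)) - (LINT x|lborel. h x * \<phi> x)
      = (- s) * (LINT x|lborel. h x * partial i \<phi> (x + \<xi> *\<^sub>R axis i 1))"
    by (rule correlation_mvt[OF li(1) \<phi>(1)])
  have t: "(\<lambda>x. \<phi> (x + \<xi> *\<^sub>R axis i 1)) \<in> test_functions" using test_translate \<phi>(1) by blast
  have 1: "(LINT x|lborel. h x * partial i \<phi> (x + \<xi> *\<^sub>R axis i 1)) = - (LINT x|lborel. h' x * \<phi> (x + \<xi> *\<^sub>R axis i 1))"
  proof -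
    have "(LINT x|lborel. h x * partial i (\<lambda>x. \<phi> (x + \<xi> *\<^sub>R axis i 1)) x) = - (LINT x|lborel. h' x * \<phi> (x + \<xi> *\<^sub>R axis i 1))"
      using wp t unfolding has_weak_partial_def by blast
    then show ?thesis by (simp only: partial_translate[OF \<phi>(1)])
  qed
  have 2: "(LINT x|lborel. (h (x + s *\<^sub>R axis i 1) - h x) * \<phi> x)
      = (LINT x|lborel. h x * \<phi> (x + (- s) *\<^sub>R axis i 1)) - (LINT x|lborel. h x * \<phi> x)"
  proof -
    have "(LINT x|lborel. (h (x + s *\<^sub>R axis i 1) - h x) * \<phi> x)
        = (LINT x|lborel. h (x + s *\<^sub>R axis i 1) * \<phi> x) - (LINT x|lborel. h x * \<phi> x)"
      unfolding left_diff_distrib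
      by (intro Bochner_Integration.integral_diff locally_integrable_test lit li \<phi>)
    also have "(LINT x|lborel. h (x + s *\<^sub>R axis i 1) * \<phi> x) = (LINT x|lborel. h x * \<phi> (x + (- s) *\<^sub>R axis i 1))"
      using integral_translate[of "\<lambda>x. h x * \<phi> (x + (- s) *\<^sub>R axis i 1)" "s *\<^sub>R axis i 1"] by simp
    finally show ?thesis .
  qed
  have "\<bar>LINT x|lborel. (h (x + s *\<^sub>R axis i 1) - h x) * \<phi> x\<bar> = \<bar>s\<bar> * \<bar>LINT x|lborel. h' x * \<phi> (x + \<xi> *\<^sub>R axis i 1)\<bar>"
    by (simp only: 1 2 \<xi> abs_mult abs_minus_cancel)
  also have "\<bar>LINT x|lborel. h' x * \<phi> (x + \<xi> *\<^sub>R axis i 1)\<bar> \<le> (LINT x|lborel. \<bar>h' x * \<phi> (x + \<xi> *\<^sub>R axis i 1)\<bar>)"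
    by (rule integral_abs_bound)
  also have "\<dots> \<le> (LINT x|lborel. L * \<phi> (x + \<xi> *\<^sub>R axis i 1))"
  proof (rule integral_mono_AE)
    show "integrable lborel (\<lambda>x. \<bar>h' x * \<phi> (x + \<xi> *\<^sub>R axis i 1)\<bar>)"
      by (intro integrable_abs locally_integrable_test li t)
    show "integrable lborel (\<lambda>x. L * \<phi> (x + \<xi> *\<^sub>R axis i 1))" using test_integrable[OF t] by simp
    show "AE x in lborel. \<bar>h' x * \<phi> (x + \<xi> *\<^sub>R axis i 1)\<bar> \<le> L * \<phi> (x + \<xi> *\<^sub>R axis i 1)"
      using L by eventually_elim (simp add: abs_mult \<phi>(2) mult_right_mono)
  qed
  also have "\<dots> = L * (LINT x|lborel. \<phi> x)" using integral_translate[of \<phi>] by simp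
  finally show "\<bar>LINT x|lborel. (h (x + s *\<^sub>R axis i 1) - h x) * \<phi> x\<bar> \<le> \<bar>s\<bar> * L * (LINT x|lborel. \<phi> x)"
    by (simp add: mult_left_mono mult.assoc)
qed

section \<open>Product rule and elliptic regularity\<close>

context mollifier
begin

lemma norm_mul_dq_le:
  assumes h: "ebdd h" and wp: "has_weak_partial i h h'" and L: "AE x in lborel. \<bar>h' x\<bar> \<le> L" "L \<ge> 0"
  shows "norm (mul (\<lambda>x. h (x + s *\<^sub>R axis i 1) - h x) (f :: 'n l2) /\<^sub>R s) \<le> L * norm f"
proof (cases "s = 0")
  case False
  have "norm (mul (\<lambda>x. h (x + s *\<^sub>R axis i 1) - h x) f) \<le> \<bar>s\<bar> * L * norm f"
    by (intro norm_mul_le ebdd_diff[OF ebdd_translate[OF h] h] weak_partial_translate_bound[OF \<psi> h wp L(1)]) (simp add: L)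
  moreover have "norm (mul (\<lambda>x. h (x + s *\<^sub>R axis i 1) - h x) f /\<^sub>R s)
      = norm (mul (\<lambda>x. h (x + s *\<^sub>R axis i 1) - h x) f) / \<bar>s\<bar>"
    by (simp add: divide_inverse mult.commute)
  ultimately show ?thesis using False by (simp add: pos_divide_le_eq mult_ac)
qed (use L in simp)

text \<open>Two steps, because the weak derivative of \<open>h\<close> is tested with smooth
  functions only: for a test function \<open>\<eta>\<close> in place of \<open>f\<close> the product
  of \<open>\<eta>\<close> and \<open>\<phi>\<close> is admissible, and
  \<open>integration_by_parts\<close> against \<open>h\<close> times \<open>\<eta>\<close> then
  reaches general \<open>f\<close>.\<close>

lemma wd_mul:
  assumes h: "ebdd h" and wp: "has_weak_partial i h h'" and h': "ebdd h'" and f: "wd i (f :: 'n l2) f'"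
  shows "wd i (mul h f) (mul h f' + mul h' f)"
  unfolding wd_def
proof
  fix \<eta> :: "real ^ 'n \<Rightarrow> real" assume \<eta>: "\<eta> \<in> test_functions"
  have 1: "wd i (mul h (to_l2 \<eta>)) (mul h' (to_l2 \<eta>) + mul h (to_l2 (partial i \<eta>)))"
    unfolding wd_def
  proof
    fix \<phi> :: "real ^ 'n \<Rightarrow> real" assume \<phi>: "\<phi> \<in> test_functions"
    have li: "locally_integrable h" "locally_integrable h'" using wp by (auto simp: has_weak_partial_def)
    have t: "(\<lambda>x. \<eta> x * \<phi> x) \<in> test_functions" "(\<lambda>x. \<eta> x * partial i \<phi> x) \<in> test_functions"
      "(\<lambda>x. partial i \<eta> x * \<phi> x) \<in> test_functions" using \<phi> \<eta> by (auto intro: test_mult test_partial)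
    have "(LINT x|lborel. h x * partial i (\<lambda>x. \<eta> x * \<phi> x) x) = - (LINT x|lborel. h' x * (\<eta> x * \<phi> x))"
      using wp t unfolding has_weak_partial_def by blast
    moreover have "(LINT x|lborel. h x * partial i (\<lambda>x. \<eta> x * \<phi> x) x)
        = (LINT x|lborel. h x * (\<eta> x * partial i \<phi> x) + h x * (partial i \<eta> x * \<phi> x))"
      unfolding partial_mult[OF test_differentiable[OF \<eta>] test_differentiable[OF \<phi>]] by (simp only: distrib_left)
    moreover have "\<dots> = (LINT x|lborel. h x * (\<eta> x * partial i \<phi> x)) + (LINT x|lborel. h x * (partial i \<eta> x * \<phi> x))"
      by (intro Bochner_Integration.integral_add locally_integrable_test li t)
    ultimately show "mul h (to_l2 \<eta>) \<bullet> to_l2 (partial i \<phi>) = - ((mul h' (to_l2 \<eta>) + mul h (to_l2 (partial i \<eta>))) \<bullet> to_l2 \<phi>)"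
      using \<phi> \<eta> h h'
      by (simp add: mul_to_l2 test_L2 test_partial inner_add_left to_l2_inner ebdd_mult_L2 mult.assoc)
  qed
  have "mul h f \<bullet> to_l2 (partial i \<eta>) = f \<bullet> mul h (to_l2 (partial i \<eta>))" by (rule mul_inner[OF h])
  also have "\<dots> = f \<bullet> (mul h' (to_l2 \<eta>) + mul h (to_l2 (partial i \<eta>))) - f \<bullet> mul h' (to_l2 \<eta>)"
    by (simp add: inner_add_right)
  also have "\<dots> = - (f' \<bullet> mul h (to_l2 \<eta>)) - f \<bullet> mul h' (to_l2 \<eta>)"
    using integration_by_parts[OF f 1] by simp
  also have "\<dots> = - ((mul h f' + mul h' f) \<bullet> to_l2 \<eta>)"
    by (simp add: inner_add_left mul_inner[OF h] mul_inner[OF h'])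
  finally show "mul h f \<bullet> to_l2 (partial i \<eta>) = - ((mul h f' + mul h' f) \<bullet> to_l2 \<eta>)" .
qed

text \<open>The weak equation is tested with \<open>\<phi> = D\<^sub>-\<^sub>s D\<^sub>s u\<close>, where \<open>D\<^sub>s\<close> is the difference quotient in direction \<open>k\<close>.\<close>

theorem elliptic_regularity:
  fixes u w :: "'n l2" and p :: "'n \<Rightarrow> 'n l2" and h :: "'n \<Rightarrow> real ^ 'n \<Rightarrow> real"
  assumes up: "\<And>j. wd j u (p j)"
    and h: "\<And>j. ebdd (h j)" and c: "c > 0" "\<And>j x. c \<le> h j x"
    and wp: "\<And>j. has_weak_partial k (h j) (h' j)" and L: "\<And>j. AE x in lborel. \<bar>h' j x\<bar> \<le> L" "L \<ge> 0"
    and weak: "\<And>\<phi> \<phi>'. (\<And>j. wd j \<phi> (\<phi>' j)) \<Longrightarrow> (\<Sum>j\<in>UNIV. mul (h j) (p j) \<bullet> \<phi>' j) = - (w \<bullet> \<phi>)"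
  obtains q where "wd k (p j) q" "norm q \<le> (norm w + L * (\<Sum>i\<in>UNIV. norm (p i))) / c"
proof -
  note thesisI = that
  define C where "C = norm w + L * (\<Sum>i\<in>UNIV. norm (p i))"
  have C: "C \<ge> 0" unfolding C_def using L(2) by (intro add_nonneg_nonneg mult_nonneg_nonneg sum_nonneg) auto
  have "norm (dq k s (p j)) \<le> C / c" for s
  proof -
    define z where "z i = dq k s (p i)" for i
    \<comment> \<open>All components are estimated together: coercivity controls the sum of the
      squares, while every term on the right is linear in \<open>Z\<close>.\<close>
    define Z where "Z = sqrt (\<Sum>i\<in>UNIV. (norm (z i))\<^sup>2)"
    have zZ: "norm (z i) \<le> Z" for i
      unfolding Z_def by (rule real_le_rsqrt) (rule member_le_sum, auto)
    have Z2: "Z\<^sup>2 = (\<Sum>i\<in>UNIV. (norm (z i))\<^sup>2)" unfolding Z_def by (simp add: sum_nonneg)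
    have Z0: "Z \<ge> 0" by (simp add: Z_def sum_nonneg)
    have wz: "wd i (dq k s u) (z i)" for i unfolding z_def by (intro wd_dq up)
    define g where "g i = mul (\<lambda>x. h i (x + s *\<^sub>R axis k 1) - h i x) (p i) /\<^sub>R s" for i
    have g: "norm (g i) \<le> L * norm (p i)" for i
      unfolding g_def by (rule norm_mul_dq_le[OF h wp L])
    have "(\<Sum>i\<in>UNIV. mul (h i) (p i) \<bullet> dq k (- s) (z i)) = - (w \<bullet> dq k (- s) (dq k s u))"
      by (rule weak) (intro wd_dq wz)
    then have "(\<Sum>i\<in>UNIV. dq k s (mul (h i) (p i)) \<bullet> z i) = w \<bullet> dq k (- s) (dq k s u)"
      unfolding dq_inner by (simp add: sum_negf)
    then have "(\<Sum>i\<in>UNIV. mul (\<lambda>x. h i (x + s *\<^sub>R axis k 1)) (z i) \<bullet> z i)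
        = w \<bullet> dq k (- s) (dq k s u) - (\<Sum>i\<in>UNIV. g i \<bullet> z i)"
      unfolding dq_mul[OF h] z_def[symmetric] g_def[symmetric] by (simp add: inner_add_left sum.distrib)
    moreover have "c * Z\<^sup>2 \<le> (\<Sum>i\<in>UNIV. mul (\<lambda>x. h i (x + s *\<^sub>R axis k 1)) (z i) \<bullet> z i)"
      unfolding Z2 sum_distrib_left by (intro sum_mono mul_coercive ebdd_translate[OF h]) (simp add: c)
    \<comment> \<open>The second difference quotient of \<open>u\<close> is bounded by
      \<open>z k\<close>, because \<open>z k\<close> is the derivative of \<open>dq k s u\<close> in
      the same direction \<open>k\<close>. No difference quotient falls on \<open>w\<close>.\<close>
    moreover have "w \<bullet> dq k (- s) (dq k s u) \<le> norm w * Z"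
    proof -
      have "w \<bullet> dq k (- s) (dq k s u) \<le> norm w * norm (dq k (- s) (dq k s u))" by (rule norm_cauchy_schwarz)
      also have "\<dots> \<le> norm w * Z"
        using norm_dq_le[OF wz[of k], of "- s"] zZ[of k] by (intro mult_left_mono) auto
      finally show ?thesis .
    qed
    moreover have "- (\<Sum>i\<in>UNIV. g i \<bullet> z i) \<le> (\<Sum>i\<in>UNIV. L * norm (p i) * Z)"
      unfolding sum_negf[symmetric]
    proof (rule sum_mono)
      fix i
      have "- (g i \<bullet> z i) \<le> norm (g i) * norm (z i)" using Cauchy_Schwarz_ineq2[of "g i" "z i"] by linarith
      also have "\<dots> \<le> L * norm (p i) * Z" using g zZ L(2) by (intro mult_mono) auto
      finally show "- (g i \<bullet> z i) \<le> L * norm (p i) * Z" .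
    qed
    ultimately have "c * Z\<^sup>2 \<le> C * Z"
      unfolding C_def by (simp add: distrib_right sum_distrib_left sum_distrib_right)
    \<comment> \<open>Quadratic against linear: cancelling \<open>Z\<close> gives a bound that is
      uniform in \<open>s\<close>.\<close>
    then have "c * Z \<le> C" using Z0 C by (cases "Z = 0") (auto simp: power2_eq_square)
    then have "Z \<le> C / c" using c(1) by (simp add: pos_le_divide_eq mult.commute)
    then show ?thesis using zZ[of j] by (simp add: z_def)
  qed
  note D = this
  show thesis
  proof (rule wd_of_dq_bound[of k "p j" "C / c"])
    show "norm (dq k s (p j)) \<le> C / c" for s by (rule D)
    show "C / c \<ge> 0" using C c(1) by simp
    show thesis if "wd k (p j) q" "norm q \<le> C / c" for q
      using that(1) that(2)[unfolded C_def] by (rule thesisI)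
  qed
qed

end

section \<open>The generator of the wave equation\<close>

text \<open>Skewness gives \<open>(norm (x - c *\<^sub>R y))\<^sup>2 = (norm x)\<^sup>2 + c\<^sup>2
  * (norm y)\<^sup>2\<close>, hence dissipativity. By \<open>orth\<close> the range of
  \<open>x - c *\<^sub>R y\<close> is dense; the same estimate and closedness of \<open>G\<close>
  make it closed.\<close>

lemma contraction_generatorI:
  fixes G :: "('a::{real_inner,banach,perfect_space} \<times> 'a) set"
  assumes sub: "subspace G" and cl: "closed G"
    and skew: "\<And>x y. (x, y) \<in> G \<Longrightarrow> x \<bullet> y = 0"
    and orth: "\<And>c z. c > 0 \<Longrightarrow> (\<And>x y. (x, y) \<in> G \<Longrightarrow> (x - c *\<^sub>R y) \<bullet> z = 0) \<Longrightarrow> z = 0"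
    and single: "\<And>y. (0, y) \<in> G \<Longrightarrow> y = 0"
  shows "contraction_generator G"
proof
  have dissip: "norm x \<le> norm (x - c *\<^sub>R y)" if "(x, y) \<in> G" "c > 0" for x y c
  proof -
    have "(norm (x - c *\<^sub>R y))\<^sup>2 = (norm x)\<^sup>2 + c\<^sup>2 * (norm y)\<^sup>2"
      using skew[OF that(1)] unfolding power2_norm_eq_inner
      by (simp add: inner_diff_left inner_diff_right inner_commute power2_eq_square)
    then have "(norm x)\<^sup>2 \<le> (norm (x - c *\<^sub>R y))\<^sup>2" by simp
    then show ?thesis by (rule power2_le_imp_le) simp
  qed
  show "\<exists>x y. (x, y) \<in> G \<and> x - c *\<^sub>R y = z" if c: "c > 0" for c z
  proof -
    define T where "T = (\<lambda>p::'a \<times> 'a. fst p - c *\<^sub>R snd p)"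
    have linT: "linear T" unfolding T_def by (rule linearI) (auto simp: algebra_simps)
    have subT: "subspace (T ` G)" by (rule linear_subspace_image[OF linT sub])
    have "closure (T ` G) = UNIV"
    proof (rule dense_subspaceI[OF subT])
      fix z assume "\<And>v. v \<in> T ` G \<Longrightarrow> v \<bullet> z = 0"
      then show "z = 0" by (intro orth[OF c]) (force simp: T_def)
    qed
    then obtain t where t: "\<And>n::nat. t n \<in> T ` G" "t \<longlonglongrightarrow> z" using closure_sequential[of z "T ` G"] by auto
    have "\<exists>p\<in>G. t n = T p" for n using t(1)[of n] by blast
    then obtain p where p: "\<And>n. p n \<in> G" "\<And>n. t n = T (p n)" by metis
    have fst_le: "norm (fst (p n) - fst (p m)) \<le> norm (t n - t m)" for n m
    proof -
      have "(fst (p n) - fst (p m), snd (p n) - snd (p m)) \<in> G"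
        using subspace_diff[OF sub p(1) p(1), of n m] by (simp add: minus_prod_def)
      from dissip[OF this c] show ?thesis unfolding p(2) T_def by (simp add: algebra_simps)
    qed
    have "Cauchy (\<lambda>n. fst (p n))"
    proof (rule metric_CauchyI)
      fix e :: real assume "e > 0"
      then obtain M where "\<forall>m\<ge>M. \<forall>n\<ge>M. dist (t m) (t n) < e"
        using LIMSEQ_imp_Cauchy[OF t(2)] unfolding Cauchy_def by blast
      then show "\<exists>M. \<forall>m\<ge>M. \<forall>n\<ge>M. dist (fst (p m)) (fst (p n)) < e"
        using fst_le le_less_trans unfolding dist_norm by blast
    qed
    then obtain x where x: "(\<lambda>n. fst (p n)) \<longlonglongrightarrow> x" using Cauchy_convergent convergent_def by blast
    have "(\<lambda>n. (1 / c) *\<^sub>R (fst (p n) - t n)) \<longlonglongrightarrow> (1 / c) *\<^sub>R (x - z)" by (intro tendsto_intros x t)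
    moreover have "(1 / c) *\<^sub>R (fst (p n) - t n) = snd (p n)" for n using c by (simp add: p(2) T_def)
    ultimately have y: "(\<lambda>n. snd (p n)) \<longlonglongrightarrow> (1 / c) *\<^sub>R (x - z)" by simp
    have "(x, (1 / c) *\<^sub>R (x - z)) \<in> G"
      using closed_sequentially[OF cl, of p] p(1) tendsto_Pair[OF x y] by simp
    moreover have "x - c *\<^sub>R ((1 / c) *\<^sub>R (x - z)) = z" using c by simp
    ultimately show ?thesis by blast
  qed
  note range = this
  show "closure (fst ` G) = UNIV"
  proof (rule dense_subspaceI)
    show "subspace (fst ` G)" by (rule linear_subspace_image[OF linear_fst sub])
    fix z assume z: "\<And>v. v \<in> fst ` G \<Longrightarrow> v \<bullet> z = 0"
    \<comment> \<open>A vector orthogonal to the domain is written as \<open>x - y\<close> with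
      \<open>(x, y)\<close> in the graph. Pairing with \<open>x\<close> and skewness give
      \<open>x = 0\<close>, then single-valuedness gives \<open>y = 0\<close>.\<close>
    obtain x y where xy: "(x, y) \<in> G" "x - 1 *\<^sub>R y = z" using range[of 1 z] by auto
    have "x \<in> fst ` G" using xy(1) by force
    then have "x \<bullet> z = 0" by (rule z)
    then have "x \<bullet> x = 0" using xy skew by (auto simp: inner_diff_right)
    then have "x = 0" by simp
    then show "z = 0" using single xy by auto
  qed
  show "norm x \<le> norm (x - c *\<^sub>R y)" if "(x, y) \<in> G" "c > 0" for x y c using that by (rule dissip)
qed (use sub cl in auto)

lemma inner_vec_eq: "(q :: 'a::real_inner ^ 'n) \<bullet> r = (\<Sum>j\<in>UNIV. q $ j \<bullet> r $ j)"
  by (simp add: inner_vec_def)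

locale wave = mollifier \<psi> for \<psi> :: "real ^ 'n::finite \<Rightarrow> real" +
  fixes h :: "'n \<Rightarrow> real ^ 'n \<Rightarrow> real" and c :: real
  assumes h: "\<And>j. ebdd (h j)" and c: "c > 0" and hc: "\<And>j x. c \<le> h j x"
begin

text \<open>\<open>a\<close> symmetrises the system and \<open>b\<close> undoes it; both are bounded
  because \<open>h\<close> has the lower bound \<open>c\<close> and is essentially bounded
  above.\<close>

definition a :: "'n \<Rightarrow> real ^ 'n \<Rightarrow> real" where "a j x = sqrt (h j x)"
definition b :: "'n \<Rightarrow> real ^ 'n \<Rightarrow> real" where "b j x = 1 / sqrt (h j x)"

lemma h_pos: "h j x > 0"
  using hc[of j x] c by linarith

lemma ebdd_a: "ebdd (a j)"
proof -
  have [measurable]: "h j \<in> borel_measurable borel" using h by (rule ebdd_measurable)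
  obtain M where M: "M \<ge> 0" "AE x in lborel. \<bar>h j x\<bar> \<le> M" using ebdd_D[OF h] .
  show ?thesis
  proof (rule ebddI)
    show "AE x in lborel. \<bar>a j x\<bar> \<le> sqrt M" using M(2) by eventually_elim (simp add: a_def less_imp_le[OF h_pos])
    show "a j \<in> borel_measurable borel" unfolding a_def by measurable
  qed
qed

lemma b_bound: "\<bar>b j x\<bar> \<le> 1 / sqrt c"
  using hc[of j x] c h_pos[of j x] by (simp add: b_def frac_le)

lemma ebdd_b: "ebdd (b j)"
proof -
  have [measurable]: "h j \<in> borel_measurable borel" using h by (rule ebdd_measurable)
  show ?thesis
  proof (rule ebddI)
    show "AE x in lborel. \<bar>b j x\<bar> \<le> 1 / sqrt c" using b_bound by simp
    show "b j \<in> borel_measurable borel" unfolding b_def by measurable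
  qed
qed

lemma mul_ab [simp]: "mul (a j) (mul (b j) f) = f" "mul (b j) (mul (a j) f) = f"
proof -
  have 1: "(\<lambda>x. a j x * b j x) = (\<lambda>x. 1)" "(\<lambda>x. b j x * a j x) = (\<lambda>x. 1)"
    using h_pos by (auto simp: a_def b_def fun_eq_iff less_imp_neq[symmetric])
  show "mul (a j) (mul (b j) f) = f" by (simp only: mul_mul[OF ebdd_a ebdd_b] 1 mul_one)
  show "mul (b j) (mul (a j) f) = f" by (simp only: mul_mul[OF ebdd_b ebdd_a] 1 mul_one)
qed

lemma mul_aa: "mul (a j) (mul (a j) f) = mul (h j) f"
proof -
  have "(\<lambda>x. a j x * a j x) = h j" using h_pos by (auto simp: a_def fun_eq_iff less_imp_le)
  then show ?thesis by (simp only: mul_mul[OF ebdd_a ebdd_a])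
qed

lemma mul_hb: "mul (h j) (mul (b j) f) = mul (a j) f"
  by (simp add: mul_aa[symmetric])

text \<open>The divergence is tested against all of \<open>H1\<close> instead of test functions only. This makes the generator
  skew-symmetric without any density of test functions in \<open>H1\<close>.\<close>

definition is_div :: "('n \<Rightarrow> 'n l2) \<Rightarrow> 'n l2 \<Rightarrow> bool" where
  "is_div q d \<longleftrightarrow> (\<forall>\<phi> \<phi>'. (\<forall>j. wd j \<phi> (\<phi>' j)) \<longrightarrow> (\<Sum>j\<in>UNIV. q j \<bullet> \<phi>' j) = - (d \<bullet> \<phi>))"

text \<open>The graph of the operator that sends \<open>(v, q)\<close> to
  \<open>(div (a q), a grad v)\<close>. The second component is stated as
  \<open>grad v = b r\<close>, which passes to limits because \<open>b\<close> is a bounded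
  multiplier.\<close>

definition G :: "(('n l2 \<times> ('n l2 ^ 'n)) \<times> ('n l2 \<times> ('n l2 ^ 'n))) set" where
  "G = {((v, q), (d, r)). (\<forall>j. wd j v (mul (b j) (r $ j))) \<and> is_div (\<lambda>j. mul (a j) (q $ j)) d}"

lemma G_iff: "((v, q), (d, r)) \<in> G \<longleftrightarrow> (\<forall>j. wd j v (mul (b j) (r $ j))) \<and> is_div (\<lambda>j. mul (a j) (q $ j)) d"
  by (simp add: G_def)

lemma is_divD: "is_div q d \<Longrightarrow> (\<And>j. wd j \<phi> (\<phi>' j)) \<Longrightarrow> (\<Sum>j\<in>UNIV. q j \<bullet> \<phi>' j) = - (d \<bullet> \<phi>)"
  unfolding is_div_def by blast

lemma is_divI: "(\<And>\<phi> \<phi>'. (\<And>j. wd j \<phi> (\<phi>' j)) \<Longrightarrow> (\<Sum>j\<in>UNIV. q j \<bullet> \<phi>' j) = - (d \<bullet> \<phi>)) \<Longrightarrow> is_div q d"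
  unfolding is_div_def by blast

lemma is_div_add:
  assumes "is_div q d" "is_div q' d'" shows "is_div (\<lambda>j. q j + q' j) (d + d')"
proof (rule is_divI)
  fix \<phi> \<phi>' assume w: "\<And>j. wd j \<phi> (\<phi>' j :: 'n l2)"
  show "(\<Sum>j\<in>UNIV. (q j + q' j) \<bullet> \<phi>' j) = - ((d + d') \<bullet> \<phi>)"
    using is_divD[OF assms(1) w] is_divD[OF assms(2) w] by (simp add: inner_add_left sum.distrib)
qed

lemma is_div_scale:
  assumes "is_div q d" shows "is_div (\<lambda>j. s *\<^sub>R q j) (s *\<^sub>R d)"
proof (rule is_divI)
  fix \<phi> \<phi>' assume w: "\<And>j. wd j \<phi> (\<phi>' j :: 'n l2)"
  show "(\<Sum>j\<in>UNIV. (s *\<^sub>R q j) \<bullet> \<phi>' j) = - ((s *\<^sub>R d) \<bullet> \<phi>)"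
    using is_divD[OF assms w] by (simp add: sum_distrib_left[symmetric])
qed

lemma is_div_diff:
  assumes "is_div q d" "is_div q' d'" shows "is_div (\<lambda>j. q j - q' j) (d - d')"
  using is_div_add[OF assms(1) is_div_scale[OF assms(2), of "-1"]] by simp

lemma G_subspace: "subspace G"
proof (rule subspaceI)
  show "0 \<in> G"
    by (simp add: zero_prod_def G_iff mul_zero ebdd_a ebdd_b wd_zero is_div_def)
  show "x + y \<in> G" if "x \<in> G" "y \<in> G" for x y
  proof -
    obtain v q d r v' q' d' r' where e: "x = ((v, q), (d, r))" "y = ((v', q'), (d', r'))"
      by (metis surj_pair)
    show ?thesis using that unfolding e
      by (auto simp: G_iff mul_add ebdd_a ebdd_b intro!: wd_add is_div_add)
  qed
  show "s *\<^sub>R x \<in> G" if "x \<in> G" for s x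
  proof -
    obtain v q d r where e: "x = ((v, q), (d, r))" by (metis surj_pair)
    show ?thesis using that unfolding e
      by (auto simp: G_iff mul_scale ebdd_a ebdd_b intro!: wd_scale is_div_scale)
  qed
qed

lemma tendsto_mul: "ebdd m \<Longrightarrow> (f \<longlongrightarrow> l) F \<Longrightarrow> ((\<lambda>x. mul m (f x)) \<longlongrightarrow> mul m l) F"
  by (rule bounded_linear.tendsto[OF mul_bounded_linear])

lemma G_closed: "closed G"
  unfolding closed_sequential_limits
proof (intro allI impI, elim conjE)
  fix x l assume xG: "\<forall>n. x n \<in> G" and lim: "x \<longlonglongrightarrow> l"
  obtain v q d r where l: "l = ((v, q), (d, r))" by (metis surj_pair)
  define vn qn dn rn where "vn n = fst (fst (x n))" and "qn n = snd (fst (x n))"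
    and "dn n = fst (snd (x n))" and "rn n = snd (snd (x n))" for n
  have x: "x n = ((vn n, qn n), (dn n, rn n))" for n by (simp add: vn_def qn_def dn_def rn_def)
  have lims: "vn \<longlonglongrightarrow> v" "qn \<longlonglongrightarrow> q" "dn \<longlonglongrightarrow> d" "rn \<longlonglongrightarrow> r"
    using tendsto_fst[OF lim] tendsto_snd[OF lim]
    unfolding vn_def qn_def dn_def rn_def l by (auto dest: tendsto_fst tendsto_snd)
  have g: "\<And>n j. wd j (vn n) (mul (b j) (rn n $ j))" "\<And>n. is_div (\<lambda>j. mul (a j) (qn n $ j)) (dn n)"
    using xG unfolding x G_iff by auto
  have "wd j v (mul (b j) (r $ j))" for j
    by (rule wd_closed[OF g(1) lims(1)]) (intro tendsto_mul ebdd_b tendsto_vec_nth lims)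
  moreover have "is_div (\<lambda>j. mul (a j) (q $ j)) d"
  proof (rule is_divI)
    fix \<phi> \<phi>' assume "\<And>j. wd j \<phi> (\<phi>' j :: 'n l2)"
    then have "(\<Sum>j\<in>UNIV. mul (a j) (qn n $ j) \<bullet> \<phi>' j) = - (dn n \<bullet> \<phi>)" for n by (rule is_divD[OF g(2)])
    moreover have "(\<lambda>n. \<Sum>j\<in>UNIV. mul (a j) (qn n $ j) \<bullet> \<phi>' j) \<longlonglongrightarrow> (\<Sum>j\<in>UNIV. mul (a j) (q $ j) \<bullet> \<phi>' j)"
      by (intro tendsto_sum tendsto_inner tendsto_const tendsto_mul ebdd_a tendsto_vec_nth lims)
    moreover have "(\<lambda>n. - (dn n \<bullet> \<phi>)) \<longlonglongrightarrow> - (d \<bullet> \<phi>)" by (intro tendsto_intros lims)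
    ultimately show "(\<Sum>j\<in>UNIV. mul (a j) (q $ j) \<bullet> \<phi>' j) = - (d \<bullet> \<phi>)"
      using LIMSEQ_unique by (simp only:)
  qed
  ultimately show "l \<in> G" by (simp add: l G_iff)
qed

text \<open>\<open>v\<close> itself is admissible as \<open>\<phi>\<close> in \<open>is_div\<close>,
  with gradient \<open>b r\<close>; the weights \<open>a\<close> and \<open>b\<close> then
  cancel.\<close>

lemma G_skew: "((v, q), (d, r)) \<in> G \<Longrightarrow> (v, q) \<bullet> (d, r) = 0"
proof -
  assume "((v, q), (d, r)) \<in> G"
  then have g: "\<And>j. wd j v (mul (b j) (r $ j))" "is_div (\<lambda>j. mul (a j) (q $ j)) d" by (auto simp: G_iff)
  have "(\<Sum>j\<in>UNIV. mul (a j) (q $ j) \<bullet> mul (b j) (r $ j)) = - (d \<bullet> v)" by (rule is_divD[OF g(2,1)])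
  moreover have "mul (a j) (q $ j) \<bullet> mul (b j) (r $ j) = q $ j \<bullet> r $ j" for j
    by (simp add: mul_inner[OF ebdd_a])
  ultimately show ?thesis by (simp add: inner_vec_eq inner_commute)
qed

lemma is_div_zero_imp_zero: "is_div (\<lambda>j. 0) d \<Longrightarrow> d = 0"
proof (rule eq_testI)
  fix \<phi> :: "real ^ 'n \<Rightarrow> real" assume d: "is_div (\<lambda>j. 0) d" and \<phi>: "\<phi> \<in> test_functions"
  show "d \<bullet> to_l2 \<phi> = 0 \<bullet> to_l2 \<phi>"
    using is_divD[OF d, of "to_l2 \<phi>" "\<lambda>j. to_l2 (partial j \<phi>)"] test_wd[OF \<phi>] by simp
qed

text \<open>Skew-adjointness: a vector \<open>z\<close> orthogonal to the range turns out to lie in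
  the domain of \<open>G\<close> with image \<open>- z / s\<close>, and skewness forces
  \<open>z = 0\<close>. The divergence half comes from testing with states
  \<open>(\<phi>, 0)\<close>, the gradient half from states \<open>(0, q)\<close>.\<close>

lemma G_orthogonal:
  assumes s: "s > 0" and orth: "\<And>x y. (x, y) \<in> G \<Longrightarrow> (x - s *\<^sub>R y) \<bullet> z = 0"
  shows "z = 0"
proof -
  obtain w p where z: "z = (w, p)" by (metis surj_pair)
  have "is_div (\<lambda>j. mul (a j) (p $ j)) ((- (1 / s)) *\<^sub>R w)"
  proof (rule is_divI)
    fix \<phi> \<phi>' assume wd: "\<And>j. wd j \<phi> (\<phi>' j :: 'n l2)"
    have symm: "mul (a j) (p $ j) \<bullet> \<phi>' j = mul (a j) (\<phi>' j) \<bullet> p $ j" for j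
      unfolding mul_inner[OF ebdd_a, of j "p $ j"] by (rule inner_commute)
    have "((\<phi>, 0), (0, \<chi> j. mul (a j) (\<phi>' j))) \<in> G"
      using wd by (simp add: G_iff mul_zero ebdd_a is_div_def)
    from orth[OF this] have "\<phi> \<bullet> w = s * (\<Sum>j\<in>UNIV. mul (a j) (\<phi>' j) \<bullet> p $ j)"
      by (simp add: z inner_vec_eq sum_distrib_left sum_negf)
    then show "(\<Sum>j\<in>UNIV. mul (a j) (p $ j) \<bullet> \<phi>' j) = - (((- (1 / s)) *\<^sub>R w) \<bullet> \<phi>)"
      using s symm by (simp add: inner_commute)
  qed
  moreover have "wd j w (mul (b j) (((- (1 / s)) *\<^sub>R p) $ j))" for j
    unfolding wd_def
  proof
    fix \<phi> :: "real ^ 'n \<Rightarrow> real" assume \<phi>: "\<phi> \<in> test_functions"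
    \<comment> \<open>Concentrated in direction \<open>j\<close> and weighted by \<open>b\<close>,
      so that the divergence of \<open>a q\<close> is just \<open>partial j \<phi>\<close>.\<close>
    define q where "q = (\<chi> i. if i = j then mul (b j) (to_l2 \<phi>) else 0)"
    have aq: "mul (a i) (q $ i) = (if i = j then to_l2 \<phi> else 0)" for i
      by (simp add: q_def mul_zero ebdd_a)
    have "is_div (\<lambda>i. mul (a i) (q $ i)) (to_l2 (partial j \<phi>))"
    proof (rule is_divI)
      fix \<eta> \<eta>' assume "\<And>j. wd j \<eta> (\<eta>' j :: 'n l2)"
      from integration_by_parts[OF test_wd[OF \<phi>] this]
      show "(\<Sum>i\<in>UNIV. mul (a i) (q $ i) \<bullet> \<eta>' i) = - (to_l2 (partial j \<phi>) \<bullet> \<eta>)"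
        unfolding aq by (simp add: if_distrib[of "\<lambda>x. x \<bullet> _"] cong: if_cong)
    qed
    then have "((0, q), (to_l2 (partial j \<phi>), 0)) \<in> G" by (simp add: G_iff mul_zero ebdd_b wd_zero)
    from orth[OF this] have e: "q \<bullet> p = s * (to_l2 (partial j \<phi>) \<bullet> w)" by (simp add: z)
    have "w \<bullet> to_l2 (partial j \<phi>) = (1 / s) * (q \<bullet> p)"
      unfolding e using s by (simp add: inner_commute)
    moreover have "q \<bullet> p = mul (b j) (to_l2 \<phi>) \<bullet> p $ j"
      unfolding inner_vec_eq q_def by (simp add: if_distrib[of "\<lambda>x. x \<bullet> _"] cong: if_cong)
    moreover have "mul (b j) (to_l2 \<phi>) \<bullet> p $ j = mul (b j) (p $ j) \<bullet> to_l2 \<phi>"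
      unfolding mul_inner[OF ebdd_b, of j "p $ j"] by (rule inner_commute)
    ultimately have "w \<bullet> to_l2 (partial j \<phi>) = (1 / s) * (mul (b j) (p $ j) \<bullet> to_l2 \<phi>)"
      by (simp only:)
    then show "w \<bullet> to_l2 (partial j \<phi>) = - (mul (b j) (((- (1 / s)) *\<^sub>R p) $ j) \<bullet> to_l2 \<phi>)"
      by (simp only: vector_scaleR_component mul_scale[OF ebdd_b]) simp
  qed
  ultimately have "((w, p), ((- (1 / s)) *\<^sub>R w, (- (1 / s)) *\<^sub>R p)) \<in> G" by (simp add: G_iff)
  from G_skew[OF this] have "z \<bullet> ((- (1 / s)) *\<^sub>R z) = 0" by (simp only: z scaleR_Pair)
  then show "z = 0" using s by simp
qed

lemma generator: "contraction_generator G"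
proof (rule contraction_generatorI[OF G_subspace G_closed])
  show "x \<bullet> y = 0" if "(x, y) \<in> G" for x y
    using that G_skew by (metis surj_pair)
  show "z = 0" if "s > 0" "\<And>x y. (x, y) \<in> G \<Longrightarrow> (x - s *\<^sub>R y) \<bullet> z = 0" for s z
    using that by (rule G_orthogonal)
  show "y = 0" if "(0, y) \<in> G" for y
  proof -
    obtain d r where y: "y = (d, r)" by (metis surj_pair)
    have g: "\<And>j. wd j 0 (mul (b j) (r $ j))" "is_div (\<lambda>j. 0) d"
      using that by (auto simp: y zero_prod_def G_iff mul_zero ebdd_a)
    have "mul (b j) (r $ j) = 0" for j using wd_unique[OF g(1) wd_zero] .
    then have "mul (a j) (mul (b j) (r $ j)) = 0" for j by (simp only: mul_zero[OF ebdd_a])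
    then have "r = 0" by (simp add: vec_eq_iff)
    then show ?thesis using is_div_zero_imp_zero[OF g(2)] by (simp add: y zero_prod_def)
  qed
qed

end

lemma norm_vec_le_sum: "norm (q :: 'a::real_normed_vector ^ 'n) \<le> (\<Sum>j\<in>UNIV. norm (q $ j))"
  unfolding norm_vec_def by (rule L2_set_le_sum) simp

section \<open>Lipschitz coefficients and the solution as a curve of classes\<close>

locale wave_lipschitz = wave \<psi> h c for \<psi> :: "real ^ 'n::finite \<Rightarrow> real" and h c +
  fixes h' :: "'n \<Rightarrow> 'n \<Rightarrow> real ^ 'n \<Rightarrow> real" and L M :: real
  assumes wp: "\<And>j k. has_weak_partial k (h j) (h' j k)"
    and L: "\<And>j k. AE x in lborel. \<bar>h' j k x\<bar> \<le> L" "L \<ge> 0"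
    and M: "\<And>j. AE x in lborel. \<bar>h j x\<bar> \<le> M" "M \<ge> 0"
begin

lemma ebdd_h': "ebdd (h' j k)"
proof (rule ebddI)
  show "h' j k \<in> borel_measurable borel"
    using wp locally_integrable_measurable unfolding has_weak_partial_def by blast
qed (rule L)

text \<open>The crude factor \<open>1 + M\<close> in place of \<open>sqrt M\<close> keeps every
  later constant polynomial in \<open>M\<close>.\<close>

lemma norm_mul_a_le: "norm (mul (a j) f) \<le> (1 + M) * norm f"
proof (rule norm_mul_le[OF ebdd_a])
  show "AE x in lborel. \<bar>a j x\<bar> \<le> 1 + M"
    using M(1)[of j]
  proof eventually_elim
    case (elim x)
    have "sqrt (h j x) \<le> sqrt ((1 + M)\<^sup>2)"
    proof (rule real_sqrt_le_mono)
      have "h j x \<le> 1 + M" using elim by linarith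
      also have "\<dots> \<le> (1 + M)\<^sup>2" using M(2) by (simp add: power2_eq_square)
      finally show "h j x \<le> (1 + M)\<^sup>2" .
    qed
    then show ?case using M(2) h_pos[of j x] by (simp add: a_def)
  qed
qed (use M in simp)

lemma norm_mul_b_le: "norm (mul (b j) f) \<le> norm f / sqrt c"
  using norm_mul_le[OF ebdd_b, of j "1 / sqrt c" f] b_bound c by simp

text \<open>Serves twice: at time 0 it places the data in the domain of the generator, and at later
  times, together with \<open>is_div_unique\<close>, it identifies \<open>w\<close> with the
  differentiated form of the divergence.\<close>

lemma is_div_mul:
  assumes "\<And>j. wd j (p j) (s j)"
  shows "is_div (\<lambda>j. mul (h j) (p j)) (\<Sum>j\<in>UNIV. mul (h j) (s j) + mul (h' j j) (p j))"
proof (rule is_divI)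
  fix \<phi> \<phi>' assume \<phi>: "\<And>j. wd j \<phi> (\<phi>' j :: 'n l2)"
  have "mul (h j) (p j) \<bullet> \<phi>' j = - ((mul (h j) (s j) + mul (h' j j) (p j)) \<bullet> \<phi>)" for j
    using integration_by_parts[OF wd_mul[OF h wp ebdd_h' assms] \<phi>, of j] by simp
  then show "(\<Sum>j\<in>UNIV. mul (h j) (p j) \<bullet> \<phi>' j) = - ((\<Sum>j\<in>UNIV. mul (h j) (s j) + mul (h' j j) (p j)) \<bullet> \<phi>)"
    by (simp add: inner_sum_left sum_negf)
qed

lemma is_div_unique:
  assumes "is_div q d" "is_div q d'" shows "d = d'"
proof -
  have "is_div (\<lambda>j. 0) (d - d')" using is_div_diff[OF assms] by simp
  then have "d - d' = 0" by (rule is_div_zero_imp_zero)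
  then show ?thesis by simp
qed

text \<open>\<open>A\<close> and \<open>B\<close> bound the initial state and its image under the
  generator, that is, the state and its time derivative at time 0. The contraction preserves both
  bounds, and the elliptic estimate converts them into bounds on second derivatives.\<close>

theorem wave_solution:
  assumes T: "T > 0" and p0: "\<And>j. wd j u0 (p0 j)" and s0: "\<And>j k. wd k (p0 j) (s0 j k)"
    and p1: "\<And>j. wd j u1 (p1 j)"
  defines "A \<equiv> norm u1 + (1 + M) * (\<Sum>j\<in>UNIV. norm (p0 j))"
    and "B \<equiv> (\<Sum>j\<in>UNIV. M * norm (s0 j j) + L * norm (p0 j)) + (1 + M) * (\<Sum>j\<in>UNIV. norm (p1 j))"
  obtains u v w :: "real \<Rightarrow> 'n l2" and p r s where
    "u 0 = u0" "v 0 = u1"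
    "\<And>t. t \<in> {0..T} \<Longrightarrow> (u has_vector_derivative v t) (at t within {0..T})"
    "\<And>t. t \<in> {0..T} \<Longrightarrow> (v has_vector_derivative w t) (at t within {0..T})"
    "continuous_on {0..T} w"
    "\<And>t j. t \<in> {0..T} \<Longrightarrow> ((\<lambda>t. p t j) has_vector_derivative r t j) (at t within {0..T})"
    "\<And>j. continuous_on {0..T} (\<lambda>t. r t j)"
    "\<And>t j. t \<in> {0..T} \<Longrightarrow> wd j (u t) (p t j)"
    "\<And>t j. t \<in> {0..T} \<Longrightarrow> wd j (v t) (r t j)"
    "\<And>t j k. t \<in> {0..T} \<Longrightarrow> wd k (p t j) (s t j k)"
    "\<And>j k. continuous_on {0..T} (\<lambda>t. s t j k)"
    "\<And>t. t \<in> {0..T} \<Longrightarrow> w t = (\<Sum>j\<in>UNIV. mul (h j) (s t j j) + mul (h' j j) (p t j))"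
    "\<And>t. t \<in> {0..T} \<Longrightarrow> norm (u t) \<le> norm u0 + A * T"
    "\<And>t j. t \<in> {0..T} \<Longrightarrow> norm (p t j) \<le> A / sqrt c"
    "\<And>t j k. t \<in> {0..T} \<Longrightarrow> norm (s t j k) \<le> (B + L * (real CARD('n) * (A / sqrt c))) / c"
proof -
  note thesisI = that
  \<comment> \<open>The value of the second time derivative at time 0, read off from the equation;
    here two derivatives of \<open>u0\<close> and one of the coefficients are spent.\<close>
  define d0 where "d0 = (\<Sum>j\<in>UNIV. mul (h j) (s0 j j) + mul (h' j j) (p0 j))"
  define x0 where "x0 = (u1, \<chi> j. mul (a j) (p0 j))"
  define y0 where "y0 = (d0, \<chi> j. mul (a j) (p1 j))"
  have "(x0, y0) \<in> G"
    unfolding x0_def y0_def G_iff d0_def using p1 is_div_mul[OF s0] by (simp add: mul_aa)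
  note xy0 = this
  obtain X Y where XY: "X 0 = x0" "\<And>t. t \<in> {0..T} \<Longrightarrow> (X t, Y t) \<in> G"
    "\<And>t. t \<in> {0..T} \<Longrightarrow> (X has_vector_derivative Y t) (at t within {0..T})"
    "continuous_on {0..T} Y"
    "\<And>t. t \<in> {0..T} \<Longrightarrow> norm (X t) \<le> norm x0" "\<And>t. t \<in> {0..T} \<Longrightarrow> norm (Y t) \<le> norm y0"
  proof (rule contraction_generator.hille_yosida[OF generator T xy0])
    fix X Y
    assume "X 0 = x0" "\<And>t. t \<in> {0..T} \<Longrightarrow> (X t, Y t) \<in> G"
      "\<And>t. t \<in> {0..T} \<Longrightarrow> (X has_vector_derivative Y t) (at t within {0..T})"
      "continuous_on {0..T} Y"
      "\<And>t. t \<in> {0..T} \<Longrightarrow> norm (X t) \<le> norm x0" "\<And>t. t \<in> {0..T} \<Longrightarrow> norm (Y t) \<le> norm y0"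
    then show thesis by (rule that)
  qed
  have x0A: "norm x0 \<le> A"
  proof -
    have "norm x0 \<le> norm u1 + norm (\<chi> j. mul (a j) (p0 j))" unfolding x0_def by (rule norm_Pair_le)
    also have "norm (\<chi> j. mul (a j) (p0 j)) \<le> (\<Sum>j\<in>UNIV. norm ((\<chi> j. mul (a j) (p0 j)) $ j))"
      by (rule norm_vec_le_sum)
    also have "\<dots> \<le> (\<Sum>j\<in>UNIV. (1 + M) * norm (p0 j))" by (rule sum_mono) (simp add: norm_mul_a_le)
    finally show ?thesis by (simp add: A_def sum_distrib_left)
  qed
  have y0B: "norm y0 \<le> B"
  proof -
    have "norm d0 \<le> (\<Sum>j\<in>UNIV. M * norm (s0 j j) + L * norm (p0 j))"
      unfolding d0_def
      by (intro order_trans[OF norm_sum] sum_mono order_trans[OF norm_triangle_ineq] add_mono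
          norm_mul_le h ebdd_h' M L)
    moreover have "norm y0 \<le> norm d0 + norm (\<chi> j. mul (a j) (p1 j))" unfolding y0_def by (rule norm_Pair_le)
    moreover have "norm (\<chi> j. mul (a j) (p1 j)) \<le> (\<Sum>j\<in>UNIV. norm ((\<chi> j. mul (a j) (p1 j)) $ j))"
      by (rule norm_vec_le_sum)
    moreover have "\<dots> \<le> (\<Sum>j\<in>UNIV. (1 + M) * norm (p1 j))" by (rule sum_mono) (simp add: norm_mul_a_le)
    ultimately show ?thesis by (simp add: B_def sum_distrib_left)
  qed
  define v w where "v t = fst (X t)" and "w t = fst (Y t)" for t
  define q r where "q t j = snd (X t) $ j" and "r t j = mul (b j) (snd (Y t) $ j)" for t j
  \<comment> \<open>The candidate for the gradient of \<open>u\<close>, recovered from the weighted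
    unknown.\<close>
  define p where "p t j = mul (b j) (q t j)" for t j
  have G1: "wd j (v t) (r t j)" and G2: "is_div (\<lambda>j. mul (a j) (q t j)) (w t)" if "t \<in> {0..T}" for t j
    using XY(2)[OF that] G_iff[of "fst (X t)" "snd (X t)" "fst (Y t)" "snd (Y t)"]
    by (auto simp: v_def w_def q_def r_def)
  have vder: "(v has_vector_derivative w t) (at t within {0..T})" if "t \<in> {0..T}" for t
    unfolding v_def w_def by (rule bounded_linear.has_vector_derivative[OF bounded_linear_fst XY(3)[OF that]])
  have bl: "bounded_linear (\<lambda>x :: 'n l2 \<times> ('n l2 ^ 'n). mul (b j) (snd x $ j))" for j
    by (intro bounded_linear_compose[OF mul_bounded_linear[OF ebdd_b]]
        bounded_linear_compose[OF bounded_linear_vec_nth] bounded_linear_snd)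
  have pder: "((\<lambda>t. p t j) has_vector_derivative r t j) (at t within {0..T})" if "t \<in> {0..T}" for t j
    unfolding p_def q_def r_def by (rule bounded_linear.has_vector_derivative[OF bl XY(3)[OF that]])
  have wcont: "continuous_on {0..T} w" unfolding w_def by (intro continuous_on_fst XY(4))
  have rcont: "continuous_on {0..T} (\<lambda>t. r t j)" for j
    unfolding r_def by (rule bounded_linear.continuous_on[OF bl XY(4)])
  have vcont: "continuous_on {0..T} v" by (rule continuous_on_vector_derivative[OF vder])
  have pcont: "continuous_on {0..T} (\<lambda>t. p t j)" for j by (rule continuous_on_vector_derivative[OF pder])
  \<comment> \<open>The first-order system contains only \<open>v\<close> and the weighted gradient;
    \<open>u\<close> is restored by integration in time.\<close>
  define u where "u t = u0 + integral {0..t} v" for t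
  have uder: "(u has_vector_derivative v t) (at t within {0..T})" if "t \<in> {0..T}" for t
    unfolding u_def using integral_has_vector_derivative[OF vcont that]
    by (simp add: has_vector_derivative_add_const add.commute[of u0])
  have u_0: "u 0 = u0" by (simp add: u_def)
  have vb: "norm (v t) \<le> A" if "t \<in> {0..T}" for t
    using norm_fst_le[of "fst (X t)" "snd (X t)"] XY(5)[OF that] x0A by (simp add: v_def)
  have wb: "norm (w t) \<le> B" if "t \<in> {0..T}" for t
    using norm_fst_le[of "fst (Y t)" "snd (Y t)"] XY(6)[OF that] y0B by (simp add: w_def)
  have pb: "norm (p t j) \<le> A / sqrt c" if "t \<in> {0..T}" for t j
  proof -
    have "norm (q t j) \<le> norm (snd (X t))" unfolding q_def by (rule Finite_Cartesian_Product.norm_nth_le)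
    also have "\<dots> \<le> norm (X t)" using norm_snd_le[of "snd (X t)" "fst (X t)"] by simp
    also have "\<dots> \<le> A" using XY(5)[OF that] x0A by linarith
    finally have "norm (q t j) / sqrt c \<le> A / sqrt c" using c by (intro divide_right_mono) auto
    then show ?thesis using norm_mul_b_le[of j "q t j"] by (simp add: p_def)
  qed
  have uwd: "wd j (u t) (p t j)" if t: "t \<in> {0..T}" for t j
    unfolding wd_def
  proof
    fix \<phi> :: "real ^ 'n \<Rightarrow> real" assume \<phi>: "\<phi> \<in> test_functions"
    \<comment> \<open>The defect in the weak derivative identity. It vanishes at time 0, and its
      time derivative vanishes because \<open>r\<close>, the time derivative of \<open>p\<close>, is
      the gradient of \<open>v\<close>.\<close>
    define F where "F t = u t \<bullet> to_l2 (partial j \<phi>) + p t j \<bullet> to_l2 \<phi>" for t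
    have Fder: "(F has_vector_derivative 0) (at s within {0..T})" if "s \<in> {0..T}" for s
    proof -
      have "(F has_vector_derivative v s \<bullet> to_l2 (partial j \<phi>) + r s j \<bullet> to_l2 \<phi>) (at s within {0..T})"
        unfolding F_def
        by (intro has_vector_derivative_add bounded_linear.has_vector_derivative[OF bounded_linear_inner_left]
            uder pder that)
      then show ?thesis using wd_D[OF G1[OF that] \<phi>, of j] by simp
    qed
    have "norm (F t - F 0) \<le> 0 * \<bar>t - 0\<bar>"
      by (rule has_vector_derivative_bound[OF _ Fder]) (use T t in auto)
    moreover have "F 0 = 0"
      using wd_D[OF p0 \<phi>, of j] by (simp add: F_def u_0 p_def q_def XY(1) x0_def)
    ultimately show "u t \<bullet> to_l2 (partial j \<phi>) = - (p t j \<bullet> to_l2 \<phi>)" by (simp add: F_def)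
  qed
  have weak: "is_div (\<lambda>j. mul (h j) (p t j)) (w t)" if "t \<in> {0..T}" for t
    using G2[OF that] by (simp add: p_def mul_hb)
  have reg: "\<exists>s. wd k (p t j) s \<and> norm s \<le> (norm (w t) + L * (\<Sum>i\<in>UNIV. norm (p t i))) / c"
    if "t \<in> {0..T}" for t j k
    by (rule elliptic_regularity[OF uwd[OF that] h c hc wp L is_divD[OF weak[OF that]], of k j]) blast+
  \<comment> \<open>Chosen without a norm bound; by uniqueness of weak derivatives every bound
    proved for some derivative holds for this one.\<close>
  define s where "s t j k = (SOME s. wd k (p t j) s)" for t j k
  have swd: "wd k (p t j) (s t j k)" if "t \<in> {0..T}" for t j k
    unfolding s_def using someI_ex[of "wd k (p t j)"] reg[OF that] by blast
  have sb: "norm (s t j k) \<le> (norm (w t) + L * (\<Sum>i\<in>UNIV. norm (p t i))) / c" if "t \<in> {0..T}" for t j k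
    using reg[OF that] wd_unique[OF swd[OF that]] by metis
  have sb': "norm (s t j k) \<le> (B + L * (real CARD('n) * (A / sqrt c))) / c" if "t \<in> {0..T}" for t j k
  proof -
    have "(\<Sum>i\<in>UNIV. norm (p t i)) \<le> (\<Sum>i\<in>(UNIV :: 'n set). A / sqrt c)" by (intro sum_mono pb that)
    also have "\<dots> = real CARD('n) * (A / sqrt c)" by simp
    finally have "(norm (w t) + L * (\<Sum>i\<in>UNIV. norm (p t i))) / c \<le> (B + L * (real CARD('n) * (A / sqrt c))) / c"
      using c L(2) by (intro divide_right_mono add_mono mult_left_mono wb that) auto
    then show ?thesis using sb[OF that, of j k] by linarith
  qed
  have scont: "continuous_on {0..T} (\<lambda>t. s t j k)" for j k
    unfolding continuous_on_def
  proof
    fix t assume t: "t \<in> {0..T}"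
    \<comment> \<open>The regularity estimate is applied to the difference of the solutions at two
      times, which satisfies the same linear elliptic problem; continuity of \<open>w\<close> and
      \<open>p\<close> thereby carries over to \<open>s\<close>.\<close>
    have diff: "norm (s \<tau> j k - s t j k) \<le> (norm (w \<tau> - w t) + L * (\<Sum>i\<in>UNIV. norm (p \<tau> i - p t i))) / c"
      if \<tau>: "\<tau> \<in> {0..T}" for \<tau>
    proof -
      have weak': "is_div (\<lambda>j. mul (h j) (p \<tau> j - p t j)) (w \<tau> - w t)"
        using is_div_diff[OF weak[OF \<tau>] weak[OF t]] by (simp add: mul_diff h)
      have "\<exists>q. wd k (p \<tau> j - p t j) q \<and> norm q \<le> (norm (w \<tau> - w t) + L * (\<Sum>i\<in>UNIV. norm (p \<tau> i - p t i))) / c"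
        by (rule elliptic_regularity[OF wd_diff[OF uwd[OF \<tau>] uwd[OF t]] h c hc wp L is_divD[OF weak'], of k j]) blast+
      then show ?thesis using wd_unique[OF wd_diff[OF swd[OF \<tau>] swd[OF t]]] by metis
    qed
    have "((\<lambda>\<tau>. s \<tau> j k - s t j k) \<longlongrightarrow> 0) (at t within {0..T})"
    proof (rule Lim_null_comparison)
      show "\<forall>\<^sub>F \<tau> in at t within {0..T}. norm (s \<tau> j k - s t j k)
          \<le> (norm (w \<tau> - w t) + L * (\<Sum>i\<in>UNIV. norm (p \<tau> i - p t i))) / c"
        unfolding eventually_at_filter using diff by simp
      have wl: "((\<lambda>\<tau>. w \<tau>) \<longlongrightarrow> w t) (at t within {0..T})" using wcont t by (simp add: continuous_on_def)
      have pl: "((\<lambda>\<tau>. p \<tau> i) \<longlongrightarrow> p t i) (at t within {0..T})" for i using pcont t by (simp add: continuous_on_def)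
      have "((\<lambda>\<tau>. (norm (w \<tau> - w t) + L * (\<Sum>i\<in>UNIV. norm (p \<tau> i - p t i))) / c)
          \<longlongrightarrow> (norm (w t - w t) + L * (\<Sum>i\<in>UNIV. norm (p t i - p t i))) / c) (at t within {0..T})"
        using c by (intro tendsto_intros wl pl) simp
      then show "((\<lambda>\<tau>. (norm (w \<tau> - w t) + L * (\<Sum>i\<in>UNIV. norm (p \<tau> i - p t i))) / c) \<longlongrightarrow> 0) (at t within {0..T})"
        by simp
    qed
    then show "((\<lambda>\<tau>. s \<tau> j k) \<longlongrightarrow> s t j k) (at t within {0..T})" by (simp add: LIM_zero_iff)
  qed
  have ub: "norm (u t) \<le> norm u0 + A * T" if t: "t \<in> {0..T}" for t
  proof -
    have "norm (u t - u 0) \<le> A * \<bar>t - 0\<bar>"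
      by (rule has_vector_derivative_bound[OF _ uder vb]) (use T t in auto)
    also have "\<dots> \<le> A * T"
      using t order_trans[OF norm_ge_zero vb[OF t]] by (intro mult_left_mono) auto
    finally show ?thesis using norm_triangle_sub[of "u t" u0] by (simp add: u_0)
  qed
  have eqn: "w t = (\<Sum>j\<in>UNIV. mul (h j) (s t j j) + mul (h' j j) (p t j))" if "t \<in> {0..T}" for t
    by (rule is_div_unique[OF weak[OF that] is_div_mul[OF swd[OF that]]])
  have v_0: "v 0 = u1" by (simp add: v_def XY(1) x0_def)
  show thesis
    by (rule thesisI[OF u_0 v_0 uder vder wcont pder rcont uwd G1 swd scont eqn ub pb sb'])
qed

end

section \<open>Strong solutions with Sobolev data\<close>

lemma wpartial_has_weak_partial: "weakly_differentiable i f \<Longrightarrow> has_weak_partial i f (wpartial i f)"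
proof -
  assume "weakly_differentiable i f"
  then obtain g where "has_weak_partial i f g" unfolding weakly_differentiable_def ..
  then show "has_weak_partial i f (wpartial i f)" unfolding wpartial_def by (rule someI[of "has_weak_partial i f"])
qed

lemma to_l2_sum: "(\<And>j. j \<in> S \<Longrightarrow> f j \<in> L2) \<Longrightarrow> finite S \<Longrightarrow>
    (\<lambda>x. \<Sum>j\<in>S. f j x) \<in> L2 \<and> to_l2 (\<lambda>x. \<Sum>j\<in>S. f j x) = (\<Sum>j\<in>S. to_l2 (f j))"
proof (induction S rule: infinite_finite_induct)
  case (insert j S)
  then have *: "f j \<in> L2" "(\<lambda>x. \<Sum>j\<in>S. f j x) \<in> L2"
    "to_l2 (\<lambda>x. \<Sum>j\<in>S. f j x) = (\<Sum>j\<in>S. to_l2 (f j))" by auto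
  then show ?case using insert.hyps to_l2_add[OF *(1,2)] L2_add[OF *(1,2)] by simp
qed (auto simp: L2_zero to_l2_zero)

lemma L2_AE_cong:
  assumes "f \<in> L2" "g \<in> borel_measurable borel" "AE x in lborel. g x = f x"
  shows "g \<in> L2"
proof -
  have [measurable]: "f \<in> borel_measurable borel" "g \<in> borel_measurable borel" using assms L2_D by auto
  have "integrable lborel (\<lambda>x. (g x)\<^sup>2) \<longleftrightarrow> integrable lborel (\<lambda>x. (f x)\<^sup>2)"
    by (rule integrable_cong_AE) (use assms(3) in auto)
  then show ?thesis using assms L2_D by (auto simp: L2_def)
qed

text \<open>The coefficient of the Laplacian, to which the elliptic estimate is later applied with
  \<open>L = 0\<close>.\<close>

lemma has_weak_partial_one: "has_weak_partial i (\<lambda>x. 1) (\<lambda>x. 0)"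
  unfolding has_weak_partial_def
proof (intro conjI ballI)
  show "locally_integrable (\<lambda>x::real^'a. 1)" by (rule locally_integrable_bounded[of _ 1]) auto
  show "locally_integrable (\<lambda>x::real^'a. 0)" by (rule locally_integrable_bounded[of _ 0]) auto
  show "(LINT x|lborel. 1 * partial i \<phi> x) = - (LINT x|lborel. 0 * \<phi> x)" if "\<phi> \<in> test_functions"
    for \<phi> :: "real ^ 'a \<Rightarrow> real"
    using integral_partial_test[OF that] by simp
qed

text \<open>Rules out negative infinite values, so that finiteness of the sum in
  \<open>W1inf\<close> makes each summand a real number.\<close>

lemma Linf_norm_nonneg: "0 \<le> Linf_norm (f :: real ^ 'n::finite \<Rightarrow> 'b::real_normed_vector)"
proof -
  have "esssup lborel (\<lambda>x :: real ^ 'n. 0 :: ereal) = 0" by (rule esssup_const) simp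
  moreover have "esssup lborel (\<lambda>x :: real ^ 'n. 0 :: ereal) \<le> Linf_norm f"
    unfolding Linf_norm_def by (rule esssup_mono) auto
  ultimately show ?thesis by simp
qed

lemma W1inf_D:
  assumes f: "f \<in> W1inf"
  shows "f \<in> borel_measurable borel" "weakly_differentiable i f" "0 \<le> W1inf_norm f"
    "AE x in lborel. \<bar>f x\<bar> \<le> W1inf_norm f" "AE x in lborel. \<bar>wpartial i f x\<bar> \<le> W1inf_norm f"
proof -
  show "f \<in> borel_measurable borel" "weakly_differentiable i f" using f by (auto simp: W1inf_def)
  define l g where "l = Linf_norm f" and "g = Linf_norm (weak_grad f)"
  have "l + g < \<infinity>" "0 \<le> l" "0 \<le> g" using f Linf_norm_nonneg by (auto simp: W1inf_def l_def g_def)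
  then obtain l' g' where lg: "l = ereal l'" "g = ereal g'" "0 \<le> l'" "0 \<le> g'"
    by (cases l; cases g) auto
  have N: "W1inf_norm f = l' + g'" using lg by (simp add: W1inf_norm_def l_def[symmetric] g_def[symmetric])
  show "0 \<le> W1inf_norm f" using lg N by simp
  have "AE x in lborel. ereal (norm (f x)) \<le> l" unfolding l_def Linf_norm_def by (rule esssup_AE)
  then show "AE x in lborel. \<bar>f x\<bar> \<le> W1inf_norm f"
    by eventually_elim (use lg N in simp)
  have "AE x in lborel. ereal (norm (weak_grad f x)) \<le> g" unfolding g_def Linf_norm_def by (rule esssup_AE)
  then show "AE x in lborel. \<bar>wpartial i f x\<bar> \<le> W1inf_norm f"
  proof eventually_elim
    case (elim x)
    have "\<bar>wpartial i f x\<bar> \<le> norm (weak_grad f x)"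
      using component_le_norm_cart[of "weak_grad f x" i] by (simp add: weak_grad_def)
    then show ?case using elim lg N by simp
  qed
qed

section \<open>Passing from classes back to functions and their Sobolev norms\<close>

lemma of_l2_diff_L2: "(\<lambda>x. of_l2 f x - of_l2 g x) \<in> L2"
  "to_l2 (\<lambda>x. of_l2 f x - of_l2 g x) = f - g"
  by (simp_all add: L2_diff to_l2_diff)

lemma of_l2_quotient_L2: "(\<lambda>x. (of_l2 f x - of_l2 g x) / r - of_l2 k x) \<in> L2"
  "to_l2 (\<lambda>x. (of_l2 f x - of_l2 g x) / r - of_l2 k x) = (f - g) /\<^sub>R r - k"
proof -
  have *: "(\<lambda>x. inverse r * (of_l2 f x - of_l2 g x)) \<in> L2" by (intro L2_scale of_l2_diff_L2)
  have e: "(\<lambda>x. (of_l2 f x - of_l2 g x) / r - of_l2 k x) = (\<lambda>x. inverse r * (of_l2 f x - of_l2 g x) - of_l2 k x)"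
    by (simp add: divide_inverse mult.commute)
  show "(\<lambda>x. (of_l2 f x - of_l2 g x) / r - of_l2 k x) \<in> L2"
    unfolding e by (intro L2_diff * of_l2_L2)
  show "to_l2 (\<lambda>x. (of_l2 f x - of_l2 g x) / r - of_l2 k x) = (f - g) /\<^sub>R r - k"
    unfolding e by (simp add: to_l2_diff * to_l2_scale of_l2_diff_L2)
qed

lemma has_vector_derivative_quotient:
  fixes U :: "real \<Rightarrow> 'a::real_normed_vector"
  assumes "(U has_vector_derivative V) (at t within S)"
  shows "((\<lambda>s. (U s - U t) /\<^sub>R (s - t) - V) \<longlongrightarrow> 0) (at t within S)"
proof (rule tendsto_norm_zero_cancel)
  have "((\<lambda>s. (1 / norm (s - t)) *\<^sub>R (U s - (U t + (s - t) *\<^sub>R V))) \<longlongrightarrow> 0) (at t within S)"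
    using assms unfolding has_vector_derivative_def has_derivative_within by simp
  then have "((\<lambda>s. norm ((1 / norm (s - t)) *\<^sub>R (U s - (U t + (s - t) *\<^sub>R V)))) \<longlongrightarrow> 0) (at t within S)"
    by (rule tendsto_norm_zero)
  moreover have "\<forall>\<^sub>F s in at t within S. norm ((1 / norm (s - t)) *\<^sub>R (U s - (U t + (s - t) *\<^sub>R V)))
      = norm ((U s - U t) /\<^sub>R (s - t) - V)"
    unfolding eventually_at_filter
  proof (rule always_eventually, intro allI impI)
    fix s assume s: "s \<noteq> t"
    have "(U s - U t) /\<^sub>R (s - t) - V = inverse (s - t) *\<^sub>R (U s - (U t + (s - t) *\<^sub>R V))"
      using s by (simp add: scaleR_diff_right scaleR_add_right)
    then show "norm ((1 / norm (s - t)) *\<^sub>R (U s - (U t + (s - t) *\<^sub>R V))) = norm ((U s - U t) /\<^sub>R (s - t) - V)"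
      by (simp only: norm_scaleR) (simp add: divide_inverse)
  qed
  ultimately show "((\<lambda>s. norm ((U s - U t) /\<^sub>R (s - t) - V)) \<longlongrightarrow> 0) (at t within S)"
    by (rule Lim_transform_eventually)
qed

context mollifier
begin

lemma has_weak_partial_unique:
  fixes f :: "real ^ 'n \<Rightarrow> real"
  assumes "has_weak_partial i f g" "has_weak_partial i f g'"
  shows "AE x in lborel. g x = g' x"
proof -
  have li: "locally_integrable g" "locally_integrable g'" using assms by (auto simp: has_weak_partial_def)
  have "AE x in lborel. g x + - 1 * g' x = 0"
  proof (rule test_zero_imp_AE_zero[OF \<psi>])
    show "locally_integrable (\<lambda>x. g x + - 1 * g' x)" by (intro locally_integrable_add locally_integrable_scale li)
    fix \<phi> :: "real ^ 'n \<Rightarrow> real" assume \<phi>: "\<phi> \<in> test_functions"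
    have "(LINT x|lborel. (g x + - 1 * g' x) * \<phi> x) = (LINT x|lborel. g x * \<phi> x - g' x * \<phi> x)"
      by (simp add: left_diff_distrib)
    also have "\<dots> = (LINT x|lborel. g x * \<phi> x) - (LINT x|lborel. g' x * \<phi> x)"
      by (intro Bochner_Integration.integral_diff locally_integrable_test li \<phi>)
    also have "\<dots> = 0"
    proof -
      have "(LINT x|lborel. f x * partial i \<phi> x) = - (LINT x|lborel. g x * \<phi> x)"
        "(LINT x|lborel. f x * partial i \<phi> x) = - (LINT x|lborel. g' x * \<phi> x)"
        using assms \<phi> unfolding has_weak_partial_def by blast+
      then show ?thesis by linarith
    qed
    finally show "(LINT x|lborel. (g x + - 1 * g' x) * \<phi> x) = 0" .
  qed
  then show ?thesis by eventually_elim simp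
qed

text \<open>\<open>wpartial\<close> is an arbitrary choice among weak derivatives that are merely
  locally integrable. Uniqueness almost everywhere makes it agree with \<open>g\<close>, which puts
  it into \<open>L2\<close>.\<close>

lemma wpartial_l2:
  fixes f :: "real ^ 'n \<Rightarrow> real"
  assumes f: "f \<in> L2" and wd: "wd i (to_l2 f) g"
  shows "weakly_differentiable i f" "wpartial i f \<in> L2" "to_l2 (wpartial i f) = g"
proof -
  have hwp: "has_weak_partial i f (of_l2 g)"
    unfolding has_weak_partial_def
  proof (intro conjI ballI)
    fix \<phi> :: "real ^ 'n \<Rightarrow> real" assume \<phi>: "\<phi> \<in> test_functions"
    show "(LINT x|lborel. f x * partial i \<phi> x) = - (LINT x|lborel. of_l2 g x * \<phi> x)"
      using wd_D[OF wd \<phi>] unfolding inner_test[OF \<phi>] to_l2_inner[OF f test_L2[OF test_partial[OF \<phi>]]] .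
  qed (simp_all add: locally_integrable_L2 f)
  then show w: "weakly_differentiable i f" by (auto simp: weakly_differentiable_def)
  have hw: "has_weak_partial i f (wpartial i f)" by (rule wpartial_has_weak_partial[OF w])
  have ae: "AE x in lborel. wpartial i f x = of_l2 g x" by (rule has_weak_partial_unique[OF hw hwp])
  have "locally_integrable (wpartial i f)" using hw unfolding has_weak_partial_def by blast
  then have "wpartial i f \<in> borel_measurable borel" by (rule locally_integrable_measurable)
  then show L: "wpartial i f \<in> L2" by (rule L2_AE_cong[OF of_l2_L2 _ ae])
  have "to_l2 (wpartial i f) = to_l2 (of_l2 g)" using ae by (simp only: to_l2_eq_iff[OF L of_l2_L2])
  then show "to_l2 (wpartial i f) = g" by simp
qed

lemma wd_wpartial:
  fixes f :: "real ^ 'n \<Rightarrow> real"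
  assumes f: "f \<in> L2" and w: "weakly_differentiable i f" "wpartial i f \<in> L2"
  shows "wd i (to_l2 f) (to_l2 (wpartial i f))"
  unfolding wd_def
proof
  fix \<phi> :: "real ^ 'n \<Rightarrow> real" assume \<phi>: "\<phi> \<in> test_functions"
  show "to_l2 f \<bullet> to_l2 (partial i \<phi>) = - (to_l2 (wpartial i f) \<bullet> to_l2 \<phi>)"
    using wpartial_has_weak_partial[OF w(1)] \<phi>
    unfolding has_weak_partial_def to_l2_inner[OF f test_L2[OF test_partial[OF \<phi>]]] to_l2_inner[OF w(2) test_L2[OF \<phi>]]
    by blast
qed

lemma H1_D:
  fixes f :: "real ^ 'n \<Rightarrow> real"
  assumes "f \<in> H1"
  shows "f \<in> L2" "wpartial i f \<in> L2" "wd i (to_l2 f) (to_l2 (wpartial i f))"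
proof -
  have *: "f \<in> L2" "weakly_differentiable i f" "wpartial i f \<in> L2" using assms unfolding H1_def by blast+
  then show "f \<in> L2" "wpartial i f \<in> L2" "wd i (to_l2 f) (to_l2 (wpartial i f))"
    using wd_wpartial[OF *] by blast+
qed

text \<open>The norm formula holds for any witnesses \<open>g\<close>, which turns statements about
  \<open>H1_norm\<close> into statements about norms of classes.\<close>

lemma H1_I:
  fixes f :: "real ^ 'n \<Rightarrow> real"
  assumes f: "f \<in> L2" and g: "\<And>i. wd i (to_l2 f) (g i)"
  shows "f \<in> H1" and "H1_norm f = norm (to_l2 f) + sqrt (\<Sum>j\<in>UNIV. (norm (g j))\<^sup>2)"
proof -
  note w = wpartial_l2[OF f g]
  show "f \<in> H1" unfolding H1_def using f w by blast
  show "H1_norm f = norm (to_l2 f) + sqrt (\<Sum>j\<in>UNIV. (norm (g j))\<^sup>2)"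
    unfolding H1_norm_def norm_to_l2[OF f, symmetric] norm_to_l2[OF w(2), symmetric] w(3) ..
qed

lemma H2_I:
  fixes f :: "real ^ 'n \<Rightarrow> real"
  assumes f: "f \<in> L2" and g: "\<And>i. wd i (to_l2 f) (g i)" and s: "\<And>i j. wd j (g i) (s i j)"
  shows "f \<in> H2" and "H2_norm f = norm (to_l2 f) + norm (\<Sum>j\<in>UNIV. g j) + norm (\<Sum>j\<in>UNIV. s j j)"
proof -
  note w = wpartial_l2[OF f g]
  have s': "wd j (to_l2 (wpartial i f)) (s i j)" for i j using s w by simp
  note w2 = wpartial_l2[OF w(2) s']
  show "f \<in> H2" unfolding H2_def using H1_I(1)[OF f g] H1_I(1)[OF w(2) s'] by simp
  have "to_l2 (\<lambda>x. \<Sum>j\<in>UNIV. wpartial j f x) = (\<Sum>j\<in>UNIV. g j)"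
    "(\<lambda>x. \<Sum>j\<in>UNIV. wpartial j f x) \<in> L2"
    using to_l2_sum[of UNIV "\<lambda>j. wpartial j f", OF w(2)] unfolding w(3) by simp_all
  moreover have "to_l2 (\<lambda>x. \<Sum>j\<in>UNIV. wpartial j (wpartial j f) x) = (\<Sum>j\<in>UNIV. s j j)"
    "(\<lambda>x. \<Sum>j\<in>UNIV. wpartial j (wpartial j f) x) \<in> L2"
    using to_l2_sum[of UNIV "\<lambda>j. wpartial j (wpartial j f)", OF w2(2)] unfolding w2(3) by simp_all
  ultimately show "H2_norm f = norm (to_l2 f) + norm (\<Sum>j\<in>UNIV. g j) + norm (\<Sum>j\<in>UNIV. s j j)"
    unfolding H2_norm_def norm_to_l2[OF f, symmetric] by (simp only: norm_to_l2[symmetric])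
qed

lemma H2_D:
  fixes f :: "real ^ 'n \<Rightarrow> real"
  assumes "f \<in> H2"
  obtains g s where "f \<in> L2" "\<And>i. wd i (to_l2 f) (g i)" "\<And>i j. wd j (g i) (s i j)"
proof -
  have f: "f \<in> H1" "\<And>i. wpartial i f \<in> H1" using assms by (auto simp: H2_def)
  show thesis
    by (rule that[of "\<lambda>i. to_l2 (wpartial i f)" "\<lambda>i j. to_l2 (wpartial j (wpartial i f))"])
      (use H1_D[OF f(1)] H1_D[OF f(2)] in auto)
qed

text \<open>Integration by parts expresses the square of the gradient norm as minus the inner
  product of \<open>u\<close> with its Laplacian; elliptic regularity for the Laplacian bounds each
  mixed second derivative. Together they recover single derivatives from what \<open>H2_norm\<close>
  controls.\<close>

lemma laplacian_bounds:
  fixes u :: "'n l2"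
  assumes g: "\<And>i. wd i u (g i)" and s: "\<And>i j. wd j (g i) (s i j)"
    and N: "norm u \<le> N" "norm (\<Sum>j\<in>UNIV. s j j) \<le> N"
  shows "norm (g i) \<le> N" "norm (s i j) \<le> N"
proof -
  have N0: "N \<ge> 0" using N(1) norm_ge_zero order_trans by blast
  have "(\<Sum>j\<in>UNIV. g j \<bullet> g j) = - (u \<bullet> (\<Sum>j\<in>UNIV. s j j))"
    using integration_by_parts[OF g s] by (simp add: inner_sum_right sum_negf)
  also have "\<dots> \<le> norm u * norm (\<Sum>j\<in>UNIV. s j j)"
    using Cauchy_Schwarz_ineq2[of u "\<Sum>j\<in>UNIV. s j j"] by linarith
  also have "\<dots> \<le> N * N" using N N0 by (intro mult_mono) auto
  finally have "(\<Sum>j\<in>UNIV. g j \<bullet> g j) \<le> N\<^sup>2" by (simp add: power2_eq_square)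
  moreover have "g i \<bullet> g i \<le> (\<Sum>j\<in>UNIV. g j \<bullet> g j)" by (rule member_le_sum) auto
  ultimately have "(norm (g i))\<^sup>2 \<le> N\<^sup>2" by (simp add: power2_norm_eq_inner)
  then show "norm (g i) \<le> N" using N0 by (rule power2_le_imp_le)
  have "\<exists>q. wd j (g i) q \<and> norm q \<le> (norm (\<Sum>j\<in>UNIV. s j j) + 0 * (\<Sum>i\<in>UNIV. norm (g i))) / 1"
  \<comment> \<open>All coefficients are 1, with lower bound 1 and derivative bound 0, so the
    constant of the estimate is 1.\<close>
  proof (rule elliptic_regularity[OF g, of "\<lambda>i x. 1" 1 j "\<lambda>i x. 0" 0 "\<Sum>j\<in>UNIV. s j j" i])
    show "ebdd (\<lambda>x. 1)" by (rule ebddI[of _ 1]) auto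
    show "has_weak_partial j (\<lambda>x. 1) (\<lambda>x. 0)" by (rule has_weak_partial_one)
    fix \<phi> \<phi>' assume \<phi>: "\<And>j. wd j \<phi> (\<phi>' j :: 'n l2)"
    show "(\<Sum>j\<in>UNIV. mul (\<lambda>x. 1) (g j) \<bullet> \<phi>' j) = - ((\<Sum>j\<in>UNIV. s j j) \<bullet> \<phi>)"
      using integration_by_parts[OF s \<phi>] by (simp add: mul_one inner_sum_left sum_negf)
  qed auto
  then show "norm (s i j) \<le> N" using wd_unique[OF s] N(2) by fastforce
qed

lemma C0_in_I:
  fixes u :: "real \<Rightarrow> real ^ 'n \<Rightarrow> real"
  assumes "\<And>t. t \<in> {0..T} \<Longrightarrow> u t \<in> X"
    and "\<And>s t. s \<in> {0..T} \<Longrightarrow> t \<in> {0..T} \<Longrightarrow> nrm (\<lambda>x. u s x - u t x) = N s t"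
    and "\<And>t. t \<in> {0..T} \<Longrightarrow> continuous_on {0..T} (\<lambda>s. N s t)" "\<And>t. N t t = 0"
  shows "u \<in> C0_in T X nrm"
  unfolding C0_in_def
proof (intro CollectI ballI conjI)
  fix t assume t: "t \<in> {0..T}"
  show "u t \<in> X" by (rule assms(1)[OF t])
  have lim: "((\<lambda>s. N s t) \<longlongrightarrow> 0) (at t within {0..T})"
    using assms(3)[OF t] t assms(4)[of t] unfolding continuous_on_def by fastforce
  have "\<forall>\<^sub>F s in at t within {0..T}. N s t = nrm (\<lambda>x. u s x - u t x)"
    unfolding eventually_at_filter using assms(2)[OF _ t] by simp
  from Lim_transform_eventually[OF lim this]
  show "((\<lambda>s. nrm (\<lambda>x. u s x - u t x)) \<longlongrightarrow> 0) (at t within {0..T})" .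
qed

lemma C0_in_L2_I:
  assumes "continuous_on {0..T} U"
  shows "(\<lambda>t. of_l2 (U t :: 'n l2)) \<in> C0_in T L2 L2_norm"
  by (rule C0_in_I[where N = "\<lambda>s t. norm (U s - U t)"])
    (auto simp: norm_to_l2[symmetric] of_l2_diff_L2 intro!: continuous_intros assms)

lemma C0_in_H1_I:
  fixes U :: "real \<Rightarrow> 'n l2"
  assumes U: "continuous_on {0..T} U" and P: "\<And>j. continuous_on {0..T} (\<lambda>t. P t j)"
    and wd: "\<And>t j. t \<in> {0..T} \<Longrightarrow> wd j (U t) (P t j)"
  shows "(\<lambda>t. of_l2 (U t)) \<in> C0_in T H1 H1_norm"
proof (rule C0_in_I[where N = "\<lambda>s t. norm (U s - U t) + sqrt (\<Sum>j\<in>UNIV. (norm (P s j - P t j))\<^sup>2)"])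
  fix s t assume s: "s \<in> {0..T}" and t: "t \<in> {0..T}"
  show "of_l2 (U t) \<in> H1" by (rule H1_I(1)[of _ "P t"]) (simp_all add: wd[OF t])
  have "wd j (U s - U t) (P s j - P t j)" for j by (intro wd_diff wd s t)
  then show "H1_norm (\<lambda>x. of_l2 (U s) x - of_l2 (U t) x)
      = norm (U s - U t) + sqrt (\<Sum>j\<in>UNIV. (norm (P s j - P t j))\<^sup>2)"
    using H1_I(2)[of "\<lambda>x. of_l2 (U s) x - of_l2 (U t) x" "\<lambda>j. P s j - P t j"] by (simp add: of_l2_diff_L2)
  show "continuous_on {0..T} (\<lambda>s. norm (U s - U t) + sqrt (\<Sum>j\<in>UNIV. (norm (P s j - P t j))\<^sup>2))"
    by (intro continuous_intros U P)
qed simp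

lemma C0_in_H2_I:
  fixes U :: "real \<Rightarrow> 'n l2"
  assumes U: "continuous_on {0..T} U" and P: "\<And>j. continuous_on {0..T} (\<lambda>t. P t j)"
    and S: "\<And>j k. continuous_on {0..T} (\<lambda>t. S t j k)"
    and wd: "\<And>t j. t \<in> {0..T} \<Longrightarrow> wd j (U t) (P t j)"
    and wd2: "\<And>t j k. t \<in> {0..T} \<Longrightarrow> wd k (P t j) (S t j k)"
  shows "(\<lambda>t. of_l2 (U t)) \<in> C0_in T H2 H2_norm"
proof (rule C0_in_I[where N = "\<lambda>s t. norm (U s - U t) + norm (\<Sum>j\<in>UNIV. P s j - P t j)
    + norm (\<Sum>j\<in>UNIV. S s j j - S t j j)"])
  fix s t assume s: "s \<in> {0..T}" and t: "t \<in> {0..T}"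
  show "of_l2 (U t) \<in> H2" by (rule H2_I(1)[of _ "P t" "S t"]) (simp_all add: wd[OF t] wd2[OF t])
  have "wd j (U s - U t) (P s j - P t j)" "wd k (P s j - P t j) (S s j k - S t j k)" for j k
    by (intro wd_diff wd wd2 s t)+
  then show "H2_norm (\<lambda>x. of_l2 (U s) x - of_l2 (U t) x)
      = norm (U s - U t) + norm (\<Sum>j\<in>UNIV. P s j - P t j) + norm (\<Sum>j\<in>UNIV. S s j j - S t j j)"
    using H2_I(2)[of "\<lambda>x. of_l2 (U s) x - of_l2 (U t) x" "\<lambda>j. P s j - P t j" "\<lambda>j k. S s j k - S t j k"]
    by (simp add: of_l2_diff_L2)
  show "continuous_on {0..T} (\<lambda>s. norm (U s - U t) + norm (\<Sum>j\<in>UNIV. P s j - P t j)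
      + norm (\<Sum>j\<in>UNIV. S s j j - S t j j))"
    by (intro continuous_intros U P S)
qed simp

lemma has_C1_derivative_L2_I:
  fixes U V :: "real \<Rightarrow> 'n l2"
  assumes der: "\<And>t. t \<in> {0..T} \<Longrightarrow> (U has_vector_derivative V t) (at t within {0..T})"
    and V: "continuous_on {0..T} V"
  shows "has_C1_derivative T L2 L2_norm (\<lambda>t. of_l2 (U t)) (\<lambda>t. of_l2 (V t))"
  unfolding has_C1_derivative_def
proof (intro conjI ballI C0_in_L2_I V)
  show "continuous_on {0..T} U" by (rule continuous_on_vector_derivative[OF der])
  fix t assume t: "t \<in> {0..T}"
  show "((\<lambda>s. L2_norm (\<lambda>x. (of_l2 (U s) x - of_l2 (U t) x) / (s - t) - of_l2 (V t) x)) \<longlongrightarrow> 0) (at t within {0..T})"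
    using tendsto_norm_zero[OF has_vector_derivative_quotient[OF der[OF t]]]
    by (simp add: norm_to_l2[symmetric] of_l2_quotient_L2)
qed

text \<open>The weak gradient of the difference quotient of \<open>U\<close> is the difference
  quotient of \<open>P\<close>, so differentiability in \<open>H1\<close> splits into
  differentiability of \<open>U\<close> and of each \<open>P\<close> as curves of classes.\<close>

lemma has_C1_derivative_H1_I:
  fixes U V :: "real \<Rightarrow> 'n l2"
  assumes der: "\<And>t. t \<in> {0..T} \<Longrightarrow> (U has_vector_derivative V t) (at t within {0..T})"
    and V: "continuous_on {0..T} V"
    and Pder: "\<And>t j. t \<in> {0..T} \<Longrightarrow> ((\<lambda>t. P t j) has_vector_derivative R t j) (at t within {0..T})"
    and R: "\<And>j. continuous_on {0..T} (\<lambda>t. R t j)"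
    and wdU: "\<And>t j. t \<in> {0..T} \<Longrightarrow> wd j (U t) (P t j)"
    and wdV: "\<And>t j. t \<in> {0..T} \<Longrightarrow> wd j (V t) (R t j)"
  shows "has_C1_derivative T H1 H1_norm (\<lambda>t. of_l2 (U t)) (\<lambda>t. of_l2 (V t))"
  unfolding has_C1_derivative_def
proof (intro conjI ballI)
  have U: "continuous_on {0..T} U" by (rule continuous_on_vector_derivative[OF der])
  have P: "continuous_on {0..T} (\<lambda>t. P t j)" for j by (rule continuous_on_vector_derivative[OF Pder])
  show "(\<lambda>t. of_l2 (U t)) \<in> C0_in T H1 H1_norm" by (rule C0_in_H1_I[of T U P]) (fact U P wdU)+
  show "(\<lambda>t. of_l2 (V t)) \<in> C0_in T H1 H1_norm" by (rule C0_in_H1_I[of T V R]) (fact V R wdV)+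
  fix t assume t: "t \<in> {0..T}"
  define dU where "dU s = (U s - U t) /\<^sub>R (s - t) - V t" for s
  define dP where "dP s j = (P s j - P t j) /\<^sub>R (s - t) - R t j" for s j
  have Ut: "(dU \<longlongrightarrow> 0) (at t within {0..T})"
    unfolding dU_def by (rule has_vector_derivative_quotient[OF der[OF t]])
  have Pt: "((\<lambda>s. dP s j) \<longlongrightarrow> 0) (at t within {0..T})" for j
    unfolding dP_def by (rule has_vector_derivative_quotient[OF Pder[OF t]])
  have "((\<lambda>s. norm (dU s) + sqrt (\<Sum>j\<in>UNIV. (norm (dP s j))\<^sup>2))
      \<longlongrightarrow> norm (0 :: 'n l2) + sqrt (\<Sum>j\<in>(UNIV :: 'n set). (norm (0 :: 'n l2))\<^sup>2)) (at t within {0..T})"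
    by (intro tendsto_intros Ut Pt)
  then have lim: "((\<lambda>s. norm (dU s) + sqrt (\<Sum>j\<in>UNIV. (norm (dP s j))\<^sup>2)) \<longlongrightarrow> 0) (at t within {0..T})"
    by simp
  have "\<forall>\<^sub>F s in at t within {0..T}. norm (dU s) + sqrt (\<Sum>j\<in>UNIV. (norm (dP s j))\<^sup>2)
      = H1_norm (\<lambda>x. (of_l2 (U s) x - of_l2 (U t) x) / (s - t) - of_l2 (V t) x)"
    unfolding eventually_at_filter
  proof (rule always_eventually, intro allI impI)
    fix s assume "s \<in> {0..T}"
    then have "wd j (dU s) (dP s j)" for j
      unfolding dU_def dP_def by (intro wd_diff wd_scale wdU wdV t)
    then show "norm (dU s) + sqrt (\<Sum>j\<in>UNIV. (norm (dP s j))\<^sup>2)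
        = H1_norm (\<lambda>x. (of_l2 (U s) x - of_l2 (U t) x) / (s - t) - of_l2 (V t) x)"
      using H1_I(2)[of "\<lambda>x. (of_l2 (U s) x - of_l2 (U t) x) / (s - t) - of_l2 (V t) x" "dP s"]
      by (simp add: of_l2_quotient_L2 dU_def)
  qed
  from Lim_transform_eventually[OF lim this]
  show "((\<lambda>s. H1_norm (\<lambda>x. (of_l2 (U s) x - of_l2 (U t) x) / (s - t) - of_l2 (V t) x)) \<longlongrightarrow> 0) (at t within {0..T})" .
qed

end

text \<open>With \<open>d\<close> the dimension, the four summands collect the coefficients of
  \<open>Q ^ 3\<close> that come from \<open>u0\<close>, from the time integral of \<open>v\<close>,
  from the gradient and from the Laplacian. The factors \<open>1 + 2 * d\<close> and
  \<open>4 * d\<close> belong to \<open>A\<close> and \<open>B\<close>.\<close>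

definition wave_const :: "real \<Rightarrow> real \<Rightarrow> real \<Rightarrow> real" where
  "wave_const T c d = 1 + (1 + 2 * d) * T + d * ((1 + 2 * d) / sqrt c)
     + d * ((4 * d + d * ((1 + 2 * d) / sqrt c)) / c)"

text \<open>Coefficients times data make \<open>A\<close> and \<open>B\<close> quadratic in
  \<open>Q\<close>; the derivative of the coefficients in the elliptic estimate contributes the
  third factor. Since \<open>Q \<ge> 1\<close>, lower powers are raised to the third.\<close>

lemma wave_const_bound:
  assumes T: "T > 0" and c: "c > 0" and d: "d \<ge> 0" and Q: "Q \<ge> 1"
    and A: "A \<le> Q + (1 + Q) * (d * Q)" and B: "B \<le> d * (Q * Q + Q * Q) + (1 + Q) * (d * Q)"
  shows "Q + A * T + d * (A / sqrt c) + d * ((B + Q * (d * (A / sqrt c))) / c) \<le> wave_const T c d * Q ^ 3"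
proof -
  have Q2: "Q \<le> Q\<^sup>2" "Q\<^sup>2 \<le> Q ^ 3" "1 \<le> Q\<^sup>2"
    using Q power_increasing[of 1 2 Q] power_increasing[of 2 3 Q] power_increasing[of 0 2 Q] by auto
  have A2: "A \<le> (1 + 2 * d) * Q\<^sup>2"
  proof -
    have "d * Q \<le> d * Q\<^sup>2" using Q2(1) d by (rule mult_left_mono)
    moreover have "Q + (1 + Q) * (d * Q) = Q + d * Q + d * Q\<^sup>2" by (simp add: power2_eq_square algebra_simps)
    moreover have "(1 + 2 * d) * Q\<^sup>2 = Q\<^sup>2 + 2 * (d * Q\<^sup>2)" by (simp add: algebra_simps)
    ultimately show ?thesis using A Q2(1) by linarith
  qed
  have B2: "B \<le> 4 * d * Q\<^sup>2"
  proof -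
    have "d * Q \<le> d * Q\<^sup>2" using Q2(1) d by (rule mult_left_mono)
    moreover have "d * (Q * Q + Q * Q) + (1 + Q) * (d * Q) = 3 * (d * Q\<^sup>2) + d * Q"
      by (simp add: power2_eq_square algebra_simps)
    ultimately show ?thesis using B by linarith
  qed
  have sc: "sqrt c > 0" using c by simp
  define D where "D = (1 + 2 * d) / sqrt c"
  have D0: "D \<ge> 0" unfolding D_def using d sc by simp
  have As: "A / sqrt c \<le> D * Q\<^sup>2"
    using divide_right_mono[OF A2, of "sqrt c"] sc by (simp add: D_def)
  have 1: "Q \<le> 1 * Q ^ 3" using Q2 by linarith
  have 2: "A * T \<le> (1 + 2 * d) * T * Q ^ 3"
  proof -
    have "A * T \<le> (1 + 2 * d) * Q\<^sup>2 * T" using A2 T by (intro mult_right_mono) auto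
    also have "\<dots> = (1 + 2 * d) * T * Q\<^sup>2" by simp
    also have "\<dots> \<le> (1 + 2 * d) * T * Q ^ 3" using Q2(2) T d by (intro mult_left_mono) auto
    finally show ?thesis .
  qed
  have As3: "A / sqrt c \<le> D * Q ^ 3"
    using As mult_left_mono[OF Q2(2) D0] by linarith
  have 3: "d * (A / sqrt c) \<le> d * D * Q ^ 3"
    using mult_left_mono[OF As3 d] by simp
  have 4: "d * ((B + Q * (d * (A / sqrt c))) / c) \<le> d * ((4 * d + d * D) / c) * Q ^ 3"
  proof -
    have "4 * d * Q\<^sup>2 \<le> 4 * d * Q ^ 3" using Q2(2) d by (intro mult_left_mono) auto
    then have "B \<le> 4 * d * Q ^ 3" using B2 by linarith
    moreover have "Q * (d * (A / sqrt c)) \<le> d * D * Q ^ 3"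
    proof -
      have "Q * (d * (A / sqrt c)) \<le> Q * (d * (D * Q\<^sup>2))" using As d Q by (intro mult_left_mono) auto
      also have "\<dots> = d * D * Q ^ 3" by (simp add: power3_eq_cube power2_eq_square)
      finally show ?thesis .
    qed
    ultimately have "B + Q * (d * (A / sqrt c)) \<le> (4 * d + d * D) * Q ^ 3" by (simp add: distrib_right)
    then have "(B + Q * (d * (A / sqrt c))) / c \<le> (4 * d + d * D) * Q ^ 3 / c" using c by (intro divide_right_mono) auto
    then have "d * ((B + Q * (d * (A / sqrt c))) / c) \<le> d * ((4 * d + d * D) * Q ^ 3 / c)" using d by (rule mult_left_mono)
    then show ?thesis by simp
  qed
  show ?thesis
    unfolding wave_const_def D_def[symmetric] distrib_right[of _ _ "Q ^ 3"] using 1 2 3 4 by linarith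
qed

section \<open>Existence for one value of the parameter, with a polynomial bound\<close>

context mollifier
begin

text \<open>A single number \<open>Q\<close> bounds coefficients, their derivatives and the data, so
  that the net argument has only one power of \<open>1 / \<epsilon>\<close> to track.\<close>

theorem wave_existence:
  fixes h :: "'n \<Rightarrow> real ^ 'n \<Rightarrow> real"
  assumes T: "T > 0" and hW: "\<And>j. h j \<in> W1inf" and c: "c > 0" and hc: "\<And>j x. c \<le> h j x"
    and u0: "u0 \<in> H2" and u1: "u1 \<in> H1"
    and Q: "Q \<ge> 1" "\<And>j. W1inf_norm (h j) \<le> Q" "H2_norm u0 \<le> Q" "H1_norm u1 \<le> Q"
  obtains u where "u \<in> C0_in T H2 H2_norm" "u \<in> C1_in T H1 H1_norm" "u \<in> C0_in T H1 H1_norm"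
    "u \<in> C1_in T L2 L2_norm" "solves_wave T h u0 u1 u"
    "\<And>t. t \<in> {0..T} \<Longrightarrow> H2_norm (u t) \<le> wave_const T c (real CARD('n)) * Q ^ 3"
proof -
  note thesisI = that
  define h' where "h' j k = wpartial k (h j)" for j k
  have hQ: "AE x in lborel. \<bar>h j x\<bar> \<le> Q" for j
    using W1inf_D(4)[OF hW[of j]] by eventually_elim (use Q(2)[of j] in linarith)
  have h'Q: "AE x in lborel. \<bar>h' j k x\<bar> \<le> Q" for j k
    using W1inf_D(5)[OF hW[of j], of k] unfolding h'_def by eventually_elim (use Q(2)[of j] in linarith)
  interpret W: wave_lipschitz \<psi> h c h' Q Q
  proof
    show "ebdd (h j)" for j by (rule ebddI[OF W1inf_D(1)[OF hW] hQ])
    show "has_weak_partial k (h j) (h' j k)" for j k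
      unfolding h'_def by (rule wpartial_has_weak_partial[OF W1inf_D(2)[OF hW]])
  qed (use c hc hQ h'Q Q in auto)
  obtain g s0 where g: "u0 \<in> L2" "\<And>i. wd i (to_l2 u0) (g i)" "\<And>i j. wd j (g i) (s0 i j)"
    using H2_D[OF u0] by metis
  \<comment> \<open>The gradient and all second derivatives of \<open>u0\<close> are recovered from
    these two bounds by \<open>laplacian_bounds\<close>.\<close>
  have n0: "norm (to_l2 u0) \<le> Q" "norm (\<Sum>j\<in>UNIV. s0 j j) \<le> Q"
    using Q(3) norm_ge_zero[of "\<Sum>j\<in>UNIV. g j"] norm_ge_zero[of "\<Sum>j\<in>UNIV. s0 j j"] norm_ge_zero[of "to_l2 u0"]
    unfolding H2_I(2)[OF g] by linarith+
  note gb = laplacian_bounds[OF g(2,3) n0]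
  define p1 where "p1 j = to_l2 (wpartial j u1)" for j
  have p1: "wd j (to_l2 u1) (p1 j)" for j unfolding p1_def by (rule H1_D(3)[OF u1])
  have u1n: "H1_norm u1 = norm (to_l2 u1) + sqrt (\<Sum>j\<in>UNIV. (norm (p1 j))\<^sup>2)"
    by (rule H1_I(2)[OF H1_D(1)[OF u1] p1])
  have n1: "norm (to_l2 u1) \<le> Q" "sqrt (\<Sum>j\<in>UNIV. (norm (p1 j))\<^sup>2) \<le> Q"
  proof -
    have "0 \<le> sqrt (\<Sum>j\<in>UNIV. (norm (p1 j))\<^sup>2)" by (intro real_sqrt_ge_zero sum_nonneg) simp
    then show "norm (to_l2 u1) \<le> Q" "sqrt (\<Sum>j\<in>UNIV. (norm (p1 j))\<^sup>2) \<le> Q"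
      using Q(4) norm_ge_zero[of "to_l2 u1"] unfolding u1n by linarith+
  qed
  have p1b: "norm (p1 j) \<le> Q" for j
  proof -
    have "norm (p1 j) \<le> sqrt (\<Sum>j\<in>UNIV. (norm (p1 j))\<^sup>2)"
      by (rule real_le_rsqrt) (rule member_le_sum, auto)
    then show ?thesis using n1(2) by linarith
  qed
  define d where "d = real CARD('n)"
  define A where "A = norm (to_l2 u1) + (1 + Q) * (\<Sum>j\<in>UNIV. norm (g j))"
  define B where "B = (\<Sum>j\<in>UNIV. Q * norm (s0 j j) + Q * norm (g j)) + (1 + Q) * (\<Sum>j\<in>UNIV. norm (p1 j))"
  have sumd: "(\<Sum>j\<in>(UNIV::'n set). K j) \<le> d * k" if "\<And>j. K j \<le> k" for K k
    using sum_bounded_above[of UNIV K k] that by (simp add: d_def)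
  have A: "A \<le> Q + (1 + Q) * (d * Q)"
    unfolding A_def using Q(1) by (intro add_mono n1 mult_left_mono sumd gb) auto
  have B: "B \<le> d * (Q * Q + Q * Q) + (1 + Q) * (d * Q)"
    unfolding B_def using Q(1) by (intro add_mono mult_left_mono sumd gb p1b) auto
  show thesis
  proof (rule W.wave_solution[OF T g(2,3) p1, folded A_def B_def d_def])
    fix u v w p r s
    assume U: "u 0 = to_l2 u0" "v 0 = to_l2 u1"
    "\<And>t. t \<in> {0..T} \<Longrightarrow> (u has_vector_derivative v t) (at t within {0..T})"
    "\<And>t. t \<in> {0..T} \<Longrightarrow> (v has_vector_derivative w t) (at t within {0..T})"
    "continuous_on {0..T} w"
    "\<And>t j. t \<in> {0..T} \<Longrightarrow> ((\<lambda>t. p t j) has_vector_derivative r t j) (at t within {0..T})"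
    "\<And>j. continuous_on {0..T} (\<lambda>t. r t j)"
    "\<And>t j. t \<in> {0..T} \<Longrightarrow> wd j (u t) (p t j)"
    "\<And>t j. t \<in> {0..T} \<Longrightarrow> wd j (v t) (r t j)"
    "\<And>t j k. t \<in> {0..T} \<Longrightarrow> wd k (p t j) (s t j k)"
    "\<And>j k. continuous_on {0..T} (\<lambda>t. s t j k)"
    "\<And>t. t \<in> {0..T} \<Longrightarrow> w t = (\<Sum>j\<in>UNIV. mul (h j) (s t j j) + mul (h' j j) (p t j))"
    and ub: "\<And>t. t \<in> {0..T} \<Longrightarrow> norm (u t) \<le> norm (to_l2 u0) + A * T"
    and pb: "\<And>t j. t \<in> {0..T} \<Longrightarrow> norm (p t j) \<le> A / sqrt c"
    and sb: "\<And>t j k. t \<in> {0..T} \<Longrightarrow> norm (s t j k) \<le> (B + Q * (d * (A / sqrt c))) / c"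
    have ucont: "continuous_on {0..T} u" by (rule continuous_on_vector_derivative[OF U(3)])
    have vcont: "continuous_on {0..T} v" by (rule continuous_on_vector_derivative[OF U(4)])
    have pcont: "continuous_on {0..T} (\<lambda>t. p t j)" for j by (rule continuous_on_vector_derivative[OF U(6)])
    show thesis
    proof (rule thesisI[of "\<lambda>t. of_l2 (u t)"])
      show "(\<lambda>t. of_l2 (u t)) \<in> C0_in T H2 H2_norm"
        by (rule C0_in_H2_I[of T u p s]) (fact ucont pcont U)+
      have "has_C1_derivative T H1 H1_norm (\<lambda>t. of_l2 (u t)) (\<lambda>t. of_l2 (v t))"
        by (rule has_C1_derivative_H1_I[of T u v p r]) (fact vcont U)+
      then show "(\<lambda>t. of_l2 (u t)) \<in> C1_in T H1 H1_norm" "(\<lambda>t. of_l2 (u t)) \<in> C0_in T H1 H1_norm"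
        unfolding C1_in_def has_C1_derivative_def by blast+
      have C1u: "has_C1_derivative T L2 L2_norm (\<lambda>t. of_l2 (u t)) (\<lambda>t. of_l2 (v t))"
        by (rule has_C1_derivative_L2_I[of T u v]) (fact vcont U)+
      then show "(\<lambda>t. of_l2 (u t)) \<in> C1_in T L2 L2_norm" unfolding C1_in_def by blast
      have C1v: "has_C1_derivative T L2 L2_norm (\<lambda>t. of_l2 (v t)) (\<lambda>t. of_l2 (w t))"
        by (rule has_C1_derivative_L2_I[of T v w]) (fact U)+
      have eq: "(\<forall>j. weakly_differentiable j (of_l2 (u t)) \<and>
                  weakly_differentiable j (\<lambda>x. h j x * wpartial j (of_l2 (u t)) x)) \<and>
             (AE x in lborel. of_l2 (w t) x - (\<Sum>j\<in>UNIV. wpartial j (\<lambda>y. h j y * wpartial j (of_l2 (u t)) y) x) = 0)"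
        if t: "t \<in> {0..T}" for t
      proof -
        have wdu: "wd j (to_l2 (of_l2 (u t))) (p t j)" for j using U(8)[OF t] by simp
        note wu = wpartial_l2[OF of_l2_L2 wdu]
        define F where "F j = (\<lambda>x. h j x * wpartial j (of_l2 (u t)) x)" for j
        have FL2: "F j \<in> L2" for j unfolding F_def by (rule ebdd_mult_L2[OF W.h wu(2)])
        have "to_l2 (F j) = mul (h j) (p t j)" for j
          unfolding F_def mul_to_l2[OF W.h wu(2), symmetric] wu(3) ..
        \<comment> \<open>The product rule applied to the flux. The diagonal derivatives sum to
          \<open>w t\<close> by the equation between classes, which becomes an identity almost
          everywhere for the chosen representatives.\<close>
        then have "wd j (to_l2 (F j)) (mul (h j) (s t j j) + mul (h' j j) (p t j))" for j
          using wd_mul[OF W.h W.wp W.ebdd_h' U(10)[OF t], of j j] by simp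
        note wF = wpartial_l2[OF FL2 this]
        have "to_l2 (\<lambda>x. \<Sum>j\<in>UNIV. wpartial j (F j) x) = to_l2 (of_l2 (w t))"
          "(\<lambda>x. \<Sum>j\<in>UNIV. wpartial j (F j) x) \<in> L2"
          using to_l2_sum[of UNIV "\<lambda>j. wpartial j (F j)", OF wF(2)] unfolding wF(3) U(12)[OF t] by simp_all
        then have "AE x in lborel. (\<Sum>j\<in>UNIV. wpartial j (F j) x) = of_l2 (w t) x"
          using to_l2_eq_iff[OF _ of_l2_L2] by blast
        then have "AE x in lborel. of_l2 (w t) x - (\<Sum>j\<in>UNIV. wpartial j (F j) x) = 0"
          by eventually_elim simp
        then show ?thesis using wu(1) wF(1) unfolding F_def by blast
      qed
      have "AE x in lborel. of_l2 (u 0) x = u0 x" "AE x in lborel. of_l2 (v 0) x = u1 x"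
        unfolding U(1,2) by (intro of_l2_to_l2 g H1_D(1)[OF u1])+
      then show "solves_wave T h u0 u1 (\<lambda>t. of_l2 (u t))"
        unfolding solves_wave_def using C1u C1v eq
        by (intro exI[of _ "\<lambda>t. of_l2 (v t)"] exI[of _ "\<lambda>t. of_l2 (w t)"]) blast
      fix t assume t: "t \<in> {0..T}"
      have "H2_norm (of_l2 (u t)) = norm (u t) + norm (\<Sum>j\<in>UNIV. p t j) + norm (\<Sum>j\<in>UNIV. s t j j)"
        using H2_I(2)[of "of_l2 (u t)" "p t" "s t"] U(8,10)[OF t] by simp
      also have "\<dots> \<le> (Q + A * T) + d * (A / sqrt c) + d * ((B + Q * (d * (A / sqrt c))) / c)"
        by (intro add_mono order_trans[OF norm_sum] sumd pb[OF t] sb[OF t])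
          (use ub[OF t] n0 in linarith)
      also have "\<dots> \<le> wave_const T c d * Q ^ 3"
        using wave_const_bound[OF T c _ Q(1) A B] by (simp add: d_def)
      finally show "H2_norm (of_l2 (u t)) \<le> wave_const T c (real CARD('n)) * Q ^ 3" by (simp add: d_def)
    qed
  qed
qed

end

theorem theorem2p4:
  fixes T c\<^sub>0 :: real
    and \<psi> :: "real ^ 'n::finite \<Rightarrow> real"
    and h :: "'n \<Rightarrow> (real ^ 'n \<Rightarrow> real) \<Rightarrow> real"
    and u\<^sub>0 u\<^sub>1 :: "(real ^ 'n \<Rightarrow> real) \<Rightarrow> real"
  assumes "T > 0"
    and "friedrichs_mollifier \<psi>"
    and "\<And>i. distribution (h i)"
    and "distribution u\<^sub>0"
    and "distribution u\<^sub>1"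
    and "c\<^sub>0 > 0"
    and "\<And>i \<epsilon> x. \<epsilon> \<in> {0<..1} \<Longrightarrow> regularise \<psi> (h i) \<epsilon> x \<ge> c\<^sub>0"
    and "\<exists>N\<^sub>0. \<forall>i. moderate_of_order W1inf W1inf_norm N\<^sub>0 (regularise \<psi> (h i))"
    and "\<exists>N\<^sub>1. moderate_of_order H2 H2_norm N\<^sub>1 (regularise \<psi> u\<^sub>0)"
    and "\<exists>N\<^sub>2. moderate_of_order H1 H1_norm N\<^sub>2 (regularise \<psi> u\<^sub>1)"
  shows "\<exists>u. very_weak_solution \<psi> T h u\<^sub>0 u\<^sub>1 u"
proof -
  interpret mollifier \<psi> by unfold_locales (rule assms(2))
  obtain N0 N1 N2 where N: "\<And>i. moderate_of_order W1inf W1inf_norm N0 (regularise \<psi> (h i))"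
    "moderate_of_order H2 H2_norm N1 (regularise \<psi> u\<^sub>0)"
    "moderate_of_order H1 H1_norm N2 (regularise \<psi> u\<^sub>1)"
    using assms(8-10) by blast
  \<comment> \<open>The order \<open>N0\<close> is common to all directions, but the constant may
    depend on the direction.\<close>
  have "\<exists>k. k > 0 \<and> (\<forall>\<epsilon>\<in>{0<..1}. regularise \<psi> (h i) \<epsilon> \<in> W1inf \<and>
      W1inf_norm (regularise \<psi> (h i) \<epsilon>) \<le> k * (1 / \<epsilon>) ^ N0)" for i
    using N(1)[of i] unfolding moderate_of_order_def by blast
  then obtain k where k: "\<And>i. k i > 0" "\<And>i \<epsilon>. \<epsilon> \<in> {0<..1} \<Longrightarrow> regularise \<psi> (h i) \<epsilon> \<in> W1inf"
    "\<And>i \<epsilon>. \<epsilon> \<in> {0<..1} \<Longrightarrow> W1inf_norm (regularise \<psi> (h i) \<epsilon>) \<le> k i * (1 / \<epsilon>) ^ N0"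
    by metis
  obtain k1 where k1: "k1 > 0" "\<And>\<epsilon>. \<epsilon> \<in> {0<..1} \<Longrightarrow> regularise \<psi> u\<^sub>0 \<epsilon> \<in> H2"
    "\<And>\<epsilon>. \<epsilon> \<in> {0<..1} \<Longrightarrow> H2_norm (regularise \<psi> u\<^sub>0 \<epsilon>) \<le> k1 * (1 / \<epsilon>) ^ N1"
    using N(2) unfolding moderate_of_order_def by blast
  obtain k2 where k2: "k2 > 0" "\<And>\<epsilon>. \<epsilon> \<in> {0<..1} \<Longrightarrow> regularise \<psi> u\<^sub>1 \<epsilon> \<in> H1"
    "\<And>\<epsilon>. \<epsilon> \<in> {0<..1} \<Longrightarrow> H1_norm (regularise \<psi> u\<^sub>1 \<epsilon>) \<le> k2 * (1 / \<epsilon>) ^ N2"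
    using N(3) unfolding moderate_of_order_def by blast
  \<comment> \<open>The sum over the finitely many directions, plus 1, dominates every constant and
    makes \<open>Q \<epsilon> \<ge> 1\<close>.\<close>
  define P where "P = 1 + (\<Sum>i\<in>UNIV. k i) + k1 + k2"
  \<comment> \<open>Because \<open>1 / \<epsilon> \<ge> 1\<close>, the power with the summed order
    dominates each of the three powers.\<close>
  define m where "m = N0 + N1 + N2"
  have sk: "0 \<le> (\<Sum>i\<in>UNIV. k i)" "k i \<le> (\<Sum>i\<in>UNIV. k i)" for i
    using k(1) by (auto intro!: sum_nonneg member_le_sum simp: less_imp_le)
  have P: "1 \<le> P" "k i \<le> P" "k1 \<le> P" "k2 \<le> P" for i
    using sk(1) sk(2)[of i] k1(1) k2(1) by (auto simp: P_def)
  define Q where "Q \<epsilon> = P * (1 / \<epsilon>) ^ m" for \<epsilon> :: real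
  have Qge: "l * (1 / \<epsilon>) ^ n \<le> Q \<epsilon>" if \<epsilon>: "\<epsilon> \<in> {0<..1}" and l: "l \<le> P" and n: "n \<le> m" for l \<epsilon> n
  proof -
    have "(1 / \<epsilon>) ^ n \<le> (1 / \<epsilon>) ^ m" using \<epsilon> n by (intro power_increasing) auto
    then show ?thesis unfolding Q_def using \<epsilon> l P(1) by (intro mult_mono) auto
  qed
  have Q1: "1 \<le> Q \<epsilon>" if "\<epsilon> \<in> {0<..1}" for \<epsilon> using Qge[OF that P(1), of 0] by simp
  define K where "K = wave_const T c\<^sub>0 (real CARD('n))"
  have "\<exists>u. u \<in> C0_in T H2 H2_norm \<and> u \<in> C1_in T H1 H1_norm \<and> u \<in> C0_in T H1 H1_norm \<and>
      u \<in> C1_in T L2 L2_norm \<and>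
      solves_wave T (\<lambda>i. regularise \<psi> (h i) \<epsilon>) (regularise \<psi> u\<^sub>0 \<epsilon>) (regularise \<psi> u\<^sub>1 \<epsilon>) u \<and>
      (\<forall>t\<in>{0..T}. H2_norm (u t) \<le> K * Q \<epsilon> ^ 3)" if \<epsilon>: "\<epsilon> \<in> {0<..1}" for \<epsilon>
  proof (rule wave_existence[where h = "\<lambda>i. regularise \<psi> (h i) \<epsilon>", OF assms(1) k(2)[OF \<epsilon>] assms(6) assms(7)[OF \<epsilon>] k1(2)[OF \<epsilon>] k2(2)[OF \<epsilon>] Q1[OF \<epsilon>]])
    show "W1inf_norm (regularise \<psi> (h i) \<epsilon>) \<le> Q \<epsilon>" for i
      using k(3)[OF \<epsilon>, of i] Qge[OF \<epsilon> P(2)[of i], of N0] by (simp add: m_def)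
    show "H2_norm (regularise \<psi> u\<^sub>0 \<epsilon>) \<le> Q \<epsilon>"
      using k1(3)[OF \<epsilon>] Qge[OF \<epsilon> P(3), of N1] by (simp add: m_def)
    show "H1_norm (regularise \<psi> u\<^sub>1 \<epsilon>) \<le> Q \<epsilon>"
      using k2(3)[OF \<epsilon>] Qge[OF \<epsilon> P(4), of N2] by (simp add: m_def)
  qed (unfold K_def, blast)
  \<comment> \<open>Moderateness asks for no regularity in \<open>\<epsilon>\<close>, so the
    solutions for different \<open>\<epsilon>\<close> may be chosen independently of each
    other.\<close>
  then obtain u where u: "\<And>\<epsilon>. \<epsilon> \<in> {0<..1} \<Longrightarrow> u \<epsilon> \<in> C0_in T H2 H2_norm \<and> u \<epsilon> \<in> C1_in T H1 H1_norm \<and>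
      u \<epsilon> \<in> C0_in T H1 H1_norm \<and> u \<epsilon> \<in> C1_in T L2 L2_norm \<and>
      solves_wave T (\<lambda>i. regularise \<psi> (h i) \<epsilon>) (regularise \<psi> u\<^sub>0 \<epsilon>) (regularise \<psi> u\<^sub>1 \<epsilon>) (u \<epsilon>) \<and>
      (\<forall>t\<in>{0..T}. H2_norm (u \<epsilon> t) \<le> K * Q \<epsilon> ^ 3)"
    by metis
  have K: "K > 0"
    unfolding K_def wave_const_def using assms(1,6) by (intro add_pos_nonneg) auto
  have "C1_moderate T u"
    unfolding C1_moderate_def
  proof (intro conjI ballI exI)
    show "u \<epsilon> \<in> C0_in T H2 H2_norm \<inter> C1_in T H1 H1_norm" if "\<epsilon> \<in> {0<..1}" for \<epsilon> using u[OF that] by blast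
    show "0 < K * P ^ 3" using K P(1) by simp
    \<comment> \<open>The cubic dependence on \<open>Q\<close> turns the order \<open>m\<close> into
      \<open>m * 3\<close>; the constant involves only \<open>T\<close>, the lower bound, the
      dimension and the constants of the data and coefficients.\<close>
    show "H2_norm (u \<epsilon> t) \<le> K * P ^ 3 * (1 / \<epsilon>) ^ (m * 3)" if "\<epsilon> \<in> {0<..1}" "t \<in> {0..T}" for \<epsilon> t
    proof -
      have "Q \<epsilon> ^ 3 = P ^ 3 * (1 / \<epsilon>) ^ (m * 3)"
        unfolding Q_def power_mult_distrib power_mult ..
      then show ?thesis using u[OF that(1)] that(2) by (simp add: mult.assoc)
    qed
  qed
  moreover have "(\<forall>i. regularisation \<psi> (h i) (regularise \<psi> (h i)) \<and> moderate W1inf W1inf_norm (regularise \<psi> (h i))) \<and>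
      regularisation \<psi> u\<^sub>0 (regularise \<psi> u\<^sub>0) \<and> moderate H2 H2_norm (regularise \<psi> u\<^sub>0) \<and>
      regularisation \<psi> u\<^sub>1 (regularise \<psi> u\<^sub>1) \<and> moderate H1 H1_norm (regularise \<psi> u\<^sub>1) \<and>
      (\<forall>\<epsilon>\<in>{0<..1}. solves_wave T (\<lambda>i. regularise \<psi> (h i) \<epsilon>) (regularise \<psi> u\<^sub>0 \<epsilon>) (regularise \<psi> u\<^sub>1 \<epsilon>) (u \<epsilon>))"
    using N u unfolding regularisation_def moderate_def by blast
  ultimately have "very_weak_solution \<psi> T h u\<^sub>0 u\<^sub>1 u"
    unfolding very_weak_solution_def using u
    by (intro conjI exI[of _ "\<lambda>i. regularise \<psi> (h i)"] exI[of _ "regularise \<psi> u\<^sub>0"] exI[of _ "regularise \<psi> u\<^sub>1"]) blast+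
  then show ?thesis by blast
qed

end
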